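(* Let $\ell_1,\ell_2>0$, $\theta\in(-\pi/2,\pi/2]$, $\nu>0$, and $\beta=\nu+1$ (that is, $\beta=\nu+d/2$ with $d=2$). Let $$\mathbf{R}=\begin{pmatrix}\ell_1\cos\theta & \ell_1\sin\theta\\ -\ell_2\sin\theta & \ell_2\cos\theta\end{pmatrix},$$ and let $\mathcal{W}$ be spatial Gaussian white noise with unit variance on $\mathbb{R}^2$. Then the solution $x(\boldsymbol{w})$ of the stochastic partial differential equation $$\left(1-\nabla\cdot\mathbf{R}^T\mathbf{R}\nabla\right)^{\beta/2}x(\boldsymbol{w})=(\ell_2/\ell_1)^{1/2}\,\mathcal{W}(\boldsymbol{w}),\qquad \boldsymbol{w}\in\mathbb{R}^2,$$ is a Gaussian field with mean zero and anisotropic Mat\'ern covariance function; that is, for some marginal variance $\sigma^2>0$, for all $\boldsymbol{w}_i,\boldsymbol{w}_j\in\mathbb{R}^2$, $$\mathrm{Cov}(x(\boldsymbol{w}_i),x(\boldsymbol{w}_j))=\sigma^2\,\frac{(r_w/\zeta)^{\nu}K_{\nu}(r_w/\zeta)}{2^{\nu-1}\Gamma(\nu)},\qquad \zeta=\frac{\ell_1}{\sqrt{\cos^2(\psi-\theta)+(\ell_1/\ell_2)^2\sin^2(\psi-\theta)}},$$ where $r_w=\Vert\boldsymbol{w}_i-\boldsymbol{w}_j\Vert$ and $\psi$ is the polar angle of $\boldsymbol{w}_i-\boldsymbol{w}_j$, i.e. $\boldsymbol{w}_i-\boldsymbol{w}_j=(r_w\cos\psi,\,r_w\sin\psi)^T$,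 and the value at $r_w=0$ is understood as the limit $\sigma^2$.
   Context: $\Vert\cdot\Vert$ is the Euclidean norm, $\Gamma$ is the gamma function, and $K_\nu$ is the modified Bessel function of the second kind of order $\nu$. Here $\ell_1$ is the correlation length in the direction of angle $\theta$ (measured counter-clockwise from the first coordinate axis), $\ell_2$ is the correlation length in the perpendicular direction, and $\zeta$ is the range parameter in the direction $\psi$. Gaussian field: a real stochastic process $\{x(\boldsymbol{w}):\boldsymbol{w}\in\mathbb{R}^2\}$ such that for every $k\ge 1$ and all $\boldsymbol{w}_1,\dots,\boldsymbol{w}_k$ the vector $[x(\boldsymbol{w}_1),\dots,x(\boldsymbol{w}_k)]^T$ is normally distributed. Its covariance function is $(\boldsymbol{w},\boldsymbol{w}')\mapsto\mathrm{Cov}(x(\boldsymbol{w}),x(\boldsymbol{w}'))$. White noise: for an orthonormal basis $\{\phi_j\}_{j\ge1}$ of $L^2(\mathbb{R}^2)$ (real-valued functions), spatial Gaussian white noise with unit variance is the formal series $\mathcal{W}(\boldsymbol{w})=\sum_{j=1}^\infty \xi_j\phi_j(\boldsymbol{w})$ with $\xi_j$ i.i.d. $\mathcal{N}(0,1)$. For $f\in L^2(\mathbb{R}^2)$, $\int_{\mathbb{R}^2} f(\boldsymbol{v})\mathcal{W}(\boldsymbol{v})\,d\boldsymbol{v}$ denotes the series $\sum_j \xi_j\int_{\mathbb{R}^2} f\phi_j\,d\boldsymbol{v}$ (convergent in mean square). The operator $(1-\nabla\cdot\mathbf{R}^T\mathbf{R}\nabla)^{\beta/2}$ is the Fourier multiplier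 with symbol $(1+\Vert\mathbf{R}\boldsymbol{\omega}\Vert^2)^{\beta/2}$ on tempered distributions. The solution of the equation is the field defined through the Green's function: $$x(\boldsymbol{w})=(\ell_2/\ell_1)^{1/2}\int_{\mathbb{R}^2}g(\boldsymbol{w},\boldsymbol{v})\mathcal{W}(\boldsymbol{v})\,d\boldsymbol{v},$$ where $g(\boldsymbol{w},\boldsymbol{v})=g(\boldsymbol{w}-\boldsymbol{v})$ is the Green's function of the operator, i.e. the tempered distribution satisfying $(1-\nabla\cdot\mathbf{R}^T\mathbf{R}\nabla)^{\beta/2}g=\delta_f$, with $\delta_f$ the Dirac delta at the origin. *)

theory Defs
  imports "HOL-Probability.Probability"
begin

(* DLMF 10.32.9: for z > 0 and every real order nu, integers included,
   K_nu(z) = \<integral>_0^\<infinity> exp (-z cosh t) cosh (nu t) dt. *)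
definition bessel_K :: "real \<Rightarrow> real \<Rightarrow> real" where
  "bessel_K \<nu> z = (LBINT t:{0..}. exp (- z * cosh t) * cosh (\<nu> * t))"

(* sigma2 is the limit of the second branch as r tends to 0 from above. *)
definition matern :: "real \<Rightarrow> real \<Rightarrow> real \<Rightarrow> real \<Rightarrow> real" where
  "matern \<sigma>2 \<nu> \<zeta> r =
     (if r = 0 then \<sigma>2
      else \<sigma>2 * ((r / \<zeta>) powr \<nu> * bessel_K \<nu> (r / \<zeta>)) / (2 powr (\<nu> - 1) * Gamma \<nu>))"


definition L2_fun :: "(real^2 \<Rightarrow> real) \<Rightarrow> bool" where
  "L2_fun f \<longleftrightarrow> f \<in> borel_measurable lborel \<and> integrable lborel (\<lambda>v. (f v)\<^sup>2)"

definition L2_inner :: "(real^2 \<Rightarrow> real) \<Rightarrow> (real^2 \<Rightarrow> real) \<Rightarrow> real" where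
  "L2_inner f h = (\<integral>v. f v * h v \<partial>lborel)"

definition orthonormal_basis_L2 :: "(nat \<Rightarrow> real^2 \<Rightarrow> real) \<Rightarrow> bool" where
  "orthonormal_basis_L2 \<phi> \<longleftrightarrow>
     (\<forall>j. L2_fun (\<phi> j)) \<and>
     (\<forall>i j. L2_inner (\<phi> i) (\<phi> j) = (if i = j then 1 else 0)) \<and>
     (\<forall>f. L2_fun f \<longrightarrow>
        (\<lambda>n. \<integral>v. (f v - (\<Sum>j<n. L2_inner f (\<phi> j) * \<phi> j v))\<^sup>2 \<partial>lborel) \<longlonglongrightarrow> 0)"

(* The formal series \<Sum>j. \<xi> j * \<phi> j has no pointwise value, so white noise is represented by
   its data: the coefficients \<xi> and the basis \<phi>. *)
definition white_noise ::
    "'w measure \<Rightarrow> (nat \<Rightarrow> 'w \<Rightarrow> real) \<Rightarrow> (nat \<Rightarrow> real^2 \<Rightarrow> real) \<Rightarrow> bool" where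
  "white_noise M \<xi> \<phi> \<longleftrightarrow>
     prob_space M \<and>
     prob_space.indep_vars M (\<lambda>_. borel) \<xi> UNIV \<and>
     (\<forall>j. distributed M lborel (\<xi> j) std_normal_density) \<and>
     orthonormal_basis_L2 \<phi>"

(* Y is (a version of) the mean-square sum of the series \<Sum>j. \<xi> j * (\<integral> f \<phi>\<^sub>j). *)
definition white_noise_integral ::
    "'w measure \<Rightarrow> (nat \<Rightarrow> 'w \<Rightarrow> real) \<Rightarrow> (nat \<Rightarrow> real^2 \<Rightarrow> real) \<Rightarrow>
     (real^2 \<Rightarrow> real) \<Rightarrow> ('w \<Rightarrow> real) \<Rightarrow> bool" where
  "white_noise_integral M \<xi> \<phi> f Y \<longleftrightarrow>
     L2_fun f \<and>
     Y \<in> borel_measurable M \<and> integrable M (\<lambda>\<omega>. (Y \<omega>)\<^sup>2) \<and>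
     (\<lambda>n. \<integral>\<omega>. (Y \<omega> - (\<Sum>j<n. \<xi> j \<omega> * L2_inner f (\<phi> j)))\<^sup>2 \<partial>M) \<longlonglongrightarrow> 0"


(* iter_partial [i1, ..., ik] f is the partial derivative of f in the coordinates i1, ..., ik. *)
definition iter_partial :: "2 list \<Rightarrow> (real^2 \<Rightarrow> complex) \<Rightarrow> real^2 \<Rightarrow> complex" where
  "iter_partial is f = foldr (\<lambda>i h x. frechet_derivative h (at x) (axis i 1)) is f"

definition schwartz_space :: "(real^2 \<Rightarrow> complex) set" where
  "schwartz_space =
     {f. \<forall>is. (\<forall>x. iter_partial is f differentiable (at x)) \<and>
              (\<forall>N::nat. bounded (range (\<lambda>x. (1 + norm x) ^ N *\<^sub>R iter_partial is f x)))}"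

definition schwartz_norm :: "nat \<Rightarrow> (real^2 \<Rightarrow> complex) \<Rightarrow> real" where
  "schwartz_norm N f =
     (\<Sum>is | length is \<le> N. SUP x. (1 + norm x) ^ N * norm (iter_partial is f x))"

(* Functionals are total functions; only their values on schwartz_space matter. *)
definition tempered_distribution :: "((real^2 \<Rightarrow> complex) \<Rightarrow> complex) \<Rightarrow> bool" where
  "tempered_distribution T \<longleftrightarrow>
     (\<forall>f\<in>schwartz_space. \<forall>h\<in>schwartz_space. \<forall>a b.
        T (\<lambda>x. a * f x + b * h x) = a * T f + b * T h) \<and>
     (\<exists>N C. \<forall>f\<in>schwartz_space. norm (T f) \<le> C * schwartz_norm N f)"

(* Angular-frequency convention: partial derivatives become multiplication by \<i> * (\<omega> $ i),
   so - \<nabla> \<cdot> R\<^sup>T R \<nabla> has symbol (norm (R *v \<omega>))\<^sup>2. *)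
definition fourier :: "(real^2 \<Rightarrow> complex) \<Rightarrow> real^2 \<Rightarrow> complex" where
  "fourier f \<omega> = (\<integral>x. cis (- (\<omega> \<bullet> x)) * f x \<partial>lborel)"

definition inverse_fourier :: "(real^2 \<Rightarrow> complex) \<Rightarrow> real^2 \<Rightarrow> complex" where
  "inverse_fourier f x = of_real (1 / (2 * pi)\<^sup>2) * (\<integral>\<omega>. cis (\<omega> \<bullet> x) * f \<omega> \<partial>lborel)"

definition fourier_dist ::
    "((real^2 \<Rightarrow> complex) \<Rightarrow> complex) \<Rightarrow> (real^2 \<Rightarrow> complex) \<Rightarrow> complex" where
  "fourier_dist T = (\<lambda>f. T (fourier f))"

definition inverse_fourier_dist ::
    "((real^2 \<Rightarrow> complex) \<Rightarrow> complex) \<Rightarrow> (real^2 \<Rightarrow> complex) \<Rightarrow> complex" where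
  "inverse_fourier_dist T = (\<lambda>f. T (inverse_fourier f))"

definition mult_dist ::
    "(real^2 \<Rightarrow> complex) \<Rightarrow> ((real^2 \<Rightarrow> complex) \<Rightarrow> complex) \<Rightarrow> (real^2 \<Rightarrow> complex) \<Rightarrow> complex" where
  "mult_dist s T = (\<lambda>f. T (\<lambda>\<omega>. s \<omega> * f \<omega>))"

definition fourier_multiplier ::
    "(real^2 \<Rightarrow> complex) \<Rightarrow> ((real^2 \<Rightarrow> complex) \<Rightarrow> complex) \<Rightarrow> (real^2 \<Rightarrow> complex) \<Rightarrow> complex" where
  "fourier_multiplier s T = inverse_fourier_dist (mult_dist s (fourier_dist T))"

(* (1 - \<nabla> \<cdot> R\<^sup>T R \<nabla>) to the power \<beta>/2 *)
definition spde_operator ::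
    "real^2^2 \<Rightarrow> real \<Rightarrow> ((real^2 \<Rightarrow> complex) \<Rightarrow> complex) \<Rightarrow> (real^2 \<Rightarrow> complex) \<Rightarrow> complex" where
  "spde_operator R \<beta> =
     fourier_multiplier (\<lambda>\<omega>. of_real ((1 + (norm (R *v \<omega>))\<^sup>2) powr (\<beta> / 2)))"

definition dirac :: "(real^2 \<Rightarrow> complex) \<Rightarrow> complex" where
  "dirac f = f 0"

definition greens_distribution ::
    "real^2^2 \<Rightarrow> real \<Rightarrow> ((real^2 \<Rightarrow> complex) \<Rightarrow> complex) \<Rightarrow> bool" where
  "greens_distribution R \<beta> T \<longleftrightarrow>
     tempered_distribution T \<and> (\<forall>f\<in>schwartz_space. spde_operator R \<beta> T f = dirac f)"

definition distribution_of :: "(real^2 \<Rightarrow> real) \<Rightarrow> (real^2 \<Rightarrow> complex) \<Rightarrow> complex" where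
  "distribution_of g f = (\<integral>v. of_real (g v) * f v \<partial>lborel)"

definition greens_function :: "real^2^2 \<Rightarrow> real \<Rightarrow> (real^2 \<Rightarrow> real) \<Rightarrow> bool" where
  "greens_function R \<beta> g \<longleftrightarrow> L2_fun g \<and> greens_distribution R \<beta> (distribution_of g)"

definition spde_solution ::
    "'w measure \<Rightarrow> (nat \<Rightarrow> 'w \<Rightarrow> real) \<Rightarrow> (nat \<Rightarrow> real^2 \<Rightarrow> real) \<Rightarrow>
     real^2^2 \<Rightarrow> real \<Rightarrow> real \<Rightarrow> (real^2 \<Rightarrow> 'w \<Rightarrow> real) \<Rightarrow> bool" where
  "spde_solution M \<xi> \<phi> R \<beta> c x \<longleftrightarrow>
     (\<exists>g. greens_function R \<beta> g \<and>
        (\<forall>w. \<exists>Y. white_noise_integral M \<xi> \<phi> (\<lambda>v. g (w - v)) Y \<and> x w = (\<lambda>\<omega>. c * Y \<omega>)))"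


(* Almost surely constant variables count as normal (variance 0): a vector with normal
   distribution may have a singular covariance matrix, e.g. when its entries repeat. *)
definition normal_variable :: "'w measure \<Rightarrow> ('w \<Rightarrow> real) \<Rightarrow> bool" where
  "normal_variable M X \<longleftrightarrow>
     X \<in> borel_measurable M \<and>
     (\<exists>\<mu> \<sigma>. \<sigma> \<ge> 0 \<and>
        (if \<sigma> = 0 then AE \<omega> in M. X \<omega> = \<mu> else distributed M lborel X (normal_density \<mu> \<sigma>)))"

definition normal_vector :: "'w measure \<Rightarrow> nat \<Rightarrow> (nat \<Rightarrow> 'w \<Rightarrow> real) \<Rightarrow> bool" where
  "normal_vector M k X \<longleftrightarrow>
     (\<forall>i<k. X i \<in> borel_measurable M) \<and>
     (\<forall>a::nat \<Rightarrow> real. normal_variable M (\<lambda>\<omega>. \<Sum>i<k. a i * X i \<omega>))"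

definition gaussian_field :: "'w measure \<Rightarrow> (real^2 \<Rightarrow> 'w \<Rightarrow> real) \<Rightarrow> bool" where
  "gaussian_field M x \<longleftrightarrow> (\<forall>k\<ge>1. \<forall>w::nat \<Rightarrow> real^2. normal_vector M k (\<lambda>i. x (w i)))"

definition covariance :: "'w measure \<Rightarrow> ('w \<Rightarrow> real) \<Rightarrow> ('w \<Rightarrow> real) \<Rightarrow> real" where
  "covariance M X Y =
     (\<integral>\<omega>. (X \<omega> - (\<integral>\<omega>'. X \<omega>' \<partial>M)) * (Y \<omega> - (\<integral>\<omega>'. Y \<omega>' \<partial>M)) \<partial>M)"

end

theory Submission
  imports Defs
begin

text \<open>The Green's function can be written down. Put \<open>b = \<beta> / 2\<close>. At a frequency \<open>\<omega>\<close> with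
\<open>q = |R \<omega>|\<^sup>2\<close>, the reciprocal \<open>(1 + q) powr (- b)\<close> of the symbol is a Laplace transform: it is
the mean of \<open>exp (- t q)\<close> over a random time t with the gamma distribution of shape b. Since
\<open>exp (- t q)\<close> is the Fourier transform of a Gaussian (\<open>heat t\<close> below), the same mean of Gaussians,
\<open>kernel b\<close>, has the reciprocal of the symbol as its Fourier transform, and so it is a Green's function
(\<open>greens_function_kernel\<close>).

Its autocorrelation comes from the same picture. Two Gaussians convolve to the one whose time is
the sum of their times, and the sum of two independent gamma times of shape b is a gamma time of
shape \<open>2 b = \<nu> + 1\<close>; hence the autocorrelation of \<open>kernel b\<close> is \<open>kernel (\<nu> + 1)\<close>
(\<open>kernel_autocorrelation\<close>), which is finite at the origin because \<open>\<nu> > 0\<close>. What is left is an integral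
over t, and the substitution \<open>t = (z / 2) exp s\<close> turns it into the integral that defines the Bessel
function at z, the length of the displacement after multiplication by the inverse transpose of R
(\<open>kernel_eq_bessel_K\<close>). Rotated to the principal axes, z is \<open>r / \<zeta>\<close>.

A solution may be built from any Green's function, so uniqueness is needed too. A gamma mixture
of Gaussians with times at least \<open>\<epsilon> > 0\<close> is a Schwartz function (\<open>mixture_schwartz\<close>), and on it the
operator acts, in the sense of duality, by returning \<open>heat \<epsilon>\<close>. The equation therefore prescribes the
means of a Green's function against all Gaussians, and as the Gaussians shrink to points these
determine it almost everywhere (\<open>greens_function_unique\<close>). That \<open>kernel b\<close> satisfies the equation
against every Schwartz function rests on two facts about inverse Fourier transforms of Schwartz
functions: they decay faster than any power, and their integral is the value of the function at
the origin (\<open>integral_inverse_fourier\<close>).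

The stochastic part is Hilbert space geometry. The coefficients \<open>\<xi>\<close> are orthonormal on the probability
space as the basis \<open>\<phi>\<close> is on the plane, so integration against white noise preserves inner products
(\<open>white_noise_integral_covariance\<close>); it is linear, every square-integrable function has an integral
(\<open>white_noise_integral_exists\<close>), and the integrals are normal as mean-square limits of normal sums
(\<open>white_noise_integral_normal\<close>). Covariances of a solution are thus \<open>l2 / l1\<close> times autocorrelations of
the Green's function.\<close>

section \<open>Lebesgue measure on the plane\<close>

text \<open>A measure on the plane is determined by its values on boxes. The preimage of a box under B is
its image under the inverse matrix, whose area is known.\<close>

lemma lborel_linear_substitution:
  fixes B :: "real^2^2"
  assumes "det B \<noteq> 0"
  shows "(lborel :: (real^2) measure) = density (distr lborel borel ((*v) B)) (\<lambda>_. ennreal \<bar>det B\<bar>)"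
proof (rule lborel_eqI)
  fix l u :: "real^2"
  assume le: "\<And>b. b \<in> Basis \<Longrightarrow> l \<bullet> b \<le> u \<bullet> b"
  have "invertible B" using assms by (simp add: invertible_det_nz)
  then obtain C where CB: "C ** B = mat 1" and BC: "B ** C = mat 1"
    unfolding invertible_def by blast
  have vim: "(*v) B -` box l u = (*v) C ` box l u"
  proof (intro set_eqI iffI)
    fix x assume "x \<in> (*v) B -` box l u"
    then show "x \<in> (*v) C ` box l u"
      by (intro image_eqI[of _ _ "B *v x"]) (auto simp: matrix_vector_mul_assoc CB)
  qed (auto simp: matrix_vector_mul_assoc BC)
  have lin: "linear ((*v) C)" by simp
  have detC: "\<bar>det B\<bar> * \<bar>det C\<bar> = 1"
    using BC by (metis abs_mult abs_one det_I det_mul)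
  have B_meas[measurable]: "(*v) B \<in> borel_measurable borel"
    by (intro borel_measurable_continuous_onI matrix_vector_mult_linear_continuous_on)
  have boxm: "box l u \<in> lmeasurable" by simp
  have img: "(*v) C ` box l u \<in> sets borel"
    unfolding vim[symmetric] using measurable_sets[OF B_meas, of "box l u"] by simp
  have fin: "(*v) C ` box l u \<in> lmeasurable"
    by (rule measurable_linear_image[OF lin boxm])
  have "emeasure lborel ((*v) C ` box l u) = emeasure lebesgue ((*v) C ` box l u)"
    using img by (simp add: emeasure_completion)
  also have "\<dots> = ennreal (measure lebesgue ((*v) C ` box l u))"
    using fin by (metis emeasure_eq_measure2)
  also have "\<dots> = ennreal (\<bar>det C\<bar> * measure lebesgue (box l u))"
    using measure_linear_image[OF lin boxm] by simp
  also have "measure lebesgue (box l u) = (\<Prod>b\<in>Basis. (u - l) \<bullet> b)"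
    using le by (simp add: measure_lborel_box_eq)
  finally have em: "emeasure lborel ((*v) C ` box l u) = ennreal (\<bar>det C\<bar> * (\<Prod>b\<in>Basis. (u - l) \<bullet> b))" .
  have "emeasure (density (distr lborel borel ((*v) B)) (\<lambda>_. ennreal \<bar>det B\<bar>)) (box l u)
      = ennreal \<bar>det B\<bar> * emeasure lborel ((*v) C ` box l u)"
    by (simp add: emeasure_density_const emeasure_distr vim)
  also have "\<dots> = ennreal (\<bar>det B\<bar> * (\<bar>det C\<bar> * (\<Prod>b\<in>Basis. (u - l) \<bullet> b)))"
    unfolding em by (rule ennreal_mult'[symmetric]) simp
  finally show "emeasure (density (distr lborel borel ((*v) B)) (\<lambda>_. ennreal \<bar>det B\<bar>)) (box l u) = (\<Prod>b\<in>Basis. (u - l) \<bullet> b)"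
    using detC by (simp add: mult.assoc[symmetric])
qed simp

lemma measurable_mult_vec[measurable]: "(*v) (B :: real^2^2) \<in> borel_measurable borel"
  by (intro borel_measurable_continuous_onI matrix_vector_mult_linear_continuous_on)

lemma has_bochner_integral_linear_substitution:
  fixes B :: "real^2^2" and f :: "real^2 \<Rightarrow> 'b::{banach, second_countable_topology}"
  assumes "det B \<noteq> 0" and [measurable]: "f \<in> borel_measurable borel"
    and "has_bochner_integral lborel (\<lambda>u. f (B *v u)) a"
  shows "has_bochner_integral lborel f (\<bar>det B\<bar> *\<^sub>R a)"
proof -
  have "has_bochner_integral (distr lborel borel ((*v) B)) f a"
    using assms(3) by (intro has_bochner_integral_distr) simp_all
  then have "has_bochner_integral (distr lborel borel ((*v) B)) (\<lambda>x. \<bar>det B\<bar> *\<^sub>R f x) (\<bar>det B\<bar> *\<^sub>R a)"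
    by (rule has_bochner_integral_scaleR_right)
  then have "has_bochner_integral (density (distr lborel borel ((*v) B)) (\<lambda>_. ennreal \<bar>det B\<bar>)) f (\<bar>det B\<bar> *\<^sub>R a)"
    by (intro has_bochner_integral_density) simp_all
  then show ?thesis
    using lborel_linear_substitution[OF assms(1)] by simp
qed

lemma prod_Basis_2:
  fixes f :: "real^2 \<Rightarrow> real"
  shows "(\<Prod>b\<in>(Basis :: (real^2) set). f b) = f (axis 1 1) * f (axis 2 1)"
proof -
  have basis: "(Basis :: (real^2) set) = {axis 1 1, axis 2 1}"
    by (auto simp: Basis_vec_def UNIV_2)
  have "axis 1 1 \<noteq> (axis 2 1 :: real^2)"
    by (simp add: axis_eq_axis)
  then show ?thesis
    unfolding basis by (subst prod.insert) auto
qed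

lemma vec_pair_measurable[measurable]:
  "(\<lambda>p::real\<times>real. vector [fst p, snd p] :: real^2) \<in> borel_measurable borel"
proof -
  have "(\<lambda>p::real\<times>real. vector [fst p, snd p] :: real^2) = (\<lambda>p. fst p *\<^sub>R axis 1 1 + snd p *\<^sub>R axis 2 1)"
    by (auto simp: vec_eq_iff forall_2 axis_def)
  then show ?thesis
    by (auto intro!: borel_measurable_continuous_onI continuous_intros)
qed

text \<open>Identifying the plane with a product of two lines makes Fubini's theorem available for functions
of vectors.\<close>

lemma lborel_eq_distr_vec_pair:
  "distr (lborel :: (real \<times> real) measure) borel (\<lambda>p. vector [fst p, snd p]) = (lborel :: (real^2) measure)"
proof (rule lborel_eqI[symmetric])
  fix l u :: "real^2"
  assume le: "\<And>b. b \<in> Basis \<Longrightarrow> l \<bullet> b \<le> u \<bullet> b"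
  have le12: "l $ i \<le> u $ i" for i
    using le[of "axis i 1"] by (simp add: cart_eq_inner_axis axis_in_Basis_iff)
  have "(\<lambda>p::real\<times>real. vector [fst p, snd p] :: real^2) -` box l u = {l$1<..<u$1} \<times> {l$2<..<u$2}"
    by (auto simp: mem_box_cart forall_2)
  then have "emeasure (distr (lborel :: (real \<times> real) measure) borel (\<lambda>p. vector [fst p, snd p])) (box l u)
     = emeasure (lborel \<Otimes>\<^sub>M lborel) ({l$1<..<u$1} \<times> {l$2<..<u$2})"
    by (simp add: emeasure_distr lborel_prod)
  also have "\<dots> = ennreal (u$1 - l$1) * ennreal (u$2 - l$2)"
    using le12 by (subst lborel.emeasure_pair_measure_Times) auto
  also have "\<dots> = (\<Prod>b\<in>Basis. (u - l) \<bullet> b)"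
    using le12 by (simp add: prod_Basis_2 ennreal_mult' cart_eq_inner_axis[symmetric])
  finally show "emeasure (distr (lborel :: (real \<times> real) measure) borel (\<lambda>p. vector [fst p, snd p])) (box l u) = (\<Prod>b\<in>Basis. (u - l) \<bullet> b)" .
qed simp

lemma has_bochner_integral_product_2:
  fixes f g :: "real \<Rightarrow> 'b::{real_normed_field, banach, second_countable_topology}"
  assumes f: "has_bochner_integral lborel f a" and g: "has_bochner_integral lborel g b"
  shows "has_bochner_integral (lborel :: (real^2) measure) (\<lambda>x. f (x$1) * g (x$2)) (a * b)"
proof -
  have fi: "integrable lborel f" "integral\<^sup>L lborel f = a" and gi: "integrable lborel g" "integral\<^sup>L lborel g = b"
    using f g by (simp_all add: has_bochner_integral_iff)
  have [measurable]: "f \<in> borel_measurable borel" "g \<in> borel_measurable borel"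
    using fi(1) gi(1) borel_measurable_integrable by force+
  have int: "integrable (lborel \<Otimes>\<^sub>M lborel) (\<lambda>(x, y). f x * g y)"
  proof (rule lborel_pair.Fubini_integrable)
    show "integrable lborel (\<lambda>x. \<integral>y. norm (case (x, y) of (x, y) \<Rightarrow> f x * g y) \<partial>lborel)"
      using fi(1) by (simp add: norm_mult)
    show "AE x in lborel. integrable lborel (\<lambda>y. case (x, y) of (x, y) \<Rightarrow> f x * g y)"
      using gi(1) by simp
  qed simp
  have "integral\<^sup>L (lborel \<Otimes>\<^sub>M lborel) (\<lambda>(x, y). f x * g y) = (\<integral>x. \<integral>y. f x * g y \<partial>lborel \<partial>lborel)"
    using lborel_pair.integral_fst[OF int] by simp
  also have "\<dots> = a * b"
    using fi gi by simp
  finally have "has_bochner_integral lborel (\<lambda>p. f (fst p) * g (snd p)) (a * b)"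
    using int by (simp add: has_bochner_integral_iff lborel_prod case_prod_unfold)
  then have "has_bochner_integral (distr (lborel :: (real\<times>real) measure) borel (\<lambda>p. vector [fst p, snd p] :: real^2)) (\<lambda>x. f (x$1) * g (x$2)) (a * b)"
    by (intro has_bochner_integral_distr) simp_all
  then show ?thesis by (simp add: lborel_eq_distr_vec_pair)
qed

section \<open>The anisotropic heat kernel\<close>

lemma cis_measurable [measurable]: "cis \<in> borel_measurable borel"
  by (intro borel_measurable_continuous_onI continuous_intros)

text \<open>A is the inverse transpose of R: frequencies are stretched by R, displacements by A. Keeping A as a
parameter avoids an explicit matrix inverse until R is known in coordinates.\<close>

locale anisotropy =
  fixes R A :: "real^2^2"
  assumes transpose_R_A: "transpose R ** A = mat 1"
begin

lemma A_transpose_R: "A ** transpose R = mat 1"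
  using transpose_R_A by (simp add: matrix_left_right_inverse)

lemma R_transpose_A: "R ** transpose A = mat 1"
  by (metis A_transpose_R matrix_transpose_mul transpose_mat transpose_transpose)

lemma det_R_A: "det R * det A = 1"
  using transpose_R_A by (metis det_I det_mul det_transpose)

lemma det_R: "det R \<noteq> 0"
  using det_R_A by auto

lemma A_cancel [simp]: "A *v (u v* R) = u"
  by (metis A_transpose_R matrix_vector_mul_assoc matrix_vector_mul_lid transpose_matrix_vector)

lemma R_cancel [simp]: "R *v (u v* A) = u"
  by (metis R_transpose_A matrix_vector_mul_assoc matrix_vector_mul_lid transpose_matrix_vector)

text \<open>The density of the centred normal distribution with covariance matrix \<open>2 t\<close> times
\<open>transpose R ** R\<close>.\<close>

definition heat :: "real \<Rightarrow> real^2 \<Rightarrow> real" where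
  "heat t x = exp (- (norm (A *v x))\<^sup>2 / (4 * t)) / (4 * pi * t * \<bar>det R\<bar>)"

lemma heat_measurable [measurable]:
  "(\<lambda>(t, x). heat t x) \<in> borel_measurable (borel \<Otimes>\<^sub>M borel)"
  unfolding heat_def by measurable

lemma heat_measurable_space [measurable]: "heat t \<in> borel_measurable borel"
  unfolding heat_def by measurable

lemma heat_pos: "t > 0 \<Longrightarrow> heat t x > 0"
  using det_R by (simp add: heat_def)

lemma heat_minus: "heat t (a - b) = heat t (b - a)"
  by (simp add: heat_def matrix_vector_mult_diff_distrib norm_minus_commute)

end

lemma norm_2_power2: "(norm (x :: real^2))\<^sup>2 = (x$1)\<^sup>2 + (x$2)\<^sup>2"
  by (simp add: norm_vec_def L2_set_def sum_2)

lemma inner_2: "(x :: real^2) \<bullet> y = x$1 * y$1 + x$2 * y$2"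
  by (simp add: inner_vec_def sum_2)

text \<open>The characteristic function of the standard normal distribution, rescaled.\<close>

lemma fourier_normal_density:
  assumes t: "t > 0"
  shows "has_bochner_integral lborel
    (\<lambda>u. cis (- (k * u)) * complex_of_real (normal_density 0 (sqrt (2 * t)) u))
    (complex_of_real (exp (- t * k\<^sup>2)))"
proof -
  let ?c = "sqrt (2 * t)"
  have c: "?c > 0" "?c \<noteq> 0" using t by auto
  have int: "integrable std_normal_distribution (\<lambda>x. iexp ((- k * ?c) * x))"
    by (intro prob_space.integrable_iexp) (auto simp: prob_space_normal_density)
  have "has_bochner_integral std_normal_distribution (\<lambda>x. iexp ((- k * ?c) * x))
      (complex_of_real (exp (- ((- k * ?c)\<^sup>2) / 2)))"
    using int fun_cong[OF char_std_normal_distribution, of "- k * ?c"]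
    unfolding has_bochner_integral_iff char_def by blast
  then have "has_bochner_integral lborel (\<lambda>x. std_normal_density x *\<^sub>R iexp ((- k * ?c) * x))
      (complex_of_real (exp (- t * k\<^sup>2)))"
    using t by (simp add: has_bochner_integral_iff integrable_density integral_density power_mult_distrib mult.commute)
  also have "(\<lambda>x. std_normal_density x *\<^sub>R iexp ((- k * ?c) * x)) =
     (\<lambda>x. ?c *\<^sub>R (cis (- (k * (0 + ?c * x))) * complex_of_real (normal_density 0 ?c (0 + ?c * x))))"
    using t by (auto simp: fun_eq_iff std_normal_density_def normal_density_def cis_conv_exp scaleR_conv_of_real
        real_sqrt_mult power_mult_distrib field_simps of_real_mult[symmetric] simp del: of_real_mult)
  finally have "has_bochner_integral lborel (\<lambda>x. inverse ?c *\<^sub>R (?c *\<^sub>R (cis (- (k * (0 + ?c * x))) * complex_of_real (normal_density 0 ?c (0 + ?c * x)))))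
    (inverse ?c *\<^sub>R complex_of_real (exp (- t * k\<^sup>2)))"
    by (rule has_bochner_integral_scaleR_right)
  then show ?thesis
    using c by (subst lborel_has_bochner_integral_real_affine_iff[of ?c _ _ 0]) (simp_all add: divide_inverse)
qed

lemma convolution_normal_density:
  assumes "\<sigma> > 0" "\<tau> > 0"
  shows "has_bochner_integral lborel
    (\<lambda>x. normal_density 0 \<sigma> (a - x) * normal_density 0 \<tau> (b - x))
    (normal_density 0 (sqrt (\<sigma>\<^sup>2 + \<tau>\<^sup>2)) (a - b))"
proof (rule has_bochner_integral_nn_integral)
  have "(\<integral>\<^sup>+ x. ennreal (normal_density 0 \<sigma> (a - x) * normal_density 0 \<tau> (b - x)) \<partial>lborel)
      = (\<integral>\<^sup>+ y. ennreal (normal_density 0 \<sigma> (a - (b + 1 * y)) * normal_density 0 \<tau> (b - (b + 1 * y))) \<partial>lborel)"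
    by (subst nn_integral_real_affine[where c=1 and t=b]) simp_all
  also have "\<dots> = (\<integral>\<^sup>+ y. ennreal (normal_density 0 \<sigma> ((a - b) - y) * normal_density 0 \<tau> y) \<partial>lborel)"
    by (simp add: normal_density_def algebra_simps)
  finally show "(\<integral>\<^sup>+ x. ennreal (normal_density 0 \<sigma> (a - x) * normal_density 0 \<tau> (b - x)) \<partial>lborel)
      = ennreal (normal_density 0 (sqrt (\<sigma>\<^sup>2 + \<tau>\<^sup>2)) (a - b))"
    using fun_cong[OF conv_normal_density_zero_mean[OF assms], of "a - b"] by simp
qed simp_all

context anisotropy
begin

text \<open>In the coordinates \<open>A x\<close> the variables separate. This reduces all Gaussian integrals over the plane
to integrals over the line.\<close>

lemma heat_eq_normal_density:
  assumes t: "t > 0"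
  shows "heat t x = normal_density 0 (sqrt (2 * t)) ((A *v x)$1) * normal_density 0 (sqrt (2 * t)) ((A *v x)$2) / \<bar>det R\<bar>"
  using t by (simp add: heat_def normal_density_def norm_2_power2 exp_add[symmetric] field_simps)

lemma fourier_heat:
  assumes t: "t > 0"
  shows "has_bochner_integral lborel (\<lambda>x. cis (- (\<omega> \<bullet> x)) * complex_of_real (heat t x))
    (complex_of_real (exp (- t * (norm (R *v \<omega>))\<^sup>2)))"
proof -
  let ?n = "normal_density 0 (sqrt (2 * t))" and ?k = "R *v \<omega>"
  let ?e = "\<lambda>k. complex_of_real (exp (- t * k\<^sup>2))"
  have "has_bochner_integral lborel
     (\<lambda>u::real^2. (cis (- (?k$1 * u$1)) * ?n (u$1)) * (cis (- (?k$2 * u$2)) * ?n (u$2)) / \<bar>det R\<bar>)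
     (?e (?k$1) * ?e (?k$2) / \<bar>det R\<bar>)"
    by (intro has_bochner_integral_divide_zero has_bochner_integral_product_2 fourier_normal_density t)
  also have "(\<lambda>u::real^2. (cis (- (?k$1 * u$1)) * ?n (u$1)) * (cis (- (?k$2 * u$2)) * ?n (u$2)) / \<bar>det R\<bar>)
      = (\<lambda>u. cis (- (\<omega> \<bullet> (transpose R *v u))) * heat t (transpose R *v u))"
  proof
    fix u :: "real^2"
    have "\<omega> \<bullet> (transpose R *v u) = ?k \<bullet> u"
      by (metis dot_lmul_matrix inner_commute transpose_matrix_vector)
    then show "(cis (- (?k$1 * u$1)) * ?n (u$1)) * (cis (- (?k$2 * u$2)) * ?n (u$2)) / \<bar>det R\<bar>
      = cis (- (\<omega> \<bullet> (transpose R *v u))) * heat t (transpose R *v u)"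
      using t by (simp add: heat_eq_normal_density inner_2[of ?k] cis_mult)
  qed
  finally have "has_bochner_integral lborel (\<lambda>x. cis (- (\<omega> \<bullet> x)) * complex_of_real (heat t x))
     (\<bar>det (transpose R)\<bar> *\<^sub>R (?e (?k$1) * ?e (?k$2) / \<bar>det R\<bar>))"
    by (intro has_bochner_integral_linear_substitution) (use det_R in auto)
  also have "\<bar>det (transpose R)\<bar> *\<^sub>R (?e (?k$1) * ?e (?k$2) / \<bar>det R\<bar>) = complex_of_real (exp (- t * (norm (R *v \<omega>))\<^sup>2))"
  proof -
    have "\<bar>det (transpose R)\<bar> * (exp (- t * (?k$1)\<^sup>2) * exp (- t * (?k$2)\<^sup>2) / \<bar>det R\<bar>) = exp (- t * (norm ?k)\<^sup>2)"
      using det_R by (simp add: norm_2_power2 distrib_left mult_exp_exp)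
    then show ?thesis
      by (simp only: scaleR_conv_of_real of_real_mult[symmetric] of_real_divide[symmetric])
  qed
  finally show ?thesis .
qed

text \<open>The computation of \<open>fourier_heat\<close> with space and frequency exchanged: a Gaussian in frequency with
time t is a normal density with time \<open>1 / (4 t)\<close>, up to a constant.\<close>

lemma fourier_gaussian:
  assumes t: "t > 0"
  shows "has_bochner_integral lborel (\<lambda>\<omega>. cis (- (\<omega> \<bullet> x)) * complex_of_real (exp (- t * (norm (R *v \<omega>))\<^sup>2)))
    (complex_of_real ((2 * pi)\<^sup>2 * heat t x))"
proof -
  let ?s = "1 / (4 * t)"
  let ?n = "normal_density 0 (sqrt (2 * ?s))" and ?k = "A *v x"
  let ?e = "\<lambda>k. complex_of_real (exp (- ?s * k\<^sup>2))"
  have s: "?s > 0" using t by simp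
  have "has_bochner_integral lborel
     (\<lambda>u::real^2. (pi / t) *\<^sub>R ((cis (- (?k$1 * u$1)) * ?n (u$1)) * (cis (- (?k$2 * u$2)) * ?n (u$2))))
     ((pi / t) *\<^sub>R (?e (?k$1) * ?e (?k$2)))"
    by (intro has_bochner_integral_scaleR_right has_bochner_integral_product_2 fourier_normal_density s)
  also have "(\<lambda>u::real^2. (pi / t) *\<^sub>R ((cis (- (?k$1 * u$1)) * ?n (u$1)) * (cis (- (?k$2 * u$2)) * ?n (u$2))))
      = (\<lambda>u. cis (- ((transpose A *v u) \<bullet> x)) * complex_of_real (exp (- t * (norm (R *v (transpose A *v u)))\<^sup>2)))"
  proof
    fix u :: "real^2"
    have *: "(u v* A) \<bullet> x = ?k \<bullet> u"
      by (metis dot_lmul_matrix inner_commute)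
    have "(pi / t) * (?n (u$1) * ?n (u$2)) = exp (- t * (norm u)\<^sup>2)"
      using t by (simp add: normal_density_def norm_2_power2 distrib_left exp_add[symmetric] mult_exp_exp field_simps)
    then have "complex_of_real (exp (- t * (norm u)\<^sup>2)) = (pi / t) *\<^sub>R complex_of_real (?n (u$1) * ?n (u$2))"
      by (simp only: scaleR_conv_of_real of_real_mult[symmetric])
    then show "(pi / t) *\<^sub>R ((cis (- (?k$1 * u$1)) * ?n (u$1)) * (cis (- (?k$2 * u$2)) * ?n (u$2)))
      = cis (- ((transpose A *v u) \<bullet> x)) * complex_of_real (exp (- t * (norm (R *v (transpose A *v u)))\<^sup>2))"
      by (simp add: * inner_2[of ?k] cis_mult)
  qed
  finally have "has_bochner_integral lborel (\<lambda>\<omega>. cis (- (\<omega> \<bullet> x)) * complex_of_real (exp (- t * (norm (R *v \<omega>))\<^sup>2)))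
     (\<bar>det (transpose A)\<bar> *\<^sub>R ((pi / t) *\<^sub>R (?e (?k$1) * ?e (?k$2))))"
    by (intro has_bochner_integral_linear_substitution) (use det_R_A in auto)
  also have "\<bar>det (transpose A)\<bar> *\<^sub>R ((pi / t) *\<^sub>R (?e (?k$1) * ?e (?k$2))) = complex_of_real ((2 * pi)\<^sup>2 * heat t x)"
  proof -
    have a: "\<bar>det (transpose A)\<bar> = 1 / \<bar>det R\<bar>"
      using det_R_A det_R by (simp add: field_simps abs_mult[symmetric])
    have "exp (- ?s * (?k$1)\<^sup>2) * exp (- ?s * (?k$2)\<^sup>2) = exp (- (norm ?k)\<^sup>2 / (4 * t))"
      using t by (simp add: norm_2_power2 mult_exp_exp field_simps)
    then have "\<bar>det (transpose A)\<bar> * ((pi / t) * (exp (- ?s * (?k$1)\<^sup>2) * exp (- ?s * (?k$2)\<^sup>2))) = (2 * pi)\<^sup>2 * heat t x"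
      unfolding a heat_def using t det_R by (simp add: field_simps power2_eq_square)
    then show ?thesis
      by (simp only: scaleR_conv_of_real of_real_mult[symmetric])
  qed
  finally show ?thesis .
qed

text \<open>Variances of independent normal variables add.\<close>

lemma heat_convolution:
  assumes t: "t > 0" and s: "s > 0"
  shows "has_bochner_integral lborel (\<lambda>v. heat t (a - v) * heat s (b - v)) (heat (t + s) (a - b))"
proof -
  let ?n = "\<lambda>t. normal_density 0 (sqrt (2 * t))" and ?a = "A *v a" and ?b = "A *v b"
  let ?d = "\<bar>det R\<bar>"
  have sq: "sqrt ((sqrt (2 * t))\<^sup>2 + (sqrt (2 * s))\<^sup>2) = sqrt (2 * (t + s))"
    using t s by simp
  have "has_bochner_integral lborel
     (\<lambda>u::real^2. (?n t (?a$1 - u$1) * ?n s (?b$1 - u$1)) * (?n t (?a$2 - u$2) * ?n s (?b$2 - u$2)) / ?d\<^sup>2)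
     ((?n (t + s) (?a$1 - ?b$1) * ?n (t + s) (?a$2 - ?b$2)) / ?d\<^sup>2)"
    unfolding sq[symmetric]
    by (intro has_bochner_integral_divide_zero has_bochner_integral_product_2 convolution_normal_density)
       (use t s in auto)
  also have "(\<lambda>u::real^2. (?n t (?a$1 - u$1) * ?n s (?b$1 - u$1)) * (?n t (?a$2 - u$2) * ?n s (?b$2 - u$2)) / ?d\<^sup>2)
      = (\<lambda>u. heat t (a - transpose R *v u) * heat s (b - transpose R *v u))"
    using t s by (simp add: heat_eq_normal_density matrix_vector_mult_diff_distrib power2_eq_square field_simps)
  finally have "has_bochner_integral lborel (\<lambda>v. heat t (a - v) * heat s (b - v))
     (\<bar>det (transpose R)\<bar> *\<^sub>R ((?n (t + s) (?a$1 - ?b$1) * ?n (t + s) (?a$2 - ?b$2)) / ?d\<^sup>2))"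
    by (intro has_bochner_integral_linear_substitution) (use det_R in auto)
  also have "\<bar>det (transpose R)\<bar> *\<^sub>R ((?n (t + s) (?a$1 - ?b$1) * ?n (t + s) (?a$2 - ?b$2)) / ?d\<^sup>2) = heat (t + s) (a - b)"
    using t s det_R by (simp add: heat_eq_normal_density matrix_vector_mult_diff_distrib power2_eq_square del: abs_mult_self_eq)
  finally show ?thesis .
qed

end

section \<open>Gamma mixtures of heat kernels\<close>

definition gamma_density :: "real \<Rightarrow> real \<Rightarrow> real" where
  "gamma_density b t = (if t > 0 then t powr (b - 1) * exp (- t) / Gamma b else 0)"

lemma gamma_density_measurable [measurable]: "gamma_density b \<in> borel_measurable borel"
  unfolding gamma_density_def by measurable

lemma gamma_density_nonneg [simp]: "b > 0 \<Longrightarrow> gamma_density b t \<ge> 0"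
  by (auto simp: gamma_density_def intro!: divide_nonneg_pos mult_nonneg_nonneg)

text \<open>Euler's integral for the gamma function after the substitution \<open>t \<mapsto> (1 + q) t\<close>. This is what makes
negative powers of the symbol accessible through Gaussians.\<close>

lemma laplace_gamma_density:
  assumes b: "b > 0" and q: "q > - 1"
  shows "has_bochner_integral lborel (\<lambda>t. gamma_density b t * exp (- t * q)) ((1 + q) powr (- b))"
proof (rule has_bochner_integral_nn_integral)
  let ?c = "1 + q" and ?g = "\<lambda>t. indicator {0..} t * t powr (b - 1) / exp t :: real"
  have c: "?c > 0" using q by simp
  have G: "Gamma b > 0" using b by simp
  have "ennreal (Gamma b) = (\<integral>\<^sup>+t. ennreal (?g t) \<partial>lborel)"
    using b by (simp add: Gamma_conv_nn_integral_real)
  also have "\<dots> = ennreal ?c * (\<integral>\<^sup>+t. ennreal (?g (?c * t)) \<partial>lborel)"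
    using c nn_integral_real_affine[of "\<lambda>t. ennreal (?g t)" ?c 0] by simp
  also have "(\<integral>\<^sup>+t. ennreal (?g (?c * t)) \<partial>lborel) =
      (\<integral>\<^sup>+t. ennreal (Gamma b * ?c powr (b - 1)) * ennreal (gamma_density b t * exp (- t * q)) \<partial>lborel)"
  proof (rule nn_integral_cong_AE, rule AE_mp[OF AE_lborel_singleton[of 0]], intro AE_I2 impI)
    fix t :: real assume "t \<noteq> 0"
    then have "?g (?c * t) = (Gamma b * ?c powr (b - 1)) * (gamma_density b t * exp (- t * q))"
    proof (cases "t > 0")
      case True
      then have "(?c * t) powr (b - 1) = ?c powr (b - 1) * t powr (b - 1)"
        using c by (simp add: powr_mult)
      moreover have "exp (- t) * exp (- t * q) = 1 / exp (?c * t)"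
        by (simp add: mult_exp_exp exp_minus[symmetric] inverse_eq_divide[symmetric] algebra_simps)
      ultimately show ?thesis
        using True c G by (simp add: gamma_density_def)
    next
      case False
      then have "?c * t < 0" using c \<open>t \<noteq> 0\<close> by (simp add: mult_pos_neg)
      then show ?thesis using False by (simp add: gamma_density_def indicator_def)
    qed
    then show "ennreal (?g (?c * t)) = ennreal (Gamma b * ?c powr (b - 1)) * ennreal (gamma_density b t * exp (- t * q))"
      using G b by (simp add: ennreal_mult)
  qed
  also have "\<dots> = ennreal (Gamma b * ?c powr (b - 1)) * (\<integral>\<^sup>+t. ennreal (gamma_density b t * exp (- t * q)) \<partial>lborel)"
    by (rule nn_integral_cmult) simp
  also have "ennreal ?c * (ennreal (Gamma b * ?c powr (b - 1)) * (\<integral>\<^sup>+t. ennreal (gamma_density b t * exp (- t * q)) \<partial>lborel))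
     = ennreal (Gamma b * ?c powr b) * (\<integral>\<^sup>+t. ennreal (gamma_density b t * exp (- t * q)) \<partial>lborel)"
    using c G by (simp add: mult.assoc[symmetric] ennreal_mult'[symmetric] powr_diff)
  finally have eq: "ennreal (Gamma b) = ennreal (Gamma b * ?c powr b) * (\<integral>\<^sup>+t. ennreal (gamma_density b t * exp (- t * q)) \<partial>lborel)" .
  let ?I = "\<integral>\<^sup>+t. ennreal (gamma_density b t * exp (- t * q)) \<partial>lborel"
  have "ennreal (inverse (Gamma b * ?c powr b)) * ennreal (Gamma b)
     = (ennreal (inverse (Gamma b * ?c powr b)) * ennreal (Gamma b * ?c powr b)) * ?I"
    by (subst eq) (simp add: mult.assoc)
  also have "ennreal (inverse (Gamma b * ?c powr b)) * ennreal (Gamma b * ?c powr b) = 1"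
    using c G by (simp add: ennreal_mult'[symmetric] field_simps)
  finally show "?I = ennreal (?c powr (- b))"
    using c G by (simp add: ennreal_mult'[symmetric] powr_minus field_simps)
qed (use b in auto)

lemma gamma_density_powr:
  assumes "b > 0" "b + k > 0"
  shows "gamma_density b t * t powr k = Gamma (b + k) / Gamma b * gamma_density (b + k) t"
proof -
  have "Gamma (b + k) > 0" using assms by simp
  then show ?thesis by (simp add: gamma_density_def powr_add[symmetric] algebra_simps)
qed

lemma integral_gamma_density:
  assumes "b > 0" shows "has_bochner_integral lborel (gamma_density b) 1"
  using laplace_gamma_density[OF assms, of 0] by simp

lemma nn_integral_gamma_density:
  assumes "b > 0" shows "(\<integral>\<^sup>+t. ennreal (gamma_density b t) \<partial>lborel) = 1"
  using integral_gamma_density[OF assms] assms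
  by (simp add: nn_integral_eq_integral has_bochner_integral_iff)

lemma gamma_density_moment:
  assumes "b > 0" "b + k > 0"
  shows "has_bochner_integral lborel (\<lambda>t. gamma_density b t * t powr k) (Gamma (b + k) / Gamma b)"
  unfolding gamma_density_powr[OF assms]
  using has_bochner_integral_mult_right[OF integral_gamma_density[OF assms(2)], of "Gamma (b + k) / Gamma b"] by simp

text \<open>The sum of two independent gamma variables is a gamma variable. For a fixed sum u, scaling by u
shows that the inner integral is a constant C times the gamma density of the added shapes. The beta
integral in C need not be evaluated: the case \<open>F = 1\<close>, where both sides are total masses, gives
\<open>C = 1\<close>.\<close>

lemma gamma_density_convolution:
  fixes F :: "real \<Rightarrow> ennreal"
  assumes a: "a > 0" and b: "b > 0" and [measurable]: "F \<in> borel_measurable borel"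
  shows "(\<integral>\<^sup>+t. \<integral>\<^sup>+s. ennreal (gamma_density a t * gamma_density b s) * F (t + s) \<partial>lborel \<partial>lborel) =
    (\<integral>\<^sup>+u. ennreal (gamma_density (a + b) u) * F u \<partial>lborel)"
proof -
  let ?\<gamma> = gamma_density
  \<comment> \<open>The substitution \<open>t = u x\<close> leaves the integrand of the beta integral.\<close>
  define h where "h x = (if 0 < x \<and> x < 1 then x powr (a - 1) * (1 - x) powr (b - 1) else 0)" for x :: real
  have [measurable]: "h \<in> borel_measurable borel" unfolding h_def by measurable
  define C where "C = (\<integral>\<^sup>+x. ennreal (h x) \<partial>lborel) * ennreal (Gamma (a + b) / (Gamma a * Gamma b))"
  have G: "Gamma a > 0" "Gamma b > 0" "Gamma (a + b) > 0" using a b by auto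
  have inner: "(\<integral>\<^sup>+t. ennreal (?\<gamma> a t * ?\<gamma> b (u - t)) \<partial>lborel) = C * ennreal (?\<gamma> (a + b) u)" for u
  proof (cases "u > 0")
    case False
    then have z: "ennreal (?\<gamma> a t * ?\<gamma> b (u - t)) = 0" for t by (auto simp: gamma_density_def)
    show ?thesis unfolding z using False by (simp add: gamma_density_def)
  next
    case u: True
    have "(\<integral>\<^sup>+t. ennreal (?\<gamma> a t * ?\<gamma> b (u - t)) \<partial>lborel) = ennreal u * (\<integral>\<^sup>+x. ennreal (?\<gamma> a (u * x) * ?\<gamma> b (u - u * x)) \<partial>lborel)"
      using u nn_integral_real_affine[of "\<lambda>t. ennreal (?\<gamma> a t * ?\<gamma> b (u - t))" u 0] by simp
    also have "(\<lambda>x. ennreal (?\<gamma> a (u * x) * ?\<gamma> b (u - u * x))) = (\<lambda>x. ennreal (u powr (a + b - 2) * exp (- u) / (Gamma a * Gamma b)) * ennreal (h x))"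
    proof
      fix x
      have pos: "(0 < u * x) = (0 < x)" "(u * x < u) = (x < 1)"
        using u mult_less_cancel_left_pos[of u x 1] by (auto simp: zero_less_mult_iff)
      have "?\<gamma> a (u * x) * ?\<gamma> b (u - u * x) = u powr (a + b - 2) * exp (- u) / (Gamma a * Gamma b) * h x"
      proof (cases "0 < x \<and> x < 1")
        case True
        have "u - u * x = u * (1 - x)" by (simp add: algebra_simps)
        moreover have "u powr (a - 1) * u powr (b - 1) = u powr (a + b - 2)"
          by (simp add: powr_add[symmetric])
        moreover have "exp (- (u * x)) * exp (- (u * (1 - x))) = exp (- u)"
          by (simp add: mult_exp_exp algebra_simps)
        ultimately show ?thesis
          using True u by (simp add: gamma_density_def h_def powr_mult zero_less_mult_iff) (metis mult.assoc mult.left_commute)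
      qed (auto simp: h_def gamma_density_def pos)
      then show "ennreal (?\<gamma> a (u * x) * ?\<gamma> b (u - u * x)) = ennreal (u powr (a + b - 2) * exp (- u) / (Gamma a * Gamma b)) * ennreal (h x)"
        using G by (simp add: ennreal_mult'[symmetric])
    qed
    also have "ennreal u * (\<integral>\<^sup>+x. ennreal (u powr (a + b - 2) * exp (- u) / (Gamma a * Gamma b)) * ennreal (h x) \<partial>lborel)
        = (\<integral>\<^sup>+x. ennreal (h x) \<partial>lborel) * ennreal (u * (u powr (a + b - 2) * exp (- u) / (Gamma a * Gamma b)))"
    proof -
      have "ennreal u * (\<integral>\<^sup>+x. ennreal c * ennreal (h x) \<partial>lborel) = (\<integral>\<^sup>+x. ennreal (h x) \<partial>lborel) * ennreal (u * c)" for c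
        using u by (simp add: nn_integral_cmult ennreal_mult'' mult_ac)
      then show ?thesis .
    qed
    also have "u * (u powr (a + b - 2) * exp (- u) / (Gamma a * Gamma b)) = Gamma (a + b) / (Gamma a * Gamma b) * ?\<gamma> (a + b) u"
    proof -
      have "u * u powr (a + b - 2) = u powr (a + b - 1)"
        using u by (simp add: powr_diff field_simps power2_eq_square)
      then show ?thesis using u G by (simp add: gamma_density_def)
    qed
    also have "ennreal (Gamma (a + b) / (Gamma a * Gamma b) * ?\<gamma> (a + b) u) = ennreal (Gamma (a + b) / (Gamma a * Gamma b)) * ennreal (?\<gamma> (a + b) u)"
      using G by (intro ennreal_mult') simp
    finally show ?thesis
      unfolding C_def by (simp only: mult.assoc)
  qed
  have main: "(\<integral>\<^sup>+t. \<integral>\<^sup>+s. ennreal (?\<gamma> a t * ?\<gamma> b s) * F (t + s) \<partial>lborel \<partial>lborel) = C * (\<integral>\<^sup>+u. ennreal (?\<gamma> (a + b) u) * F u \<partial>lborel)"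
    if [measurable]: "F \<in> borel_measurable borel" for F
  proof -
    have "(\<integral>\<^sup>+t. \<integral>\<^sup>+s. ennreal (?\<gamma> a t * ?\<gamma> b s) * F (t + s) \<partial>lborel \<partial>lborel)
       = (\<integral>\<^sup>+t. \<integral>\<^sup>+u. ennreal (?\<gamma> a t * ?\<gamma> b (u - t)) * F u \<partial>lborel \<partial>lborel)"
    proof (rule nn_integral_cong)
      fix t
      show "(\<integral>\<^sup>+s. ennreal (?\<gamma> a t * ?\<gamma> b s) * F (t + s) \<partial>lborel) = (\<integral>\<^sup>+u. ennreal (?\<gamma> a t * ?\<gamma> b (u - t)) * F u \<partial>lborel)"
        using nn_integral_real_affine[of "\<lambda>u. ennreal (?\<gamma> a t * ?\<gamma> b (u - t)) * F u" 1 t] by simp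
    qed
    also have "\<dots> = (\<integral>\<^sup>+u. \<integral>\<^sup>+t. ennreal (?\<gamma> a t * ?\<gamma> b (u - t)) * F u \<partial>lborel \<partial>lborel)"
      by (rule lborel_pair.Fubini') measurable
    also have "\<dots> = (\<integral>\<^sup>+u. C * ennreal (?\<gamma> (a + b) u) * F u \<partial>lborel)"
      by (simp add: nn_integral_multc inner)
    finally show ?thesis
      by (simp add: nn_integral_cmult mult.assoc)
  qed
  have "(\<integral>\<^sup>+t. \<integral>\<^sup>+s. ennreal (?\<gamma> a t * ?\<gamma> b s) * 1 \<partial>lborel \<partial>lborel) = 1"
    using a b by (simp add: ennreal_mult' nn_integral_cmult nn_integral_gamma_density)
  then have "C = 1"
    using main[of "\<lambda>_. 1"] a b by (simp add: nn_integral_gamma_density)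
  then show ?thesis using main[of F] by simp
qed

context anisotropy
begin

text \<open>For \<open>b \<le> 1\<close> the mixture diverges at the origin, and the Bochner integral returns 0 there; this
affects a single point.\<close>

definition kernel :: "real \<Rightarrow> real^2 \<Rightarrow> real" where
  "kernel b x = (\<integral>t. gamma_density b t * heat t x \<partial>lborel)"

lemma kernel_measurable [measurable]: "kernel b \<in> borel_measurable borel"
  unfolding kernel_def by measurable

lemma gamma_heat_nonneg: "b > 0 \<Longrightarrow> gamma_density b t * heat t x \<ge> 0"
  by (cases "t > 0") (auto simp: heat_pos less_imp_le gamma_density_def[of b t])

lemma kernel_nonneg: "b > 0 \<Longrightarrow> kernel b x \<ge> 0"
  unfolding kernel_def by (intro integral_nonneg_AE AE_I2 gamma_heat_nonneg)

lemma kernel_minus: "kernel b (x - y) = kernel b (y - x)"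
  unfolding kernel_def by (subst heat_minus) simp

lemma A_nonzero: "x \<noteq> 0 \<Longrightarrow> A *v x \<noteq> 0"
  by (metis matrix_vector_mul_assoc matrix_vector_mul_lid matrix_vector_mult_0_right transpose_R_A)

text \<open>Away from the origin the heat kernel stays bounded as t tends to 0, since \<open>exp (- y) \<le> 1 / y\<close>.\<close>

lemma heat_le:
  assumes "x \<noteq> 0" "t > 0"
  shows "heat t x \<le> 1 / (pi * \<bar>det R\<bar> * (norm (A *v x))\<^sup>2)"
proof -
  let ?y = "(norm (A *v x))\<^sup>2 / (4 * t)"
  have y: "?y > 0" using assms A_nonzero[of x] by simp
  have "?y \<le> exp ?y" using exp_ge_add_one_self[of ?y] by linarith
  then have "exp (- ?y) \<le> 1 / ?y"
    unfolding exp_minus inverse_eq_divide by (intro frac_le y) auto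
  then have "heat t x \<le> (1 / ?y) / (4 * pi * t * \<bar>det R\<bar>)"
    unfolding heat_def using assms by (intro divide_right_mono) auto
  then show ?thesis using assms by (simp add: mult_ac)
qed

text \<open>Away from the origin the heat kernel is bounded in t. At the origin it is a multiple of \<open>1 / t\<close>,
and \<open>1 / t\<close> has a finite gamma mean for shapes above 1.\<close>

lemma integrable_gamma_heat:
  assumes "b > 1 \<or> x \<noteq> 0" and b: "b > 0"
  shows "integrable lborel (\<lambda>t. gamma_density b t * heat t x)"
proof (cases "x = 0")
  case False
  show ?thesis
  proof (rule Bochner_Integration.integrable_bound)
    show "integrable lborel (\<lambda>t. gamma_density b t * (1 / (pi * \<bar>det R\<bar> * (norm (A *v x))\<^sup>2)))"
      using integral_gamma_density[OF b] by (simp add: has_bochner_integral_iff)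
    show "AE t in lborel. norm (gamma_density b t * heat t x) \<le> norm (gamma_density b t * (1 / (pi * \<bar>det R\<bar> * (norm (A *v x))\<^sup>2)))"
    proof (rule AE_I2)
      fix t
      show "norm (gamma_density b t * heat t x) \<le> norm (gamma_density b t * (1 / (pi * \<bar>det R\<bar> * (norm (A *v x))\<^sup>2)))"
      proof (cases "t > 0")
        case True
        show ?thesis
          using heat_le[OF False True] heat_pos[OF True, of x]
          unfolding norm_mult by (intro mult_left_mono) (auto simp: real_norm_def)
      qed (simp add: gamma_density_def)
    qed
  qed measurable
next
  case True
  then have b1: "b > 1" using assms by simp
  have "gamma_density b t * heat t x = gamma_density b t * t powr (- 1) * (1 / (4 * pi * \<bar>det R\<bar>))" for t
    using True by (auto simp: gamma_density_def heat_def powr_minus divide_simps)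
  moreover have "integrable lborel (\<lambda>t. gamma_density b t * t powr (- 1) * (1 / (4 * pi * \<bar>det R\<bar>)))"
    by (rule integrable_mult_left, rule integrable.intros, rule gamma_density_moment)
      (use b1 in auto)
  ultimately show ?thesis by presburger
qed

lemma nn_integral_gamma_heat:
  assumes "b > 1 \<or> x \<noteq> 0" and b: "b > 0"
  shows "(\<integral>\<^sup>+t. ennreal (gamma_density b t * heat t x) \<partial>lborel) = ennreal (kernel b x)"
  unfolding kernel_def
  by (intro nn_integral_eq_integral integrable_gamma_heat assms AE_I2 gamma_heat_nonneg)

lemma heat_integral:
  assumes "t > 0" shows "has_bochner_integral lborel (heat t) 1"
proof -
  have "has_bochner_integral lborel (\<lambda>x. Re (complex_of_real (heat t x))) (Re 1)"
    using has_bochner_integral_bounded_linear[OF bounded_linear_Re fourier_heat[OF assms, of 0]] by simp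
  then show ?thesis by simp
qed

text \<open>The convolution of the kernel with \<open>heat \<epsilon>\<close>: adding \<open>\<epsilon>\<close> to all times removes the singularity at the
origin.\<close>

definition mixture :: "real \<Rightarrow> real \<Rightarrow> real^2 \<Rightarrow> real" where
  "mixture b \<epsilon> x = (\<integral>t. gamma_density b t * heat (t + \<epsilon>) x \<partial>lborel)"

lemma mixture_measurable [measurable]: "mixture b \<epsilon> \<in> borel_measurable borel"
  unfolding mixture_def by measurable

text \<open>Every heat kernel has mass one, so Fubini's theorem allows taking the Fourier transform under the
integral over t, which leaves the Laplace transform of the gamma density.\<close>

lemma fourier_mixture:
  assumes b: "b > 0" and \<epsilon>: "\<epsilon> \<ge> 0"
  shows "has_bochner_integral lborel
    (\<lambda>x. cis (- (\<omega> \<bullet> x)) * complex_of_real (mixture b \<epsilon> x))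
    (complex_of_real (exp (- \<epsilon> * (norm (R *v \<omega>))\<^sup>2) * (1 + (norm (R *v \<omega>))\<^sup>2) powr (- b)))"
proof -
  let ?q = "(norm (R *v \<omega>))\<^sup>2"
  let ?f = "\<lambda>t x. cis (- (\<omega> \<bullet> x)) * complex_of_real (gamma_density b t * heat (t + \<epsilon>) x)"
  have hf: "has_bochner_integral lborel (?f t) (complex_of_real (exp (- \<epsilon> * ?q) * (gamma_density b t * exp (- t * ?q))))" for t
  proof (cases "t > 0")
    case True
    then have t: "t + \<epsilon> > 0" using \<epsilon> by simp
    have "exp (- (t + \<epsilon>) * ?q) = exp (- \<epsilon> * ?q) * exp (- t * ?q)"
      by (simp add: mult_exp_exp algebra_simps)
    then show ?thesis
      using has_bochner_integral_mult_right[OF fourier_heat[OF t], of "complex_of_real (gamma_density b t)" \<omega>]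
      by (simp add: mult_ac)
  qed (simp add: gamma_density_def has_bochner_integral_zero)
  have int: "integrable (lborel \<Otimes>\<^sub>M lborel) (\<lambda>(t, x). ?f t x)"
  proof (rule lborel_pair.Fubini_integrable)
    have "(\<integral>x. norm (?f t x) \<partial>lborel) = gamma_density b t" for t
    proof (cases "t > 0")
      case True
      then have t: "t + \<epsilon> > 0" using \<epsilon> by simp
      have "(\<integral>x. norm (?f t x) \<partial>lborel) = (\<integral>x. gamma_density b t * heat (t + \<epsilon>) x \<partial>lborel)"
        using b heat_pos[OF t] by (simp add: norm_mult less_imp_le)
      also have "\<dots> = gamma_density b t"
        using heat_integral[OF t] by (simp add: has_bochner_integral_iff)
      finally show ?thesis .
    qed (simp add: gamma_density_def)
    then show "integrable lborel (\<lambda>t. \<integral>x. norm (case (t, x) of (t, x) \<Rightarrow> ?f t x) \<partial>lborel)"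
      using integral_gamma_density[OF b] by (simp add: has_bochner_integral_iff)
    show "AE t in lborel. integrable lborel (\<lambda>x. case (t, x) of (t, x) \<Rightarrow> ?f t x)"
      using hf by (auto simp: has_bochner_integral_iff)
    show "(\<lambda>(t, x). ?f t x) \<in> borel_measurable (lborel \<Otimes>\<^sub>M lborel)"
      by measurable
  qed
  have inner: "(\<integral>t. ?f t x \<partial>lborel) = cis (- (\<omega> \<bullet> x)) * complex_of_real (mixture b \<epsilon> x)" for x
    unfolding mixture_def by (simp del: of_real_mult)
  have "integrable lborel (\<lambda>x. cis (- (\<omega> \<bullet> x)) * complex_of_real (mixture b \<epsilon> x))"
    using lborel_pair.integrable_snd[OF int] unfolding inner .
  moreover have "(\<integral>x. cis (- (\<omega> \<bullet> x)) * complex_of_real (mixture b \<epsilon> x) \<partial>lborel) = (\<integral>t. \<integral>x. ?f t x \<partial>lborel \<partial>lborel)"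
    using lborel_pair.Fubini_integral[OF int] unfolding inner .
  moreover have "(\<integral>t. \<integral>x. ?f t x \<partial>lborel \<partial>lborel) = complex_of_real (exp (- \<epsilon> * ?q) * (1 + ?q) powr (- b))"
  proof -
    have "0 \<le> (norm (R *v \<omega>))\<^sup>2" by simp
    then have "- 1 < (norm (R *v \<omega>))\<^sup>2" by linarith
    then show ?thesis
      using laplace_gamma_density[OF b, of ?q] hf
      by (simp add: has_bochner_integral_iff del: of_real_mult)
  qed
  ultimately show ?thesis by (simp add: has_bochner_integral_iff)
qed

lemma fourier_kernel:
  assumes b: "b > 0"
  shows "has_bochner_integral lborel (\<lambda>x. cis (- (\<omega> \<bullet> x)) * complex_of_real (kernel b x))
    (complex_of_real ((1 + (norm (R *v \<omega>))\<^sup>2) powr (- b)))"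
  using fourier_mixture[OF b order_refl] by (simp add: kernel_def mixture_def)

text \<open>Independent times: the Gaussians of times t and s convolve to the one of time \<open>t + s\<close>, and this sum
has the gamma distribution of shape \<open>2 b\<close>. All terms are nonnegative, so the integrals are exchanged
by Tonelli's theorem; \<open>2 b > 1\<close> makes the result finite also for \<open>x = y\<close>.\<close>

lemma kernel_autocorrelation:
  assumes b: "b > 1 / 2"
  shows "has_bochner_integral lborel (\<lambda>v. kernel b (x - v) * kernel b (y - v)) (kernel (2 * b) (x - y))"
proof (rule has_bochner_integral_nn_integral)
  let ?\<gamma> = "gamma_density b"
  have b0: "b > 0" using b by simp
  let ?k = "\<lambda>x t. ennreal (?\<gamma> t * heat t x)"
  have "(\<integral>\<^sup>+v. ennreal (kernel b (x - v) * kernel b (y - v)) \<partial>lborel)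
      = (\<integral>\<^sup>+v. \<integral>\<^sup>+t. \<integral>\<^sup>+s. ?k (x - v) t * ?k (y - v) s \<partial>lborel \<partial>lborel \<partial>lborel)"
  proof (rule nn_integral_cong_AE, use AE_lborel_singleton[of x] AE_lborel_singleton[of y] in eventually_elim)
    case (elim v)
    then have "x - v \<noteq> 0" "y - v \<noteq> 0" by auto
    then show ?case
      using b0 by (simp add: nn_integral_cmult nn_integral_multc nn_integral_gamma_heat ennreal_mult kernel_nonneg)
  qed
  also have "\<dots> = (\<integral>\<^sup>+t. \<integral>\<^sup>+v. \<integral>\<^sup>+s. ?k (x - v) t * ?k (y - v) s \<partial>lborel \<partial>lborel \<partial>lborel)"
    by (rule lborel_pair.Fubini') measurable
  also have "\<dots> = (\<integral>\<^sup>+t. \<integral>\<^sup>+s. \<integral>\<^sup>+v. ?k (x - v) t * ?k (y - v) s \<partial>lborel \<partial>lborel \<partial>lborel)"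
    by (intro nn_integral_cong lborel_pair.Fubini') measurable
  also have "\<dots> = (\<integral>\<^sup>+t. \<integral>\<^sup>+s. ennreal (?\<gamma> t * ?\<gamma> s) * ennreal (heat (t + s) (x - y)) \<partial>lborel \<partial>lborel)"
  proof (intro nn_integral_cong)
    fix t s :: real
    show "(\<integral>\<^sup>+v. ?k (x - v) t * ?k (y - v) s \<partial>lborel) = ennreal (?\<gamma> t * ?\<gamma> s) * ennreal (heat (t + s) (x - y))"
    proof (cases "t > 0 \<and> s > 0")
      case True
      then have hp: "heat t z \<ge> 0" "heat s z \<ge> 0" for z by (auto intro: less_imp_le heat_pos)
      have "(\<integral>\<^sup>+v. ?k (x - v) t * ?k (y - v) s \<partial>lborel) = (\<integral>\<^sup>+v. ennreal (?\<gamma> t * ?\<gamma> s) * ennreal (heat t (x - v) * heat s (y - v)) \<partial>lborel)"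
        using b0 hp by (intro nn_integral_cong) (simp add: ennreal_mult'[symmetric] mult_ac)
      also have "\<dots> = ennreal (?\<gamma> t * ?\<gamma> s) * ennreal (heat (t + s) (x - y))"
        using heat_convolution[of t s x y] True hp
        by (simp add: nn_integral_cmult nn_integral_eq_integral has_bochner_integral_iff)
      finally show ?thesis .
    qed (auto simp: gamma_density_def)
  qed
  also have "\<dots> = (\<integral>\<^sup>+u. ennreal (gamma_density (b + b) u) * ennreal (heat u (x - y)) \<partial>lborel)"
    by (rule gamma_density_convolution[OF b0 b0, of "\<lambda>u. ennreal (heat u (x - y))"]) measurable
  also have "\<dots> = (\<integral>\<^sup>+u. ennreal (gamma_density (2 * b) u * heat u (x - y)) \<partial>lborel)"
    using b0 by (simp add: ennreal_mult'[symmetric])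
  also have "\<dots> = ennreal (kernel (2 * b) (x - y))"
    using b by (intro nn_integral_gamma_heat) auto
  finally show "(\<integral>\<^sup>+v. ennreal (kernel b (x - v) * kernel b (y - v)) \<partial>lborel) = ennreal (kernel (2 * b) (x - y))" .
qed (use b in \<open>auto simp: kernel_nonneg\<close>)

end

section \<open>Schwartz functions and Fourier inversion\<close>

lemma iter_partial_Nil [simp]: "iter_partial [] f = f"
  by (simp add: iter_partial_def)

lemma iter_partial_iter_partial: "iter_partial is (iter_partial js f) = iter_partial (is @ js) f"
  by (simp add: iter_partial_def)

lemma schwartz_iter_partial: "f \<in> schwartz_space \<Longrightarrow> iter_partial js f \<in> schwartz_space"
  by (simp add: schwartz_space_def iter_partial_iter_partial)

lemma schwartz_decay:
  assumes "f \<in> schwartz_space"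
  obtains C where "C \<ge> 0" "\<And>x. norm (f x) \<le> C / (1 + norm x) ^ N"
proof -
  have "bounded (range (\<lambda>x. (1 + norm x) ^ N *\<^sub>R iter_partial [] f x))"
    using assms unfolding schwartz_space_def by blast
  then obtain C where C: "\<And>x. norm ((1 + norm x) ^ N *\<^sub>R f x) \<le> C"
    by (auto simp: bounded_iff)
  show ?thesis
  proof
    show "C \<ge> 0" by (rule order_trans[OF norm_ge_zero C[of 0]])
    show "norm (f x) \<le> C / (1 + norm x) ^ N" for x
    proof -
      have p: "(1 + norm x) ^ N > 0" by (intro zero_less_power) (simp add: add_pos_nonneg)
      then show ?thesis using C[of x] by (simp add: field_simps)
    qed
  qed
qed

lemma schwartz_differentiable: "f \<in> schwartz_space \<Longrightarrow> f differentiable (at x)"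
  unfolding schwartz_space_def by (metis (mono_tags, lifting) iter_partial_Nil mem_Collect_eq)

lemma schwartz_continuous: "f \<in> schwartz_space \<Longrightarrow> continuous_on UNIV f"
  by (meson continuous_at_imp_continuous_on differentiable_imp_continuous_within schwartz_differentiable)

lemma schwartz_measurable: "f \<in> schwartz_space \<Longrightarrow> f \<in> borel_measurable borel"
  by (intro borel_measurable_continuous_onI schwartz_continuous)

text \<open>The weight is at most the product of \<open>1 / (1 + u\<^sup>2)\<close> over the two coordinates u.\<close>

lemma integrable_decay_weight: "integrable lborel (\<lambda>x::real^2. 1 / (1 + norm x) ^ 4)"
proof (rule Bochner_Integration.integrable_bound)
  have "set_integrable lborel (einterval (-\<infinity>) \<infinity>) (\<lambda>x. inverse (1 + x^2))"
    by (rule integrable_inverse_1_plus_square)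
  then have "integrable lborel (\<lambda>x::real. inverse (1 + x\<^sup>2))"
    by (simp add: set_integrable_def)
  then have "has_bochner_integral lborel (\<lambda>x::real. inverse (1 + x\<^sup>2)) (\<integral>x. inverse (1 + x\<^sup>2) \<partial>lborel)"
    by (rule has_bochner_integral_integrable)
  from has_bochner_integral_product_2[OF this this]
  show "integrable lborel (\<lambda>x::real^2. inverse (1 + (x$1)\<^sup>2) * inverse (1 + (x$2)\<^sup>2))"
    by (simp add: has_bochner_integral_iff)
  show "AE x in lborel. norm (1 / (1 + norm (x::real^2)) ^ 4) \<le> norm (inverse (1 + (x$1)\<^sup>2) * inverse (1 + (x$2)\<^sup>2))"
  proof (rule AE_I2)
    fix x :: "real^2"
    have *: "1 + (x$i)\<^sup>2 \<le> (1 + norm x)\<^sup>2" for i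
    proof -
      have "(x$i)\<^sup>2 \<le> (norm x)\<^sup>2" using component_le_norm_cart[of x i] by (metis norm_ge_zero power2_abs power_mono abs_ge_zero)
      then show ?thesis using norm_ge_zero[of x] by (simp add: power2_sum add_increasing2)
    qed
    have "(1 + (x$1)\<^sup>2) * (1 + (x$2)\<^sup>2) \<le> (1 + norm x)\<^sup>2 * (1 + norm x)\<^sup>2"
      by (intro mult_mono *) auto
    also have "\<dots> = (1 + norm x) ^ 4" by (simp add: power_add[symmetric])
    finally have "1 / (1 + norm x) ^ 4 \<le> 1 / ((1 + (x$1)\<^sup>2) * (1 + (x$2)\<^sup>2))"
      by (intro divide_left_mono mult_pos_pos zero_less_power) (auto simp: add_pos_nonneg)
    moreover have "0 \<le> 1 / (1 + norm x) ^ 4" by simp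
    ultimately show "norm (1 / (1 + norm x) ^ 4) \<le> norm (inverse (1 + (x$1)\<^sup>2) * inverse (1 + (x$2)\<^sup>2))"
      unfolding real_norm_def by (simp add: inverse_eq_divide)
  qed
qed measurable

lemma integrable_of_decay:
  fixes f :: "real^2 \<Rightarrow> 'b::{banach, second_countable_topology}"
  assumes [measurable]: "f \<in> borel_measurable borel" and "\<And>x. norm (f x) \<le> C / (1 + norm x) ^ 4"
  shows "integrable lborel f"
proof (rule Bochner_Integration.integrable_bound)
  show "integrable lborel (\<lambda>x::real^2. C * (1 / (1 + norm x) ^ 4))"
    by (intro integrable_mult_right integrable_decay_weight)
  show "AE x in lborel. norm (f x) \<le> norm (C * (1 / (1 + norm x) ^ 4))"
    using assms(2) by (intro AE_I2) (simp add: abs_mult order_trans[OF _ divide_right_mono[OF abs_ge_self]])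
qed measurable

lemma schwartz_integrable: "f \<in> schwartz_space \<Longrightarrow> integrable lborel f"
  by (metis integrable_of_decay schwartz_decay schwartz_measurable)

lemma integrable_cis_mult:
  assumes "integrable lborel f"
  shows "integrable lborel (\<lambda>x::real^2. cis (\<omega> \<bullet> x) * f x)"
  using assms by (rule Bochner_Integration.integrable_bound) (use borel_measurable_integrable[OF assms] in \<open>auto simp: norm_mult\<close>)

lemma lborel_integral_affine:
  fixes f :: "real^2 \<Rightarrow> 'b::{banach, second_countable_topology}"
  assumes [measurable]: "f \<in> borel_measurable borel" and "c \<noteq> 0"
  shows "(\<integral>x. f x \<partial>lborel) = c\<^sup>2 *\<^sub>R (\<integral>x. f (t + c *\<^sub>R x) \<partial>lborel)"
  by (subst lborel_affine[OF assms(2), of t])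
     (simp add: integral_density integral_distr)

lemma lborel_integrable_affine:
  fixes f :: "real^2 \<Rightarrow> 'b::{banach, second_countable_topology}"
  assumes f: "integrable lborel f" and c: "c \<noteq> 0"
  shows "integrable lborel (\<lambda>x. f (t + c *\<^sub>R x))"
proof -
  have [measurable]: "f \<in> borel_measurable borel" using borel_measurable_integrable[OF f] by simp
  have "integrable (density (distr lborel borel (\<lambda>x. t + c *\<^sub>R x)) (\<lambda>_. ennreal (\<bar>c\<bar> ^ DIM(real^2)))) f"
    using f lborel_affine[OF c, of t] by metis
  then have "integrable lborel (\<lambda>x. \<bar>c\<bar>\<^sup>2 *\<^sub>R f (t + c *\<^sub>R x))"
    by (simp add: integrable_density integrable_distr_eq)
  then have "integrable lborel (\<lambda>x. inverse (\<bar>c\<bar>\<^sup>2) *\<^sub>R (\<bar>c\<bar>\<^sup>2 *\<^sub>R f (t + c *\<^sub>R x)))"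
    by (rule integrable_scaleR_right)
  then show ?thesis using c by simp
qed

lemma one_over_Suc_tendsto: "(\<lambda>n. 1 / real (Suc n)) \<longlonglongrightarrow> 0"
  using LIMSEQ_Suc[OF lim_1_over_n] .

text \<open>A dominating function for difference quotients, uniform in the step. By the mean value theorem
the quotient is a derivative at a point within distance 1 of x, and such a shift changes \<open>1 + norm x\<close>
by a factor of at most 2; the constant 16 is \<open>2 ^ 4\<close>.\<close>

lemma difference_quotient_le:
  fixes f :: "real^2 \<Rightarrow> complex"
  assumes f: "\<And>y. f differentiable (at y)"
    and bd: "\<And>y. norm (iter_partial [i] f y) \<le> C / (1 + norm y) ^ 4"
    and h: "0 < h" "h \<le> 1"
  shows "norm ((f (x + h *\<^sub>R axis i 1) - f x) /\<^sub>R h) \<le> (16 * C) / (1 + norm x) ^ 4"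
proof -
  let ?e = "axis i 1 :: real^2"
  have C: "C \<ge> 0" using order_trans[OF norm_ge_zero bd[of 0]] by simp
  have der: "((\<lambda>s. f (x + s *\<^sub>R ?e)) has_derivative (\<lambda>r. r *\<^sub>R iter_partial [i] f (x + s *\<^sub>R ?e))) (at s)" for s
  proof -
    have D: "(f has_derivative frechet_derivative f (at (x + s *\<^sub>R ?e))) (at (x + s *\<^sub>R ?e))"
      using f frechet_derivative_works by blast
    have "((\<lambda>s. f (x + s *\<^sub>R ?e)) has_derivative (\<lambda>r. frechet_derivative f (at (x + s *\<^sub>R ?e)) (r *\<^sub>R ?e))) (at s)"
      by (rule has_derivative_compose[where f="\<lambda>s. x + s *\<^sub>R ?e" and f'="\<lambda>r. r *\<^sub>R ?e" and g=f, OF _ D]) (auto intro!: derivative_eq_intros)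
    then show ?thesis
      using has_derivative_linear[OF D] by (simp add: linear_scale iter_partial_def)
  qed
  have "continuous_on {0..h} (\<lambda>s. f (x + s *\<^sub>R ?e))"
    by (intro continuous_at_imp_continuous_on ballI has_derivative_continuous[OF der])
  from mvt_general[OF h(1) this der]
  obtain s where s: "s \<in> {0<..<h}" "norm (f (x + h *\<^sub>R ?e) - f x) \<le> norm (h *\<^sub>R iter_partial [i] f (x + s *\<^sub>R ?e))"
    by auto
  have "0 < s" "s < 1" using s(1) h by auto
  moreover have "norm x \<le> norm (x + s *\<^sub>R ?e) + s"
    using norm_triangle_ineq4[of "x + s *\<^sub>R ?e" "s *\<^sub>R ?e"] \<open>0 < s\<close> by (simp add: norm_axis_1)
  ultimately have "1 + norm x \<le> 2 * (1 + norm (x + s *\<^sub>R ?e))"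
    using norm_ge_zero[of "x + s *\<^sub>R ?e"] by argo
  then have "(1 + norm x) ^ 4 \<le> (2 * (1 + norm (x + s *\<^sub>R ?e))) ^ 4"
    by (intro power_mono) auto
  then have "(1 + norm x) ^ 4 \<le> 16 * (1 + norm (x + s *\<^sub>R ?e)) ^ 4"
    unfolding power_mult_distrib by simp
  then have "C / (1 + norm (x + s *\<^sub>R ?e)) ^ 4 \<le> C / ((1 + norm x) ^ 4 / 16)"
    using C by (intro divide_left_mono mult_pos_pos divide_pos_pos zero_less_power add_pos_nonneg) auto
  then have "norm (iter_partial [i] f (x + s *\<^sub>R ?e)) \<le> (16 * C) / (1 + norm x) ^ 4"
    using bd[of "x + s *\<^sub>R ?e"] by (simp add: mult.commute)
  moreover have "norm ((f (x + h *\<^sub>R ?e) - f x) /\<^sub>R h) \<le> norm (iter_partial [i] f (x + s *\<^sub>R ?e))"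
    using s(2) h unfolding norm_scaleR by (simp add: inverse_eq_divide pos_divide_le_eq mult.commute)
  ultimately show ?thesis by linarith
qed

lemma difference_quotient_tendsto:
  fixes f :: "real^2 \<Rightarrow> complex"
  assumes f: "f differentiable (at x)"
  shows "(\<lambda>n. (f (x + (1 / real (Suc n)) *\<^sub>R axis i 1) - f x) /\<^sub>R (1 / real (Suc n))) \<longlonglongrightarrow> iter_partial [i] f x"
proof -
  let ?e = "axis i 1 :: real^2" and ?h = "\<lambda>n. 1 / real (Suc n)" and ?D = "frechet_derivative f (at x)"
  have D: "(f has_derivative ?D) (at x)" using f frechet_derivative_works by blast
  then have lin: "linear ?D" by (rule has_derivative_linear)
  have lim: "((\<lambda>h. norm (f (x + h) - f x - ?D h) / norm h) \<longlongrightarrow> 0) (at 0)"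
    using D unfolding has_derivative_at by blast
  have step: "filterlim (\<lambda>n. ?h n *\<^sub>R ?e) (at 0) sequentially"
  proof (rule filterlim_atI)
    have "(\<lambda>n. ?h n *\<^sub>R ?e) \<longlonglongrightarrow> 0 *\<^sub>R ?e"
      by (intro tendsto_scaleR one_over_Suc_tendsto tendsto_const)
    then show "(\<lambda>n. ?h n *\<^sub>R ?e) \<longlonglongrightarrow> 0" by simp
    show "\<forall>\<^sub>F n in sequentially. ?h n *\<^sub>R ?e \<noteq> 0"
      by (intro always_eventually) (simp add: axis_eq_0_iff)
  qed
  from filterlim_compose[OF lim step]
  have "(\<lambda>n. norm (f (x + ?h n *\<^sub>R ?e) - f x - ?D (?h n *\<^sub>R ?e)) / norm (?h n *\<^sub>R ?e)) \<longlonglongrightarrow> 0" .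
  also have "(\<lambda>n. norm (f (x + ?h n *\<^sub>R ?e) - f x - ?D (?h n *\<^sub>R ?e)) / norm (?h n *\<^sub>R ?e)) =
     (\<lambda>n. norm ((f (x + ?h n *\<^sub>R ?e) - f x) /\<^sub>R ?h n - ?D ?e))"
  proof
    fix n
    have h: "?h n > 0" by simp
    have "(f (x + ?h n *\<^sub>R ?e) - f x) /\<^sub>R ?h n - ?D ?e = (f (x + ?h n *\<^sub>R ?e) - f x - ?D (?h n *\<^sub>R ?e)) /\<^sub>R ?h n"
      using h by (simp add: linear_scale[OF lin] scaleR_diff_right)
    then show "norm (f (x + ?h n *\<^sub>R ?e) - f x - ?D (?h n *\<^sub>R ?e)) / norm (?h n *\<^sub>R ?e) =
      norm ((f (x + ?h n *\<^sub>R ?e) - f x) /\<^sub>R ?h n - ?D ?e)"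
      using h by (simp add: norm_axis_1 divide_inverse mult.commute)
  qed
  finally have "(\<lambda>n. (f (x + ?h n *\<^sub>R ?e) - f x) /\<^sub>R ?h n - ?D ?e) \<longlonglongrightarrow> 0"
    by (rule tendsto_norm_zero_cancel)
  then have "(\<lambda>n. (f (x + ?h n *\<^sub>R ?e) - f x) /\<^sub>R ?h n) \<longlonglongrightarrow> ?D ?e"
    by (rule LIM_zero_cancel)
  then show ?thesis
    by (simp only: iter_partial_def foldr_Cons foldr_Nil o_apply id_apply)
qed

lemma inverse_fourier_altdef:
  "inverse_fourier f \<omega> = of_real (1 / (2 * pi)\<^sup>2) * (\<integral>x. cis (\<omega> \<bullet> x) * f x \<partial>lborel)"
  by (simp add: inverse_fourier_def inner_commute)

text \<open>The difference quotient with step h is a difference of translates, so the inverse Fourier transform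
multiplies it by \<open>(cis (- h \<omega>\<^sub>i) - 1) / h\<close>. Letting h tend to 0 on both sides gives the derivative rule
without integration by parts.\<close>

lemma inverse_fourier_partial:
  assumes f: "f \<in> schwartz_space"
  shows "inverse_fourier (iter_partial [i] f) \<omega> = - (\<i> * (\<omega> $ i)) * inverse_fourier f \<omega>"
proof -
  let ?e = "axis i 1 :: real^2" and ?h = "\<lambda>n. 1 / real (Suc n)"
  let ?D = "\<lambda>n x. (f (x + ?h n *\<^sub>R ?e) - f x) /\<^sub>R ?h n"
  let ?I = "\<integral>x. cis (\<omega> \<bullet> x) * f x \<partial>lborel"
  have [measurable]: "f \<in> borel_measurable borel" "iter_partial [i] f \<in> borel_measurable borel"
    using f schwartz_iter_partial by (auto intro: schwartz_measurable)
  note fi = schwartz_integrable[OF f]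
  obtain C where C: "\<And>x. norm (iter_partial [i] f x) \<le> C / (1 + norm x) ^ 4"
    using schwartz_decay[OF schwartz_iter_partial[OF f], of "[i]" 4] by metis
  have lim1: "(\<lambda>n. \<integral>x. cis (\<omega> \<bullet> x) * ?D n x \<partial>lborel) \<longlonglongrightarrow> (\<integral>x. cis (\<omega> \<bullet> x) * iter_partial [i] f x \<partial>lborel)"
  proof (rule integral_dominated_convergence[where w="\<lambda>x. (16 * C) / (1 + norm x) ^ 4"])
    show "integrable lborel (\<lambda>x::real^2. (16 * C) / (1 + norm x) ^ 4)"
      using integrable_mult_right[OF integrable_decay_weight, of "16 * C"] by simp
    show "AE x in lborel. (\<lambda>n. cis (\<omega> \<bullet> x) * ?D n x) \<longlonglongrightarrow> cis (\<omega> \<bullet> x) * iter_partial [i] f x"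
      by (intro AE_I2 tendsto_mult tendsto_const difference_quotient_tendsto schwartz_differentiable f)
    show "AE x in lborel. norm (cis (\<omega> \<bullet> x) * ?D n x) \<le> (16 * C) / (1 + norm x) ^ 4" for n
      unfolding norm_mult norm_cis mult_1
      by (intro AE_I2 difference_quotient_le schwartz_differentiable f C) auto
  qed measurable
  have eq: "(\<integral>x. cis (\<omega> \<bullet> x) * ?D n x \<partial>lborel) = (cis (- (?h n * \<omega> $ i)) - 1) / ?h n * ?I" for n
  proof -
    let ?g = "\<lambda>x. cis (\<omega> \<bullet> x) * f (x + ?h n *\<^sub>R ?e)"
    have gi: "integrable lborel ?g"
      using lborel_integrable_affine[OF fi, of 1 "?h n *\<^sub>R ?e"] by (intro integrable_cis_mult) (simp add: add.commute)
    have "integral\<^sup>L lborel ?g = (\<integral>x. cis (\<omega> \<bullet> (- (?h n *\<^sub>R ?e) + 1 *\<^sub>R x)) * f x \<partial>lborel)"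
      by (subst lborel_integral_affine[where c=1 and t="- (?h n *\<^sub>R ?e)"]) simp_all
    also have "\<dots> = (\<integral>x. cis (- (?h n * \<omega> $ i)) * (cis (\<omega> \<bullet> x) * f x) \<partial>lborel)"
    proof -
      have "cis (\<omega> \<bullet> (- (?h n *\<^sub>R ?e) + 1 *\<^sub>R x)) = cis (- (?h n * \<omega> $ i)) * cis (\<omega> \<bullet> x)" for x
        by (simp add: cis_mult inner_diff_right inner_axis)
      then show ?thesis by (simp only: mult.assoc)
    qed
    also have "\<dots> = cis (- (?h n * \<omega> $ i)) * ?I" by simp
    finally have "integral\<^sup>L lborel ?g = cis (- (?h n * \<omega> $ i)) * ?I" .
    moreover have "(\<lambda>x. cis (\<omega> \<bullet> x) * ?D n x) = (\<lambda>x. (?g x - cis (\<omega> \<bullet> x) * f x) /\<^sub>R ?h n)"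
      by (simp add: fun_eq_iff algebra_simps)
    ultimately show ?thesis
      using gi integrable_cis_mult[OF fi, of \<omega>] by (simp add: scaleR_conv_of_real algebra_simps)
  qed
  have lim2: "(\<lambda>n. (cis (- (?h n * \<omega> $ i)) - 1) / ?h n * ?I) \<longlonglongrightarrow> - (\<i> * (\<omega> $ i)) * ?I"
  proof (intro tendsto_mult tendsto_const)
    define c where "c = - (\<i> * complex_of_real (\<omega> $ i))"
    have "((\<lambda>z. exp (z * c)) has_field_derivative exp (0 * c) * (1 * c)) (at 0)"
      by (intro DERIV_chain2[OF DERIV_exp] DERIV_cmult_right DERIV_ident)
    then have lim: "((\<lambda>z. (exp (z * c) - 1) / z) \<longlongrightarrow> c) (at 0)"
      by (simp add: has_field_derivative_iff)
    have "(\<lambda>n. complex_of_real (?h n)) \<longlonglongrightarrow> of_real 0"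
      by (rule tendsto_of_real[OF one_over_Suc_tendsto])
    then have step: "filterlim (\<lambda>n. complex_of_real (?h n)) (at 0) sequentially"
      by (intro filterlim_atI) (simp_all add: always_eventually del: of_nat_Suc)
    have "cis (- (?h n * \<omega> $ i)) = exp (complex_of_real (?h n) * c)" for n
      by (simp add: cis_conv_exp c_def)
    then show "(\<lambda>n. (cis (- (?h n * \<omega> $ i)) - 1) / ?h n) \<longlonglongrightarrow> - (\<i> * (\<omega> $ i))"
      using filterlim_compose[OF lim step] by (simp only: c_def)
  qed
  have "(\<integral>x. cis (\<omega> \<bullet> x) * iter_partial [i] f x \<partial>lborel) = - (\<i> * (\<omega> $ i)) * ?I"
    using lim1 lim2 unfolding eq by (rule LIMSEQ_unique)
  then show ?thesis unfolding inverse_fourier_altdef by (simp only: mult.left_commute)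
qed

lemma inverse_fourier_measurable [measurable]:
  assumes [measurable]: "f \<in> borel_measurable borel"
  shows "inverse_fourier f \<in> borel_measurable borel"
  unfolding inverse_fourier_altdef by measurable

text \<open>A transform is bounded by the integral of the norm. Each derivative in direction i gains one
factor \<open>\<omega>\<^sub>i\<close>.\<close>

lemma inverse_fourier_component_decay:
  assumes "f \<in> schwartz_space"
  shows "\<exists>C. \<forall>\<omega>. \<bar>\<omega> $ i\<bar> ^ N * norm (inverse_fourier f \<omega>) \<le> C"
  using assms
proof (induction N arbitrary: f)
  case 0
  have "norm (inverse_fourier f \<omega>) \<le> 1 / (2 * pi)\<^sup>2 * (\<integral>x. norm (f x) \<partial>lborel)" for \<omega>
  proof -
    have "norm (\<integral>x. cis (\<omega> \<bullet> x) * f x \<partial>lborel) \<le> (\<integral>x. norm (cis (\<omega> \<bullet> x) * f x) \<partial>lborel)"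
      by (rule integral_norm_bound)
    then show ?thesis
      unfolding inverse_fourier_altdef norm_mult norm_cis norm_of_real
      by (intro mult_mono) (auto simp: norm_mult)
  qed
  then show ?case by auto
next
  case (Suc N)
  have "iter_partial [i] f \<in> schwartz_space" using Suc.prems by (rule schwartz_iter_partial)
  from Suc.IH[OF this] obtain C
    where "\<And>\<omega>. \<bar>\<omega> $ i\<bar> ^ N * norm (inverse_fourier (iter_partial [i] f) \<omega>) \<le> C" by blast
  then show ?case
    by (intro exI[of _ C]) (simp add: inverse_fourier_partial[OF Suc.prems] norm_mult mult_ac)
qed

lemma inverse_fourier_decay:
  assumes f: "f \<in> schwartz_space"
  obtains C where "\<And>\<omega>. norm (inverse_fourier f \<omega>) \<le> C / (1 + norm \<omega>) ^ N"
proof -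
  let ?u = "\<lambda>\<omega>. norm (inverse_fourier f \<omega>)"
  obtain C0 where C0: "\<And>\<omega>. ?u \<omega> \<le> C0"
    using inverse_fourier_component_decay[OF f, of _ 0] by auto
  obtain C1 where C1: "\<And>\<omega>. \<bar>\<omega> $ 1\<bar> ^ N * ?u \<omega> \<le> C1"
    using inverse_fourier_component_decay[OF f] by blast
  obtain C2 where C2: "\<And>\<omega>. \<bar>\<omega> $ 2\<bar> ^ N * ?u \<omega> \<le> C2"
    using inverse_fourier_component_decay[OF f] by blast
  have "?u \<omega> \<le> (3 ^ N * (C0 + C1 + C2)) / (1 + norm \<omega>) ^ N" for \<omega>
  proof -
    let ?m = "max 1 (max \<bar>\<omega> $ 1\<bar> \<bar>\<omega> $ 2\<bar>)"
    have "norm \<omega> \<le> \<bar>\<omega> $ 1\<bar> + \<bar>\<omega> $ 2\<bar>"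
      using norm_le_l1_cart[of \<omega>] by (simp add: sum_2)
    then have "1 + norm \<omega> \<le> 3 * ?m" by linarith
    then have "(1 + norm \<omega>) ^ N \<le> (3 * ?m) ^ N" by (intro power_mono) auto
    also have "\<dots> = 3 ^ N * ?m ^ N" by (simp add: power_mult_distrib)
    also have "?m ^ N \<le> 1 + \<bar>\<omega> $ 1\<bar> ^ N + \<bar>\<omega> $ 2\<bar> ^ N"
      by (auto simp: max_def)
    finally have "(1 + norm \<omega>) ^ N * ?u \<omega> \<le> (3 ^ N * (1 + \<bar>\<omega> $ 1\<bar> ^ N + \<bar>\<omega> $ 2\<bar> ^ N)) * ?u \<omega>"
      by (intro mult_right_mono) auto
    also have "\<dots> = 3 ^ N * (?u \<omega> + \<bar>\<omega> $ 1\<bar> ^ N * ?u \<omega> + \<bar>\<omega> $ 2\<bar> ^ N * ?u \<omega>)"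
      by (simp add: algebra_simps)
    also have "\<dots> \<le> 3 ^ N * (C0 + C1 + C2)"
      by (intro mult_left_mono add_mono C0 C1 C2) auto
    finally show ?thesis
      by (simp add: pos_le_divide_eq add_pos_nonneg mult.commute)
  qed
  then show ?thesis by (rule that)
qed

text \<open>The sign \<open>s = 1\<close> serves inverse transforms and \<open>s = - 1\<close> forward transforms.\<close>

lemma Fubini_multiplication_formula:
  fixes f g :: "real^2 \<Rightarrow> complex"
  assumes f: "integrable lborel f" and g: "integrable lborel g"
  shows "(\<integral>\<omega>. g \<omega> * (\<integral>x. cis (s * (\<omega> \<bullet> x)) * f x \<partial>lborel) \<partial>lborel)
    = (\<integral>x. (\<integral>\<omega>. cis (s * (\<omega> \<bullet> x)) * g \<omega> \<partial>lborel) * f x \<partial>lborel)"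
proof -
  have [measurable]: "f \<in> borel_measurable borel" "g \<in> borel_measurable borel"
    using f g by (auto dest: borel_measurable_integrable)
  let ?F = "\<lambda>\<omega> x. cis (s * (\<omega> \<bullet> x)) * (g \<omega> * f x)"
  have "integrable (lborel \<Otimes>\<^sub>M lborel) (\<lambda>(\<omega>, x). ?F \<omega> x)"
  proof (rule lborel_pair.Fubini_integrable)
    show "integrable lborel (\<lambda>\<omega>. \<integral>x. norm (case (\<omega>, x) of (\<omega>, x) \<Rightarrow> ?F \<omega> x) \<partial>lborel)"
      using g by (simp add: norm_mult)
    show "AE \<omega> in lborel. integrable lborel (\<lambda>x. case (\<omega>, x) of (\<omega>, x) \<Rightarrow> ?F \<omega> x)"
    proof (intro AE_I2)
      fix \<omega>
      show "integrable lborel (\<lambda>x. case (\<omega>, x) of (\<omega>, x) \<Rightarrow> ?F \<omega> x)"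
        using integrable_cis_mult[of "\<lambda>x. g \<omega> * f x" "s *\<^sub>R \<omega>"] f by simp
    qed
  qed measurable
  moreover have "g \<omega> * (\<integral>x. cis (s * (\<omega> \<bullet> x)) * f x \<partial>lborel) = (\<integral>x. ?F \<omega> x \<partial>lborel)" for \<omega>
    by (simp add: mult_ac del: integral_mult_right_zero integral_mult_left_zero flip: integral_mult_right_zero)
  moreover have "(\<integral>\<omega>. cis (s * (\<omega> \<bullet> x)) * g \<omega> \<partial>lborel) * f x = (\<integral>\<omega>. ?F \<omega> x \<partial>lborel)" for x
    by (simp add: mult_ac del: integral_mult_right_zero integral_mult_left_zero flip: integral_mult_right_zero)
  ultimately show ?thesis
    using lborel_pair.Fubini_integral[of ?F] by simp
qed

lemma integrable_inverse_fourier: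
  assumes f: "f \<in> schwartz_space" shows "integrable lborel (inverse_fourier f)"
proof -
  obtain C where "\<And>\<omega>. norm (inverse_fourier f \<omega>) \<le> C / (1 + norm \<omega>) ^ 4"
    using inverse_fourier_decay[OF f] by blast
  then show ?thesis
    by (intro integrable_of_decay inverse_fourier_measurable schwartz_measurable f)
qed

context anisotropy
begin

lemma heat_uminus: "heat t (- x) = heat t x"
  using heat_minus[of t 0 x] by simp

lemma heat_scale: "t > 0 \<Longrightarrow> t * heat t (sqrt t *\<^sub>R y) = heat 1 y"
  using det_R by (simp add: heat_def matrix_vector_mult_scaleR power_mult_distrib field_simps)

text \<open>Writing \<open>x = a + sqrt t y\<close> puts the dependence on t into the argument of f, where dominated
convergence applies.\<close>

lemma heat_approximate_identity:
  fixes f :: "real^2 \<Rightarrow> 'b::{banach, second_countable_topology}"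
  assumes [measurable]: "f \<in> borel_measurable borel" and bd: "\<And>x. norm (f x) \<le> B" and cont: "isCont f a"
  shows "(\<lambda>n. \<integral>x. heat (1 / real (Suc n)) (x - a) *\<^sub>R f x \<partial>lborel) \<longlonglongrightarrow> f a"
proof -
  let ?t = "\<lambda>n. 1 / real (Suc n)"
  have eq: "(\<integral>x. heat (?t n) (x - a) *\<^sub>R f x \<partial>lborel) = (\<integral>y. heat 1 y *\<^sub>R f (a + sqrt (?t n) *\<^sub>R y) \<partial>lborel)" for n
  proof -
    have t: "?t n > 0" by simp
    have "(\<integral>x. heat (?t n) (x - a) *\<^sub>R f x \<partial>lborel) = (sqrt (?t n))\<^sup>2 *\<^sub>R (\<integral>y. heat (?t n) ((a + sqrt (?t n) *\<^sub>R y) - a) *\<^sub>R f (a + sqrt (?t n) *\<^sub>R y) \<partial>lborel)"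
      by (rule lborel_integral_affine) simp_all
    also have "\<dots> = (\<integral>y. ?t n *\<^sub>R (heat (?t n) (sqrt (?t n) *\<^sub>R y) *\<^sub>R f (a + sqrt (?t n) *\<^sub>R y)) \<partial>lborel)"
      by (simp only: integral_scaleR_right real_sqrt_pow2[OF less_imp_le[OF t]] add_diff_cancel_left')
    also have "\<dots> = (\<integral>y. heat 1 y *\<^sub>R f (a + sqrt (?t n) *\<^sub>R y) \<partial>lborel)"
      unfolding scaleR_scaleR heat_scale[OF t] ..
    finally show ?thesis .
  qed
  have "(\<lambda>n. \<integral>y. heat 1 y *\<^sub>R f (a + sqrt (?t n) *\<^sub>R y) \<partial>lborel) \<longlonglongrightarrow> (\<integral>y. heat 1 y *\<^sub>R f a \<partial>lborel)"
  proof (rule integral_dominated_convergence[where w="\<lambda>y. heat 1 y * B"])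
    show "integrable lborel (\<lambda>y. heat 1 y * B)"
      using heat_integral[of 1] by (simp add: has_bochner_integral_iff)
    show "AE y in lborel. norm (heat 1 y *\<^sub>R f (a + sqrt (?t n) *\<^sub>R y)) \<le> heat 1 y * B" for n
      using bd heat_pos[of 1] by (auto intro!: mult_mono simp: less_imp_le)
    show "AE y in lborel. (\<lambda>n. heat 1 y *\<^sub>R f (a + sqrt (?t n) *\<^sub>R y)) \<longlonglongrightarrow> heat 1 y *\<^sub>R f a"
    proof (intro AE_I2 tendsto_scaleR tendsto_const)
      fix y
      have "(\<lambda>n. a + sqrt (?t n) *\<^sub>R y) \<longlonglongrightarrow> a + sqrt 0 *\<^sub>R y"
        by (intro tendsto_add tendsto_scaleR tendsto_const tendsto_real_sqrt one_over_Suc_tendsto)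
      then have "(\<lambda>n. a + sqrt (?t n) *\<^sub>R y) \<longlonglongrightarrow> a" by simp
      then show "(\<lambda>n. f (a + sqrt (?t n) *\<^sub>R y)) \<longlonglongrightarrow> f a"
        by (rule isCont_tendsto_compose[OF cont])
    qed
  qed measurable
  moreover have "(\<integral>y. heat 1 y *\<^sub>R f a \<partial>lborel) = f a"
    using heat_integral[of 1] by (simp add: has_bochner_integral_iff)
  ultimately show ?thesis unfolding eq by simp
qed

lemma integrable_gaussian: "t > 0 \<Longrightarrow> integrable lborel (\<lambda>\<omega>. exp (- t * (norm (R *v \<omega>))\<^sup>2))"
proof -
  assume "t > 0"
  then have "integrable lborel (\<lambda>\<omega>. complex_of_real (exp (- t * (norm (R *v \<omega>))\<^sup>2)))"
    using fourier_gaussian[of t 0] by (simp add: has_bochner_integral_iff)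
  then show ?thesis by (simp only: complex_of_real_integrable_eq)
qed

text \<open>Fourier inversion at the origin, the only point seen by the Dirac distribution. The Gaussian factor
g makes Fubini's theorem applicable; its Fourier transform is an approximate identity, so the
regularised integrals tend to \<open>f 0\<close>, and they also tend to the integral in question.\<close>

lemma integral_inverse_fourier:
  assumes f: "f \<in> schwartz_space"
  shows "(\<integral>\<omega>. inverse_fourier f \<omega> \<partial>lborel) = f 0"
proof -
  let ?t = "\<lambda>n. 1 / real (Suc n)"
  let ?g = "\<lambda>n \<omega>. complex_of_real (exp (- ?t n * (norm (R *v \<omega>))\<^sup>2))"
  have [measurable]: "f \<in> borel_measurable borel" by (rule schwartz_measurable[OF f])
  have eq: "(\<integral>\<omega>. ?g n \<omega> * inverse_fourier f \<omega> \<partial>lborel) = (\<integral>x. heat (?t n) (x - 0) *\<^sub>R f x \<partial>lborel)" for n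
  proof -
    have t: "?t n > 0" by simp
    have gi: "integrable lborel (?g n)" by (intro integrable_of_real integrable_gaussian t)
    have "(\<integral>\<omega>. cis (1 * (\<omega> \<bullet> x)) * ?g n \<omega> \<partial>lborel) = complex_of_real ((2 * pi)\<^sup>2 * heat (?t n) x)" for x
      using fourier_gaussian[OF t, of "- x"] by (simp add: has_bochner_integral_iff heat_uminus del: of_real_mult)
    then have "(\<integral>\<omega>. ?g n \<omega> * (\<integral>x. cis (1 * (\<omega> \<bullet> x)) * f x \<partial>lborel) \<partial>lborel) = (\<integral>x. complex_of_real ((2 * pi)\<^sup>2 * heat (?t n) x) * f x \<partial>lborel)"
      using Fubini_multiplication_formula[OF schwartz_integrable[OF f] gi, of 1] by simp
    also have "\<dots> = complex_of_real ((2 * pi)\<^sup>2) * (\<integral>x. heat (?t n) (x - 0) *\<^sub>R f x \<partial>lborel)"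
      by (simp add: scaleR_conv_of_real mult.assoc)
    finally show ?thesis
      by (simp add: inverse_fourier_altdef mult.left_commute)
  qed
  obtain B where B: "\<And>x. norm (f x) \<le> B"
    using schwartz_decay[OF f, of 0] by auto
  have "isCont f 0"
    using schwartz_continuous[OF f] by (simp add: continuous_on_eq_continuous_at)
  then have lim1: "(\<lambda>n. \<integral>\<omega>. ?g n \<omega> * inverse_fourier f \<omega> \<partial>lborel) \<longlonglongrightarrow> f 0"
    unfolding eq using B by (intro heat_approximate_identity) simp_all
  have "(\<lambda>n. \<integral>\<omega>. ?g n \<omega> * inverse_fourier f \<omega> \<partial>lborel) \<longlonglongrightarrow> (\<integral>\<omega>. inverse_fourier f \<omega> \<partial>lborel)"
  proof (rule integral_dominated_convergence[where w="\<lambda>\<omega>. norm (inverse_fourier f \<omega>)"])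
    show "integrable lborel (\<lambda>\<omega>. norm (inverse_fourier f \<omega>))"
      by (intro integrable_norm integrable_inverse_fourier f)
    show "AE \<omega> in lborel. norm (?g n \<omega> * inverse_fourier f \<omega>) \<le> norm (inverse_fourier f \<omega>)" for n
      by (intro AE_I2) (simp add: norm_mult mult_left_le_one_le)
    show "AE \<omega> in lborel. (\<lambda>n. ?g n \<omega> * inverse_fourier f \<omega>) \<longlonglongrightarrow> inverse_fourier f \<omega>"
    proof (intro AE_I2)
      fix \<omega>
      have "(\<lambda>n. complex_of_real (exp (- ?t n * (norm (R *v \<omega>))\<^sup>2)) * inverse_fourier f \<omega>) \<longlonglongrightarrow> complex_of_real (exp (- 0 * (norm (R *v \<omega>))\<^sup>2)) * inverse_fourier f \<omega>"
        by (intro tendsto_mult tendsto_of_real tendsto_exp tendsto_minus tendsto_const one_over_Suc_tendsto)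
      then show "(\<lambda>n. ?g n \<omega> * inverse_fourier f \<omega>) \<longlonglongrightarrow> inverse_fourier f \<omega>" by simp
    qed
  qed measurable
  then show ?thesis using lim1 by (rule LIMSEQ_unique)
qed

end

section \<open>Gaussian mixtures are Schwartz functions\<close>

text \<open>Read \<open>V k\<close> as the k-th derivative of a radial profile \<open>V 0\<close>. Repeated partial derivatives of
\<open>V 0 (|A (x - a)|\<^sup>2)\<close> are sums of products of coordinates of \<open>x - a\<close> with some \<open>V k (|A (x - a)|\<^sup>2)\<close>.
Describing them by a set that is closed under partial derivatives avoids explicit formulas for them.\<close>

inductive_set profile_span :: "(nat \<Rightarrow> real \<Rightarrow> real) \<Rightarrow> real^2^2 \<Rightarrow> real^2 \<Rightarrow> (real^2 \<Rightarrow> real) set"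
  for V A a where
  profile: "(\<lambda>x. V k ((norm (A *v (x - a)))\<^sup>2)) \<in> profile_span V A a"
| coordinate: "u \<in> profile_span V A a \<Longrightarrow> (\<lambda>x. (x - a) $ j * u x) \<in> profile_span V A a"
| scale: "u \<in> profile_span V A a \<Longrightarrow> (\<lambda>x. c * u x) \<in> profile_span V A a"
| add: "u \<in> profile_span V A a \<Longrightarrow> v \<in> profile_span V A a \<Longrightarrow> (\<lambda>x. u x + v x) \<in> profile_span V A a"

lemma profile_span_derivative:
  assumes V: "\<And>k r. (V k has_real_derivative V (Suc k) r) (at r)"
    and u: "u \<in> profile_span V A a"
  shows "\<exists>u'. (\<forall>i::2. u' i \<in> profile_span V A a) \<and>
    (\<forall>x. (u has_derivative (\<lambda>h. h$1 * u' 1 x + h$2 * u' 2 x)) (at x))"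
  using u
proof induction
  case (profile k)
  define B where "B = transpose A ** A"
  let ?Q = "\<lambda>x. (norm (A *v (x - a)))\<^sup>2"
  let ?u' = "\<lambda>i x. 2 * B $ i $ 1 * ((x - a) $ 1 * V (Suc k) (?Q x)) + 2 * B $ i $ 2 * ((x - a) $ 2 * V (Suc k) (?Q x))"
  have m: "?u' i \<in> profile_span V A a" for i
    by (intro profile_span.intros)
  have d: "((\<lambda>x. V k (?Q x)) has_derivative (\<lambda>h. h$1 * ?u' 1 x + h$2 * ?u' 2 x)) (at x)" for x
  proof -
    have "((\<lambda>x. A *v (x - a)) has_derivative (\<lambda>h. A *v h)) (at x)"
      by (intro derivative_eq_intros bounded_linear.has_derivative[OF matrix_vector_mul_bounded_linear]) auto
    from has_derivative_inner[OF this this]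
    have Q: "(?Q has_derivative (\<lambda>h. 2 * ((A *v (x - a)) \<bullet> (A *v h)))) (at x)"
      by (simp add: power2_norm_eq_inner inner_commute)
    have e1: "2 * ((A *v y) \<bullet> (A *v h)) = 2 * ((B *v y) \<bullet> h)" for y h
      by (simp add: B_def matrix_vector_mul_assoc[symmetric] dot_lmul_matrix)
    have e2: "2 * ((B *v y) \<bullet> h) * W = h$1 * (2 * B$1$1 * (y$1 * W) + 2 * B$1$2 * (y$2 * W)) +
        h$2 * (2 * B$2$1 * (y$1 * W) + 2 * B$2$2 * (y$2 * W))" for y h W
      by (simp add: inner_2 matrix_vector_mult_def sum_2 algebra_simps)
    have eq: "2 * ((A *v y) \<bullet> (A *v h)) * W = h$1 * (2 * B$1$1 * (y$1 * W) + 2 * B$1$2 * (y$2 * W)) +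
        h$2 * (2 * B$2$1 * (y$1 * W) + 2 * B$2$2 * (y$2 * W))" for y h W
      by (simp only: e1 e2)
    have "((\<lambda>x. V k (?Q x)) has_derivative (\<lambda>h. 2 * ((A *v (x - a)) \<bullet> (A *v h)) * V (Suc k) (?Q x))) (at x)"
      using DERIV_compose_FDERIV[OF V Q] by simp
    then show ?thesis unfolding eq .
  qed
  show ?case by (intro exI[of _ ?u'] conjI allI m d)
next
  case (coordinate u j)
  then obtain u' where u': "\<And>i::2. u' i \<in> profile_span V A a"
    "\<And>x. (u has_derivative (\<lambda>h. h$1 * u' 1 x + h$2 * u' 2 x)) (at x)" by blast
  let ?v = "\<lambda>i x. (if i = j then 1 else 0) * u x + (x - a) $ j * u' i x"
  have m: "?v i \<in> profile_span V A a" for i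
    by (intro profile_span.intros coordinate.hyps u')
  have d: "((\<lambda>x. (x - a) $ j * u x) has_derivative (\<lambda>h. h$1 * ?v 1 x + h$2 * ?v 2 x)) (at x)" for x
  proof -
    have "((\<lambda>x. (x - a) $ j) has_derivative (\<lambda>h. h $ j)) (at x)"
      by (auto intro!: derivative_eq_intros bounded_linear.has_derivative[OF bounded_linear_vec_nth])
    from has_derivative_mult[OF this u'(2)[of x]]
    show ?thesis
      by (rule has_derivative_eq_rhs) (use exhaust_2[of j] in \<open>auto simp: fun_eq_iff algebra_simps\<close>)
  qed
  show ?case by (intro exI[of _ ?v] conjI allI m d)
next
  case (scale u c)
  then obtain u' where u': "\<And>i::2. u' i \<in> profile_span V A a"
    "\<And>x. (u has_derivative (\<lambda>h. h$1 * u' 1 x + h$2 * u' 2 x)) (at x)" by blast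
  have "((\<lambda>x. c * u x) has_derivative (\<lambda>h. h$1 * (c * u' 1 x) + h$2 * (c * u' 2 x))) (at x)" for x
    by (rule has_derivative_eq_rhs[OF has_derivative_mult_right[OF u'(2)]]) (simp add: fun_eq_iff algebra_simps)
  then show ?case
    by (intro exI[of _ "\<lambda>i x. c * u' i x"] conjI allI profile_span.scale u')
next
  case (add u v)
  then obtain u' v' where u': "\<And>i::2. u' i \<in> profile_span V A a"
    "\<And>x. (u has_derivative (\<lambda>h. h$1 * u' 1 x + h$2 * u' 2 x)) (at x)"
    and v': "\<And>i::2. v' i \<in> profile_span V A a"
    "\<And>x. (v has_derivative (\<lambda>h. h$1 * v' 1 x + h$2 * v' 2 x)) (at x)" by blast
  have "((\<lambda>x. u x + v x) has_derivative (\<lambda>h. h$1 * (u' 1 x + v' 1 x) + h$2 * (u' 2 x + v' 2 x))) (at x)" for x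
    by (rule has_derivative_eq_rhs[OF has_derivative_add[OF u'(2) v'(2)]]) (simp add: fun_eq_iff algebra_simps)
  then show ?case
    by (intro exI[of _ "\<lambda>i x. u' i x + v' i x"] conjI allI profile_span.add u' v')
qed

text \<open>Because A has a left inverse, \<open>norm (A *v (x - a))\<close> controls \<open>norm x\<close>, so the decay of the profiles
carries over; every coordinate factor costs one power of \<open>1 + norm x\<close>.\<close>

lemma profile_span_decay:
  assumes V: "\<And>k N. \<exists>C. \<forall>r\<ge>0. (1 + r) ^ N * \<bar>V k r\<bar> \<le> C"
    and A: "B ** A = mat 1"
    and u: "u \<in> profile_span V A a"
  shows "\<exists>C. \<forall>x. (1 + norm x) ^ N * \<bar>u x\<bar> \<le> C"
  using u
proof (induction arbitrary: N)
  case (profile k)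
  obtain L where L: "L > 0" "\<And>x. norm (B *v x) \<le> norm x * L"
    using bounded_linear.pos_bounded[OF matrix_vector_mul_bounded_linear[of B]] by blast
  obtain C where C: "\<And>r. r \<ge> 0 \<Longrightarrow> (1 + r) ^ N * \<bar>V k r\<bar> \<le> C" using V by blast
  let ?K = "1 + norm a + L"
  have "(1 + norm x) ^ N * \<bar>V k ((norm (A *v (x - a)))\<^sup>2)\<bar> \<le> ?K ^ N * C" for x
  proof -
    let ?y = "norm (A *v (x - a))"
    have "x - a = B *v (A *v (x - a))" by (simp add: matrix_vector_mul_assoc A)
    then have "norm (x - a) \<le> ?y * L" using L(2)[of "A *v (x - a)"] by simp
    moreover have "norm x \<le> norm a + norm (x - a)" by (metis norm_triangle_sub)
    moreover have "2 * ?y \<le> 1 + ?y\<^sup>2"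
      using zero_le_power2[of "?y - 1"] by (simp add: power2_diff)
    then have "?y \<le> 1 + ?y\<^sup>2"
      using norm_ge_zero[of "A *v (x - a)"] by linarith
    then have "?y * L \<le> (1 + ?y\<^sup>2) * L" using L by (intro mult_right_mono) auto
    ultimately have "1 + norm x \<le> 1 + norm a + (1 + ?y\<^sup>2) * L" by linarith
    also have "\<dots> \<le> ?K * (1 + ?y\<^sup>2)"
    proof -
      have "?K * (1 + ?y\<^sup>2) = 1 + norm a + (1 + ?y\<^sup>2) * L + (1 + norm a) * ?y\<^sup>2"
        by (simp add: algebra_simps)
      then show ?thesis by simp
    qed
    finally have "(1 + norm x) ^ N \<le> (?K * (1 + ?y\<^sup>2)) ^ N" by (intro power_mono) auto
    then have "(1 + norm x) ^ N * \<bar>V k (?y\<^sup>2)\<bar> \<le> (?K * (1 + ?y\<^sup>2)) ^ N * \<bar>V k (?y\<^sup>2)\<bar>"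
      by (rule mult_right_mono) simp
    also have "\<dots> = ?K ^ N * ((1 + ?y\<^sup>2) ^ N * \<bar>V k (?y\<^sup>2)\<bar>)"
      by (simp only: power_mult_distrib mult.assoc)
    also have "\<dots> \<le> ?K ^ N * C"
      using C[of "?y\<^sup>2"] L by (intro mult_left_mono zero_le_power) auto
    finally show ?thesis .
  qed
  then show ?case by blast
next
  case (coordinate u j)
  obtain C where C: "\<And>x. (1 + norm x) ^ Suc N * \<bar>u x\<bar> \<le> C" using coordinate.IH by blast
  have "(1 + norm x) ^ N * \<bar>(x - a) $ j * u x\<bar> \<le> (1 + norm a) * C" for x
  proof -
    have "\<bar>(x - a) $ j\<bar> \<le> norm (x - a)" by (rule component_le_norm_cart)
    also have "\<dots> \<le> norm x + norm a" by (rule norm_triangle_ineq4)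
    also have "\<dots> \<le> (1 + norm a) * (1 + norm x)" by (simp add: algebra_simps)
    finally have "\<bar>(x - a) $ j\<bar> * ((1 + norm x) ^ N * \<bar>u x\<bar>) \<le> ((1 + norm a) * (1 + norm x)) * ((1 + norm x) ^ N * \<bar>u x\<bar>)"
      by (intro mult_right_mono) auto
    also have "\<dots> = (1 + norm a) * ((1 + norm x) ^ Suc N * \<bar>u x\<bar>)" by (simp add: mult_ac)
    also have "\<dots> \<le> (1 + norm a) * C" by (intro mult_left_mono C) auto
    finally show ?thesis by (simp add: abs_mult mult_ac)
  qed
  then show ?case by blast
next
  case (scale u c)
  obtain C where C: "\<And>x. (1 + norm x) ^ N * \<bar>u x\<bar> \<le> C" using scale.IH by blast
  have "\<bar>c\<bar> * ((1 + norm x) ^ N * \<bar>u x\<bar>) \<le> \<bar>c\<bar> * C" for x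
    by (intro mult_left_mono C) auto
  then show ?case by (intro exI[of _ "\<bar>c\<bar> * C"]) (simp add: abs_mult mult_ac)
next
  case (add u v)
  obtain C D where C: "\<And>x. (1 + norm x) ^ N * \<bar>u x\<bar> \<le> C" and D: "\<And>x. (1 + norm x) ^ N * \<bar>v x\<bar> \<le> D"
    using add.IH by meson
  have "(1 + norm x) ^ N * \<bar>u x + v x\<bar> \<le> C + D" for x
  proof -
    have "(1 + norm x) ^ N * \<bar>u x + v x\<bar> \<le> (1 + norm x) ^ N * (\<bar>u x\<bar> + \<bar>v x\<bar>)"
      by (intro mult_left_mono abs_triangle_ineq) auto
    then show ?thesis using C[of x] D[of x] by (simp add: distrib_left)
  qed
  then show ?case by blast
qed

lemma iter_partial_profile_span:
  fixes A :: "real^2^2"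
  assumes V: "\<And>k r. (V k has_real_derivative V (Suc k) r) (at r)"
    and u: "u \<in> profile_span V A a"
  shows "\<exists>v\<in>profile_span V A a. iter_partial is (\<lambda>x. complex_of_real (u x)) = (\<lambda>x. complex_of_real (v x))"
proof (induction "is")
  case Nil
  then show ?case using u by auto
next
  case (Cons i "is")
  then obtain v where v: "v \<in> profile_span V A a" "iter_partial is (\<lambda>x. complex_of_real (u x)) = (\<lambda>x. complex_of_real (v x))" by blast
  from profile_span_derivative[OF V v(1)] obtain v' where v': "\<And>i::2. v' i \<in> profile_span V A a"
    "\<And>x. (v has_derivative (\<lambda>h. h$1 * v' 1 x + h$2 * v' 2 x)) (at x)" by blast
  have "frechet_derivative (\<lambda>x. complex_of_real (v x)) (at x) (axis i 1) = complex_of_real (v' i x)" for x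
  proof -
    have "((\<lambda>x. complex_of_real (v x)) has_derivative (\<lambda>h. complex_of_real (h$1 * v' 1 x + h$2 * v' 2 x))) (at x)"
      by (intro has_derivative_of_real v')
    from frechet_derivative_at[OF this]
    have "frechet_derivative (\<lambda>x. complex_of_real (v x)) (at x) = (\<lambda>h. complex_of_real (h$1 * v' 1 x + h$2 * v' 2 x))" by simp
    then show ?thesis using exhaust_2[of i] by (auto simp: axis_def)
  qed
  then have "iter_partial (i # is) (\<lambda>x. complex_of_real (u x)) = (\<lambda>x. complex_of_real (v' i x))"
    using v(2) by (simp add: iter_partial_def)
  then show ?case using v' by blast
qed

lemma profile_span_schwartz:
  fixes A B :: "real^2^2"
  assumes V: "\<And>k r. (V k has_real_derivative V (Suc k) r) (at r)"
    and bd: "\<And>k N. \<exists>C. \<forall>r\<ge>0. (1 + r) ^ N * \<bar>V k r\<bar> \<le> C"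
    and A: "B ** A = mat 1"
  shows "(\<lambda>x. complex_of_real (V 0 ((norm (A *v (x - a)))\<^sup>2))) \<in> schwartz_space"
  unfolding schwartz_space_def mem_Collect_eq
proof (intro allI conjI)
  fix "is" :: "2 list"
  have "(\<lambda>x. V 0 ((norm (A *v (x - a)))\<^sup>2)) \<in> profile_span V A a"
    by (rule profile_span.profile)
  from iter_partial_profile_span[OF V this] obtain v where v: "v \<in> profile_span V A a"
    "iter_partial is (\<lambda>x. complex_of_real (V 0 ((norm (A *v (x - a)))\<^sup>2))) = (\<lambda>x. complex_of_real (v x))"
    by blast
  from profile_span_derivative[OF V v(1)] obtain v' :: "2 \<Rightarrow> real^2 \<Rightarrow> real"
    where "\<And>x. (v has_derivative (\<lambda>h. h$1 * v' 1 x + h$2 * v' 2 x)) (at x)" by blast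
  then show "iter_partial is (\<lambda>x. complex_of_real (V 0 ((norm (A *v (x - a)))\<^sup>2))) differentiable (at x)" for x
    unfolding v(2) differentiable_def by (blast intro: has_derivative_of_real)
  fix N
  from profile_span_decay[OF bd A v(1), of N] obtain C where "\<And>x. (1 + norm x) ^ N * \<bar>v x\<bar> \<le> C" by blast
  then show "bounded (range (\<lambda>x. (1 + norm x) ^ N *\<^sub>R iter_partial is (\<lambda>x. complex_of_real (V 0 ((norm (A *v (x - a)))\<^sup>2))) x))"
    unfolding v(2) bounded_iff by (intro exI[of _ C]) auto
qed

lemma power_le_fact_mult_exp:
  fixes x :: real assumes "x \<ge> 0" shows "x ^ N \<le> fact N * exp x"
proof -
  have "(\<Sum>n\<in>{N}. x ^ n /\<^sub>R fact n) \<le> (\<Sum>n. x ^ n /\<^sub>R fact n)"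
    using assms summable_exp_generic[of x] by (intro sum_le_suminf) auto
  then have "x ^ N / fact N \<le> exp x"
    by (simp add: exp_def divide_inverse mult.commute)
  then show ?thesis by (simp add: field_simps)
qed

lemma exp_diff_le:
  fixes x y :: real assumes "x \<le> K" "y \<le> K"
  shows "\<bar>exp x - exp y\<bar> \<le> exp K * \<bar>x - y\<bar>"
proof -
  have *: "exp v - exp u \<le> exp K * (v - u)" if "u \<le> v" "v \<le> K" for u v :: real
  proof -
    have "exp v - exp u = exp v * (1 - exp (u - v))" by (simp add: exp_diff algebra_simps)
    also have "\<dots> \<le> exp K * (v - u)"
    proof (rule mult_mono)
      show "1 - exp (u - v) \<le> v - u"
        using exp_ge_add_one_self[of "u - v"] by linarith
    qed (use that in auto)
    finally show ?thesis .
  qed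
  show ?thesis
    using *[of x y] *[of y x] assms by (cases "x \<le> y") auto
qed

lemma exponential_mixture_integrable:
  fixes w c :: "real \<Rightarrow> real"
  assumes w: "integrable lborel w" and [measurable]: "c \<in> borel_measurable borel" and c: "\<And>t. \<bar>c t\<bar> \<le> M"
  shows "integrable lborel (\<lambda>t. w t * c t ^ k * exp (r * c t))"
proof (rule Bochner_Integration.integrable_bound)
  show "integrable lborel (\<lambda>t. w t * (M ^ k * exp (\<bar>r\<bar> * M)))"
    using w by (rule integrable_mult_left)
  have [measurable]: "w \<in> borel_measurable borel" using borel_measurable_integrable[OF w] by simp
  show "(\<lambda>t. w t * c t ^ k * exp (r * c t)) \<in> borel_measurable lborel" by measurable
  show "AE t in lborel. norm (w t * c t ^ k * exp (r * c t)) \<le> norm (w t * (M ^ k * exp (\<bar>r\<bar> * M)))"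
  proof (rule AE_I2)
    fix t
    have M: "0 \<le> M" by (rule order_trans[OF abs_ge_zero c[of t]])
    have "r * c t \<le> \<bar>r\<bar> * M"
      by (rule order_trans[OF abs_ge_self]) (simp add: abs_mult c mult_left_mono)
    then have "\<bar>c t\<bar> ^ k * exp (r * c t) \<le> M ^ k * exp (\<bar>r\<bar> * M)"
      using M by (intro mult_mono power_mono c) auto
    then show "norm (w t * c t ^ k * exp (r * c t)) \<le> norm (w t * (M ^ k * exp (\<bar>r\<bar> * M)))"
      using M by (simp add: abs_mult power_abs mult.assoc mult_left_mono)
  qed
qed

text \<open>Differentiation under the integral sign. The difference quotients of \<open>exp (r * c t)\<close> for arguments
within distance 1 of r are bounded independently of t, because c is bounded.\<close>

lemma exponential_mixture_derivative:
  fixes w c :: "real \<Rightarrow> real"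
  assumes w: "integrable lborel w" and [measurable]: "c \<in> borel_measurable borel" and c: "\<And>t. \<bar>c t\<bar> \<le> M"
  shows "((\<lambda>r. \<integral>t. w t * c t ^ k * exp (r * c t) \<partial>lborel) has_real_derivative
    (\<integral>t. w t * c t ^ Suc k * exp (r * c t) \<partial>lborel)) (at r)"
proof -
  let ?F = "\<lambda>r. \<integral>t. w t * c t ^ k * exp (r * c t) \<partial>lborel" and ?K = "exp ((\<bar>r\<bar> + 1) * M) * M"
  note int = exponential_mixture_integrable[OF assms]
  have [measurable]: "w \<in> borel_measurable borel" using borel_measurable_integrable[OF w] by simp
  have M: "0 \<le> M" using order_trans[OF abs_ge_zero c] .
  have "((\<lambda>s. (?F s - ?F r) / (s - r)) \<longlongrightarrow> (\<integral>t. w t * c t ^ Suc k * exp (r * c t) \<partial>lborel)) (at r within ball r 1)"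
    unfolding tendsto_at_iff_sequentially o_def
  proof (intro allI impI)
    fix X :: "nat \<Rightarrow> real" assume X: "\<forall>i. X i \<in> ball r 1 - {r}" "X \<longlonglongrightarrow> r"
    let ?q = "\<lambda>i t. (exp (X i * c t) - exp (r * c t)) / (X i - r)"
    have eq: "(?F (X i) - ?F r) / (X i - r) = (\<integral>t. w t * c t ^ k * ?q i t \<partial>lborel)" for i
      by (subst Bochner_Integration.integral_diff[OF int int, symmetric])
         (simp add: right_diff_distrib flip: integral_divide_zero)
    have "(\<lambda>i. \<integral>t. w t * c t ^ k * ?q i t \<partial>lborel) \<longlonglongrightarrow> (\<integral>t. w t * c t ^ k * (c t * exp (r * c t)) \<partial>lborel)"
    proof (rule integral_dominated_convergence[where w="\<lambda>t. \<bar>w t * (M ^ k * ?K)\<bar>"])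
      show "integrable lborel (\<lambda>t. \<bar>w t * (M ^ k * ?K)\<bar>)"
        by (intro integrable_abs integrable_mult_left w)
      show "AE t in lborel. (\<lambda>i. w t * c t ^ k * ?q i t) \<longlonglongrightarrow> w t * c t ^ k * (c t * exp (r * c t))"
      proof (intro AE_I2 tendsto_mult[OF tendsto_const])
        fix t
        have "((\<lambda>s. exp (s * c t)) has_real_derivative c t * exp (r * c t)) (at r)"
          by (auto intro!: derivative_eq_intros)
        then show "(\<lambda>i. ?q i t) \<longlonglongrightarrow> c t * exp (r * c t)"
          using X unfolding has_field_derivative_iff tendsto_at_iff_sequentially o_def by auto
      qed
      show "AE t in lborel. norm (w t * c t ^ k * ?q i t) \<le> \<bar>w t * (M ^ k * ?K)\<bar>" for i
      proof (rule AE_I2)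
        fix t
        have Xi: "\<bar>X i - r\<bar> < 1" "X i \<noteq> r" using X(1) by (auto simp: dist_real_def abs_minus_commute)
        have le: "s * c t \<le> (\<bar>r\<bar> + 1) * M" if "\<bar>s\<bar> \<le> \<bar>r\<bar> + 1" for s
          by (rule order_trans[OF abs_ge_self]) (use that c[of t] in \<open>simp add: abs_mult mult_mono\<close>)
        have "\<bar>exp (X i * c t) - exp (r * c t)\<bar> \<le> exp ((\<bar>r\<bar> + 1) * M) * \<bar>X i * c t - r * c t\<bar>"
          using Xi by (intro exp_diff_le le) auto
        also have "\<bar>X i * c t - r * c t\<bar> = \<bar>c t\<bar> * \<bar>X i - r\<bar>"
          by (simp add: left_diff_distrib[symmetric] abs_mult mult.commute)
        also have "\<dots> \<le> M * \<bar>X i - r\<bar>" by (intro mult_right_mono c) simp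
        finally have "\<bar>exp (X i * c t) - exp (r * c t)\<bar> \<le> ?K * \<bar>X i - r\<bar>"
          by (simp add: mult.assoc)
        then have "\<bar>?q i t\<bar> \<le> ?K"
          using Xi(2) unfolding abs_divide by (subst pos_divide_le_eq) auto
        then have "\<bar>c t\<bar> ^ k * \<bar>?q i t\<bar> \<le> M ^ k * ?K"
          using M by (intro mult_mono power_mono c) auto
        then have "\<bar>w t\<bar> * (\<bar>c t\<bar> ^ k * \<bar>?q i t\<bar>) \<le> \<bar>w t\<bar> * (M ^ k * ?K)"
          by (rule mult_left_mono) simp
        then show "norm (w t * c t ^ k * ?q i t) \<le> \<bar>w t * (M ^ k * ?K)\<bar>"
          using M unfolding real_norm_def abs_mult[of "w t"] abs_mult[of "w t * _"] power_abs[symmetric]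
          by (simp only: abs_of_nonneg mult_nonneg_nonneg zero_le_power exp_ge_zero mult.assoc)
      qed
    qed measurable
    also have "(\<integral>t. w t * c t ^ k * (c t * exp (r * c t)) \<partial>lborel) = (\<integral>t. w t * c t ^ Suc k * exp (r * c t) \<partial>lborel)"
      by (simp add: mult_ac)
    finally show "(\<lambda>i. (?F (X i) - ?F r) / (X i - r)) \<longlonglongrightarrow> (\<integral>t. w t * c t ^ Suc k * exp (r * c t) \<partial>lborel)"
      unfolding eq .
  qed
  then show ?thesis
    unfolding has_field_derivative_iff by (simp add: at_within_open[of r "ball r 1"])
qed

context anisotropy
begin

text \<open>The mixture is an exponential mixture in the squared distance \<open>r = |A x|\<^sup>2\<close>, with this rate. The
weight vanishes for \<open>t \<le> 0\<close>, so the rate may be set to 0 there, which keeps it bounded.\<close>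

definition mixture_rate :: "real \<Rightarrow> real \<Rightarrow> real" where
  "mixture_rate \<epsilon> t = (if t > 0 then - 1 / (4 * (t + \<epsilon>)) else 0)"

definition mixture_weight :: "real \<Rightarrow> real \<Rightarrow> real \<Rightarrow> real" where
  "mixture_weight b \<epsilon> t = gamma_density b t / (4 * pi * (t + \<epsilon>) * \<bar>det R\<bar>)"

definition mixture_profile :: "real \<Rightarrow> real \<Rightarrow> nat \<Rightarrow> real \<Rightarrow> real" where
  "mixture_profile b \<epsilon> k r = (\<integral>t. mixture_weight b \<epsilon> t * mixture_rate \<epsilon> t ^ k * exp (r * mixture_rate \<epsilon> t) \<partial>lborel)"

lemma mixture_rate_measurable [measurable]: "mixture_rate \<epsilon> \<in> borel_measurable borel"
  unfolding mixture_rate_def by measurable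

lemma mixture_profile_0: "mixture_profile b \<epsilon> 0 ((norm (A *v x))\<^sup>2) = mixture b \<epsilon> x"
  unfolding mixture_profile_def mixture_def
  by (intro Bochner_Integration.integral_cong refl)
     (simp add: mixture_weight_def mixture_rate_def heat_def gamma_density_def)

lemma mixture_weight_bounds:
  assumes b: "b > 0" and \<epsilon>: "\<epsilon> > 0"
  shows "0 \<le> mixture_weight b \<epsilon> t" "mixture_weight b \<epsilon> t \<le> gamma_density b t * (1 / (4 * pi * \<epsilon> * \<bar>det R\<bar>))"
proof -
  have "4 * pi * \<epsilon> * \<bar>det R\<bar> > 0" using \<epsilon> det_R by simp
  moreover have "4 * pi * \<epsilon> * \<bar>det R\<bar> \<le> 4 * pi * (t + \<epsilon>) * \<bar>det R\<bar>" if "t > 0"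
    using that by (intro mult_right_mono mult_left_mono) auto
  ultimately have "t > 0 \<Longrightarrow> gamma_density b t / (4 * pi * (t + \<epsilon>) * \<bar>det R\<bar>) \<le> gamma_density b t / (4 * pi * \<epsilon> * \<bar>det R\<bar>)"
    using b by (intro frac_le) auto
  then show "mixture_weight b \<epsilon> t \<le> gamma_density b t * (1 / (4 * pi * \<epsilon> * \<bar>det R\<bar>))"
    by (cases "t > 0") (simp_all add: mixture_weight_def gamma_density_def[of b t])
  show "0 \<le> mixture_weight b \<epsilon> t"
    using b \<epsilon> by (cases "t > 0") (simp_all add: mixture_weight_def gamma_density_def[of b t])
qed

lemma integrable_mixture_weight:
  assumes b: "b > 0" and \<epsilon>: "\<epsilon> > 0"
  shows "integrable lborel (mixture_weight b \<epsilon>)"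
proof (rule Bochner_Integration.integrable_bound)
  show "integrable lborel (\<lambda>t. gamma_density b t * (1 / (4 * pi * \<epsilon> * \<bar>det R\<bar>)))"
    using integral_gamma_density[OF b] by (intro integrable_mult_left) (simp add: has_bochner_integral_iff)
  show "AE t in lborel. norm (mixture_weight b \<epsilon> t) \<le> norm (gamma_density b t * (1 / (4 * pi * \<epsilon> * \<bar>det R\<bar>)))"
    using mixture_weight_bounds[OF b \<epsilon>] unfolding real_norm_def
    by (intro AE_I2) (simp add: order_trans[OF _ abs_ge_self] del: times_divide_eq_right)
qed (simp add: mixture_weight_def[abs_def])

lemma mixture_rate_bounds:
  assumes "\<epsilon> > 0" shows "mixture_rate \<epsilon> t \<le> 0" "\<bar>mixture_rate \<epsilon> t\<bar> \<le> 1 / (4 * \<epsilon>)"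
  using assms by (auto simp: mixture_rate_def field_simps)

lemma mixture_profile_derivative:
  assumes b: "b > 0" and \<epsilon>: "\<epsilon> > 0"
  shows "(mixture_profile b \<epsilon> k has_real_derivative mixture_profile b \<epsilon> (Suc k) r) (at r)"
  unfolding mixture_profile_def
  by (rule exponential_mixture_derivative[OF integrable_mixture_weight[OF b \<epsilon>] mixture_rate_measurable
        mixture_rate_bounds(2)[OF \<epsilon>]])

text \<open>With \<open>y = (1 + r) / (4 (t + \<epsilon>))\<close>, the bound \<open>y ^ N * exp (- y) \<le> fact N\<close> trades powers of \<open>1 + r\<close>
for powers of \<open>t + \<epsilon>\<close>. These are absorbed by \<open>exp (t / 2)\<close>, which has a finite gamma mean.\<close>

lemma mixture_profile_decay:
  assumes b: "b > 0" and \<epsilon>: "\<epsilon> > 0"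
  shows "\<exists>C. \<forall>r\<ge>0. (1 + r) ^ N * \<bar>mixture_profile b \<epsilon> k r\<bar> \<le> C"
proof -
  let ?w = "mixture_weight b \<epsilon>" and ?c = "mixture_rate \<epsilon>" and ?M = "1 / (4 * \<epsilon>)"
  let ?K = "1 / (4 * pi * \<epsilon> * \<bar>det R\<bar>)" and ?E = "exp ?M * (fact N * (8 ^ N * (fact N * exp (\<epsilon> / 2))))"
  let ?D = "\<lambda>t. gamma_density b t * exp (t / 2) * (?K * (?M ^ k * ?E))"
  have D: "integrable lborel ?D"
    using laplace_gamma_density[OF b, of "- 1/2"] by (intro integrable_mult_left) (simp add: has_bochner_integral_iff)
  note int = exponential_mixture_integrable[OF integrable_mixture_weight[OF b \<epsilon>] mixture_rate_measurable mixture_rate_bounds(2)[OF \<epsilon>]]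
  have "(1 + r) ^ N * \<bar>mixture_profile b \<epsilon> k r\<bar> \<le> integral\<^sup>L lborel ?D" if r: "r \<ge> 0" for r
  proof -
    have le: "(1 + r) ^ N * \<bar>?w t * ?c t ^ k * exp (r * ?c t)\<bar> \<le> ?D t" for t
    proof (cases "t > 0")
      case True
      \<comment> \<open>The exponent after \<open>r\<close> is replaced by \<open>1 + r\<close>, at the cost of the factor \<open>exp (- ?c t)\<close>.\<close>
      define y where "y = (1 + r) * - ?c t"
      have c: "- ?c t > 0" "- ?c t \<le> ?M" and inv: "1 / - ?c t = 8 * ((t + \<epsilon>) / 2)"
        using True \<epsilon> mixture_rate_bounds[OF \<epsilon>, of t] by (auto simp: mixture_rate_def)
      have y: "y \<ge> 0" unfolding y_def using c(1) r by (intro mult_nonneg_nonneg) auto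
      have "1 + r = (1 / - ?c t) * y" using c by (simp add: y_def)
      moreover have "exp (r * ?c t) = exp (- y) * exp (- ?c t)"
        by (simp only: mult_exp_exp) (simp add: y_def algebra_simps)
      ultimately have eq: "(1 + r) ^ N * exp (r * ?c t) = (1 / - ?c t) ^ N * (y ^ N * exp (- y)) * exp (- ?c t)"
        by (simp only: power_mult_distrib mult_ac)
      have 1: "y ^ N * exp (- y) \<le> fact N"
        using power_le_fact_mult_exp[OF y, of N] by (simp add: exp_minus field_simps)
      have "((t + \<epsilon>) / 2) ^ N \<le> fact N * exp ((t + \<epsilon>) / 2)"
        using True \<epsilon> by (intro power_le_fact_mult_exp) auto
      also have "exp ((t + \<epsilon>) / 2) = exp (t / 2) * exp (\<epsilon> / 2)"
        by (simp add: mult_exp_exp add_divide_distrib)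
      finally have 2: "(1 / - ?c t) ^ N \<le> 8 ^ N * (fact N * (exp (t / 2) * exp (\<epsilon> / 2)))"
        unfolding inv power_mult_distrib by (rule mult_left_mono) simp
      have 3: "exp (- ?c t) \<le> exp ?M" using c by simp
      have E: "(1 + r) ^ N * exp (r * ?c t) \<le> 8 ^ N * (fact N * (exp (t / 2) * exp (\<epsilon> / 2))) * fact N * exp ?M"
        unfolding eq by (rule mult_mono[OF mult_mono[OF 2 1] 3]) (use c y in auto)
      have "\<bar>?c t\<bar> ^ k \<le> ?M ^ k" by (intro power_mono mixture_rate_bounds \<epsilon>) auto
      from mult_mono[OF mult_mono[OF mixture_weight_bounds(2)[OF b \<epsilon>, of t] this] E]
      have "?w t * \<bar>?c t\<bar> ^ k * ((1 + r) ^ N * exp (r * ?c t)) \<le>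
          gamma_density b t * ?K * ?M ^ k * (8 ^ N * (fact N * (exp (t / 2) * exp (\<epsilon> / 2))) * fact N * exp ?M)"
        using b \<epsilon> r by simp
      also have "\<dots> = ?D t" by (simp only: mult_ac)
      also have "?w t * \<bar>?c t\<bar> ^ k * ((1 + r) ^ N * exp (r * ?c t)) = (1 + r) ^ N * \<bar>?w t * ?c t ^ k * exp (r * ?c t)\<bar>"
        using mixture_weight_bounds(1)[OF b \<epsilon>, of t] by (simp add: abs_mult power_abs mult_ac)
      finally show ?thesis .
    qed (simp add: gamma_density_def mixture_weight_def)
    have "(1 + r) ^ N * \<bar>mixture_profile b \<epsilon> k r\<bar> \<le> (1 + r) ^ N * (\<integral>t. \<bar>?w t * ?c t ^ k * exp (r * ?c t)\<bar> \<partial>lborel)"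
      unfolding mixture_profile_def using r by (intro mult_left_mono integral_abs_bound) auto
    also have "\<dots> = (\<integral>t. (1 + r) ^ N * \<bar>?w t * ?c t ^ k * exp (r * ?c t)\<bar> \<partial>lborel)"
      by (rule integral_mult_right_zero[symmetric])
    also have "\<dots> \<le> integral\<^sup>L lborel ?D"
      by (intro integral_mono le D integrable_mult_right integrable_abs int)
    finally show ?thesis .
  qed
  then show ?thesis by blast
qed

lemma mixture_schwartz:
  assumes "b > 0" "\<epsilon> > 0"
  shows "(\<lambda>x. complex_of_real (mixture b \<epsilon> (x - a))) \<in> schwartz_space"
  using profile_span_schwartz[of "mixture_profile b \<epsilon>", OF mixture_profile_derivative[OF assms]
      mixture_profile_decay[OF assms] transpose_R_A, of a]
  unfolding mixture_profile_0 .

end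

section \<open>Square-integrable functions and orthonormal systems\<close>

text \<open>The analogue of \<open>L2_fun\<close> on an arbitrary measure space, so that the same lemmas serve the plane and
the probability space.\<close>

definition square_integrable :: "'a measure \<Rightarrow> ('a \<Rightarrow> real) \<Rightarrow> bool" where
  "square_integrable M f \<longleftrightarrow> f \<in> borel_measurable M \<and> integrable M (\<lambda>x. (f x)\<^sup>2)"

lemma square_integrable_measurable: "square_integrable M f \<Longrightarrow> f \<in> borel_measurable M"
  by (simp add: square_integrable_def)

lemma L2_fun_iff_square_integrable: "L2_fun f \<longleftrightarrow> square_integrable lborel f"
  by (simp add: L2_fun_def square_integrable_def)

lemma abs_mult_le_sum_squares: "\<bar>a * b\<bar> \<le> a\<^sup>2 + b\<^sup>2" for a b :: real
proof -
  have "2 * (\<bar>a\<bar> * \<bar>b\<bar>) \<le> a\<^sup>2 + b\<^sup>2"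
    using zero_le_power2[of "\<bar>a\<bar> - \<bar>b\<bar>"] by (simp add: power2_diff)
  moreover have "0 \<le> \<bar>a\<bar> * \<bar>b\<bar>" by simp
  ultimately show ?thesis unfolding abs_mult by linarith
qed

lemma integrable_mult_square_integrable:
  assumes f: "square_integrable M f" and g: "square_integrable M g"
  shows "integrable M (\<lambda>x. f x * g x)"
proof (rule Bochner_Integration.integrable_bound)
  show "integrable M (\<lambda>x. (f x)\<^sup>2 + (g x)\<^sup>2)"
    using f g by (simp add: square_integrable_def)
  show "AE x in M. norm (f x * g x) \<le> norm ((f x)\<^sup>2 + (g x)\<^sup>2)"
    using abs_mult_le_sum_squares by (intro AE_I2) simp
qed (use f g in \<open>auto dest!: square_integrable_measurable\<close>)

lemma square_integrable_cmult: "square_integrable M f \<Longrightarrow> square_integrable M (\<lambda>x. c * f x)"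
  by (auto simp: square_integrable_def power_mult_distrib)

lemma square_integrable_add:
  assumes f: "square_integrable M f" and g: "square_integrable M g"
  shows "square_integrable M (\<lambda>x. f x + g x)"
  using f g integrable_mult_square_integrable[OF f g]
  by (auto simp: square_integrable_def power2_sum mult.assoc)

lemma square_integrable_diff:
  assumes f: "square_integrable M f" and g: "square_integrable M g"
  shows "square_integrable M (\<lambda>x. f x - g x)"
  using square_integrable_add[OF f square_integrable_cmult[OF g, of "-1"]] by simp

lemma square_integrable_zero: "square_integrable M (\<lambda>x. 0)"
  by (simp add: square_integrable_def)

lemma square_integrable_sum:
  "(\<And>i. i \<in> I \<Longrightarrow> square_integrable M (f i)) \<Longrightarrow> square_integrable M (\<lambda>x. \<Sum>i\<in>I. f i x)"
  by (induction I rule: infinite_finite_induct) (simp_all add: square_integrable_zero square_integrable_add)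

text \<open>The integral of \<open>(t f + g)\<^sup>2\<close> is a quadratic polynomial in t without negative values.\<close>

lemma Cauchy_Schwarz_integral:
  assumes f: "square_integrable M f" and g: "square_integrable M g"
  shows "(\<integral>x. f x * g x \<partial>M)\<^sup>2 \<le> (\<integral>x. (f x)\<^sup>2 \<partial>M) * (\<integral>x. (g x)\<^sup>2 \<partial>M)"
proof -
  let ?a = "\<integral>x. (f x)\<^sup>2 \<partial>M" and ?b = "\<integral>x. f x * g x \<partial>M" and ?c = "\<integral>x. (g x)\<^sup>2 \<partial>M"
  note ints = f g integrable_mult_square_integrable[OF f g]
  have pos: "0 \<le> t\<^sup>2 * ?a + 2 * t * ?b + ?c" for t
  proof -
    have "0 \<le> (\<integral>x. (t * f x + g x)\<^sup>2 \<partial>M)" by simp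
    also have "(\<lambda>x. (t * f x + g x)\<^sup>2) = (\<lambda>x. t\<^sup>2 * (f x)\<^sup>2 + 2 * t * (f x * g x) + (g x)\<^sup>2)"
      by (simp add: fun_eq_iff power2_sum power_mult_distrib)
    also have "(\<integral>x. t\<^sup>2 * (f x)\<^sup>2 + 2 * t * (f x * g x) + (g x)\<^sup>2 \<partial>M) = t\<^sup>2 * ?a + 2 * t * ?b + ?c"
      using ints by (simp add: square_integrable_def)
    finally show ?thesis .
  qed
  show ?thesis
  proof (cases "?a = 0")
    case True
    have "?b = 0"
    proof (rule ccontr)
      assume "?b \<noteq> 0"
      then show False using pos[of "- (?c + 1) / (2 * ?b)"] True by (simp add: field_simps)
    qed
    then show ?thesis using True by simp
  next
    case False
    moreover have "?a \<ge> 0" by simp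
    ultimately have a: "?a > 0" by linarith
    have "0 \<le> (?b\<^sup>2 / ?a - 2 * (?b\<^sup>2 / ?a) + ?c) * ?a"
      using pos[of "- ?b / ?a"] a by (intro mult_nonneg_nonneg) (simp_all add: power2_eq_square)
    then show ?thesis using a by (simp add: algebra_simps)
  qed
qed

lemma integral_mult_tendsto_zero:
  assumes U: "\<And>n. square_integrable M (U n)" and V: "\<And>n. square_integrable M (V n)"
    and lim: "(\<lambda>n. (\<integral>x. (U n x)\<^sup>2 \<partial>M) * (\<integral>x. (V n x)\<^sup>2 \<partial>M)) \<longlonglongrightarrow> 0"
  shows "(\<lambda>n. \<integral>x. U n x * V n x \<partial>M) \<longlonglongrightarrow> 0"
proof -
  have "(\<lambda>n. (\<integral>x. U n x * V n x \<partial>M)\<^sup>2) \<longlonglongrightarrow> 0"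
    by (rule tendsto_sandwich[OF _ _ tendsto_const lim])
      (use Cauchy_Schwarz_integral[OF U V] in auto)
  then show ?thesis by simp
qed

text \<open>Continuity of the inner product: the product of the approximations differs from the product of the
limits by three terms that contain an error factor, and these vanish by the Cauchy-Schwarz
inequality.\<close>

lemma mean_square_limit_mult:
  assumes F: "square_integrable M F" and G: "square_integrable M G"
    and X: "\<And>n. square_integrable M (X n)" and Z: "\<And>n. square_integrable M (Z n)"
    and FX: "(\<lambda>n. \<integral>x. (F x - X n x)\<^sup>2 \<partial>M) \<longlonglongrightarrow> 0" and GZ: "(\<lambda>n. \<integral>x. (G x - Z n x)\<^sup>2 \<partial>M) \<longlonglongrightarrow> 0"
  shows "(\<lambda>n. \<integral>x. X n x * Z n x \<partial>M) \<longlonglongrightarrow> (\<integral>x. F x * G x \<partial>M)"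
proof -
  let ?u = "\<lambda>n x. F x - X n x" and ?v = "\<lambda>n x. G x - Z n x"
  have u: "square_integrable M (?u n)" and v: "square_integrable M (?v n)" for n
    using F G X Z by (auto intro: square_integrable_diff)
  have l1: "(\<lambda>n. \<integral>x. F x * ?v n x \<partial>M) \<longlonglongrightarrow> 0"
    by (rule integral_mult_tendsto_zero[OF F v]) (use tendsto_mult[OF tendsto_const GZ] in simp)
  have l2: "(\<lambda>n. \<integral>x. ?u n x * G x \<partial>M) \<longlonglongrightarrow> 0"
    by (rule integral_mult_tendsto_zero[OF u G]) (use tendsto_mult[OF FX tendsto_const] in simp)
  have l3: "(\<lambda>n. \<integral>x. ?u n x * ?v n x \<partial>M) \<longlonglongrightarrow> 0"
    by (rule integral_mult_tendsto_zero[OF u v]) (use tendsto_mult[OF FX GZ] in simp)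
  have eq: "(\<integral>x. X n x * Z n x \<partial>M) = (\<integral>x. F x * G x \<partial>M) - (\<integral>x. F x * ?v n x \<partial>M) - (\<integral>x. ?u n x * G x \<partial>M) + (\<integral>x. ?u n x * ?v n x \<partial>M)" for n
  proof -
    have "(\<integral>x. X n x * Z n x \<partial>M) = (\<integral>x. F x * G x - F x * ?v n x - ?u n x * G x + ?u n x * ?v n x \<partial>M)"
      by (simp add: algebra_simps)
    also have "\<dots> = (\<integral>x. F x * G x \<partial>M) - (\<integral>x. F x * ?v n x \<partial>M) - (\<integral>x. ?u n x * G x \<partial>M) + (\<integral>x. ?u n x * ?v n x \<partial>M)"
      using integrable_mult_square_integrable[OF F G] integrable_mult_square_integrable[OF F v]
        integrable_mult_square_integrable[OF u G] integrable_mult_square_integrable[OF u v]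
      by simp
    finally show ?thesis .
  qed
  have "(\<lambda>n. (\<integral>x. F x * G x \<partial>M) - (\<integral>x. F x * ?v n x \<partial>M) - (\<integral>x. ?u n x * G x \<partial>M) + (\<integral>x. ?u n x * ?v n x \<partial>M)) \<longlonglongrightarrow> (\<integral>x. F x * G x \<partial>M) - 0 - 0 + 0"
    by (intro tendsto_add tendsto_diff tendsto_const l1 l2 l3)
  then show ?thesis unfolding eq by simp
qed

definition orthonormal_system :: "'a measure \<Rightarrow> (nat \<Rightarrow> 'a \<Rightarrow> real) \<Rightarrow> bool" where
  "orthonormal_system M e \<longleftrightarrow> (\<forall>j. square_integrable M (e j)) \<and>
    (\<forall>i j. (\<integral>x. e i x * e j x \<partial>M) = (if i = j then 1 else 0))"

lemma square_integrable_orthonormal_sum: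
  assumes "orthonormal_system M e" shows "square_integrable M (\<lambda>x. \<Sum>j\<in>J. a j * e j x)"
  using assms by (intro square_integrable_sum square_integrable_cmult) (simp add: orthonormal_system_def)

lemma orthonormal_sum_mult:
  assumes e: "orthonormal_system M e" and J: "finite J"
  shows "(\<integral>x. (\<Sum>j\<in>J. a j * e j x) * (\<Sum>j\<in>J. b j * e j x) \<partial>M) = (\<Sum>j\<in>J. a j * b j)"
proof -
  have int: "integrable M (\<lambda>x. e i x * e j x)" for i j
    using e by (intro integrable_mult_square_integrable) (auto simp: orthonormal_system_def)
  have "(\<integral>x. (\<Sum>j\<in>J. a j * e j x) * (\<Sum>j\<in>J. b j * e j x) \<partial>M) = (\<integral>x. (\<Sum>i\<in>J. \<Sum>j\<in>J. (a i * b j) * (e i x * e j x)) \<partial>M)"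
    by (simp add: sum_product mult_ac)
  also have "\<dots> = (\<Sum>i\<in>J. \<Sum>j\<in>J. (a i * b j) * (if i = j then 1 else 0))"
    using e int by (simp add: orthonormal_system_def)
  also have "\<dots> = (\<Sum>j\<in>J. a j * b j)"
    using J by (simp add: if_distrib[of "\<lambda>z. _ * z"] cong: if_cong)
  finally show ?thesis .
qed

lemma orthonormal_sum_square:
  assumes "orthonormal_system M e" and "finite J"
  shows "(\<integral>x. (\<Sum>j\<in>J. a j * e j x)\<^sup>2 \<partial>M) = (\<Sum>j\<in>J. (a j)\<^sup>2)"
  using orthonormal_sum_mult[OF assms, of a a] by (simp add: power2_eq_square)

section \<open>The Green's function\<close>

lemma matrix_norm_bound:
  fixes B :: "real^2^2"
  obtains L where "L > 0" "\<And>x. norm (B *v x) \<le> L * norm x"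
  using bounded_linear.pos_bounded[OF matrix_vector_mul_bounded_linear[of B]] by (metis mult.commute)

lemma L2_fun_borel: "L2_fun f \<Longrightarrow> f \<in> borel_measurable borel"
  by (simp add: L2_fun_def)

lemma integrable_L2_mult: "L2_fun f \<Longrightarrow> L2_fun g \<Longrightarrow> integrable lborel (\<lambda>v. f v * g v)"
  by (simp add: L2_fun_iff_square_integrable integrable_mult_square_integrable)

lemma L2_fun_diff: "L2_fun f \<Longrightarrow> L2_fun g \<Longrightarrow> L2_fun (\<lambda>v. f v - g v)"
  by (simp add: L2_fun_iff_square_integrable square_integrable_diff)

text \<open>The positive and the negative part of D are densities of two measures that agree on boxes, hence
everywhere.\<close>

lemma L2_zero_if_box_integrals_zero:
  assumes D: "L2_fun D"
    and box_zero: "\<And>l u. (\<integral>v. D v * indicator (box l u) v \<partial>lborel) = 0"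
  shows "AE v in lborel. D v = 0"
proof -
  have [measurable]: "D \<in> borel_measurable borel" using D by (rule L2_fun_borel)
  let ?P = "\<lambda>v. ennreal (D v)" and ?N = "\<lambda>v. ennreal (- D v)"
  have fin: "integrable lborel (\<lambda>v. D v * indicator (box l u) v)" for l u :: "real^2"
  proof -
    have "L2_fun (indicator (box l u) :: real^2 \<Rightarrow> real)"
    proof -
      have "(indicator (box l u) v :: real)\<^sup>2 = indicator (box l u) v" for v
        by (simp add: indicator_def)
      then show ?thesis
        using emeasure_lborel_box_finite[of l u] unfolding L2_fun_def by (simp add: integrable_real_indicator)
    qed
    from integrable_L2_mult[OF D this] show ?thesis .
  qed
  have box_eq: "emeasure (density lborel ?P) (box l u) = emeasure (density lborel ?N) (box l u)
     \<and> emeasure (density lborel ?P) (box l u) \<noteq> \<infinity>" for l u :: "real^2"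
  proof -
    let ?f = "\<lambda>v. D v * indicator (box l u) v"
    have P: "emeasure (density lborel ?P) (box l u) = (\<integral>\<^sup>+v. ennreal (?f v) \<partial>lborel)"
      by (subst emeasure_density) (auto intro!: nn_integral_cong simp: indicator_def)
    have N: "emeasure (density lborel ?N) (box l u) = (\<integral>\<^sup>+v. ennreal (- ?f v) \<partial>lborel)"
      by (subst emeasure_density) (auto intro!: nn_integral_cong simp: indicator_def)
    have fP: "(\<integral>\<^sup>+v. ennreal (?f v) \<partial>lborel) \<noteq> \<infinity>" and fN: "(\<integral>\<^sup>+v. ennreal (- ?f v) \<partial>lborel) \<noteq> \<infinity>"
      using fin[of l u] by (auto simp: real_integrable_def)
    have eq: "enn2real (\<integral>\<^sup>+v. ennreal (?f v) \<partial>lborel) = enn2real (\<integral>\<^sup>+v. ennreal (- ?f v) \<partial>lborel)"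
      using real_lebesgue_integral_def[OF fin[of l u]] box_zero[of l u] by simp
    have real: "ennreal (enn2real z) = z" if "z \<noteq> \<infinity>" for z
      using that by (simp add: less_top)
    have "(\<integral>\<^sup>+v. ennreal (?f v) \<partial>lborel) = (\<integral>\<^sup>+v. ennreal (- ?f v) \<partial>lborel)"
      using arg_cong[OF eq, of ennreal] unfolding real[OF fP] real[OF fN] .
    then show ?thesis using P N fP by simp
  qed
  have "density lborel ?P = density lborel ?N"
  proof (rule measure_eqI_generator_eq)
    let ?E = "range (\<lambda>(a, b). box a b::(real^2) set)"
    show "Int_stable ?E" by (auto simp: Int_stable_def box_Int_box)
    show "?E \<subseteq> Pow UNIV" "sets (density lborel ?P) = sigma_sets UNIV ?E" "sets (density lborel ?N) = sigma_sets UNIV ?E"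
      by (simp_all add: borel_eq_box)
    let ?B = "\<lambda>n::nat. box (- (real n *\<^sub>R One)) (real n *\<^sub>R One) :: (real^2) set"
    show "range ?B \<subseteq> ?E" "(\<Union>i. ?B i) = UNIV"
      unfolding UN_box_eq_UNIV by auto
    show "emeasure (density lborel ?P) (?B i) \<noteq> \<infinity>" for i using box_eq by blast
    show "emeasure (density lborel ?P) X = emeasure (density lborel ?N) X" if "X \<in> ?E" for X
      using that box_eq by auto
  qed
  then have "AE v in lborel. ?P v = ?N v"
    by (intro sigma_finite_measure.density_unique[OF sigma_finite_lborel]) auto
  then show ?thesis
  proof eventually_elim
    case (elim v)
    then show ?case
      by (cases "D v \<ge> 0") (auto simp: ennreal_neg ennreal_eq_0_iff)
  qed
qed

context anisotropy
begin

lemma inverse_fourier_mixture: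
  assumes "b > 0" "\<epsilon> \<ge> 0"
  shows "inverse_fourier (\<lambda>x. complex_of_real (mixture b \<epsilon> (x - a))) \<omega> =
    of_real (1 / (2 * pi)\<^sup>2) * (cis (\<omega> \<bullet> a) * of_real (exp (- \<epsilon> * (norm (R *v \<omega>))\<^sup>2) * (1 + (norm (R *v \<omega>))\<^sup>2) powr (- b)))"
proof -
  let ?m = "\<lambda>x. complex_of_real (mixture b \<epsilon> x)"
  have neg: "R *v (- \<omega>) = - (R *v \<omega>)"
    using matrix_vector_mult_diff_distrib[of R 0 \<omega>] by simp
  have "(\<integral>x. cis (\<omega> \<bullet> x) * ?m (x - a) \<partial>lborel) = (\<integral>y. cis (\<omega> \<bullet> (a + 1 *\<^sub>R y)) * ?m ((a + 1 *\<^sub>R y) - a) \<partial>lborel)"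
    by (subst lborel_integral_affine[where c=1 and t=a]) simp_all
  also have "\<dots> = (\<integral>y. cis (\<omega> \<bullet> a) * (cis (- ((- \<omega>) \<bullet> y)) * ?m y) \<partial>lborel)"
    by (intro Bochner_Integration.integral_cong refl) (simp add: cis_mult inner_add_right mult.assoc[symmetric])
  also have "\<dots> = cis (\<omega> \<bullet> a) * of_real (exp (- \<epsilon> * (norm (R *v \<omega>))\<^sup>2) * (1 + (norm (R *v \<omega>))\<^sup>2) powr (- b))"
    using fourier_mixture[OF assms, of "- \<omega>"] by (simp add: has_bochner_integral_iff neg)
  finally show ?thesis by (simp only: inverse_fourier_altdef)
qed

text \<open>The symbol cancels against the gamma mean in the transform of the mixture; only the factor
\<open>exp (- \<epsilon> q)\<close> remains, the transform of \<open>heat \<epsilon>\<close>.\<close>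

lemma fourier_multiplied_mixture:
  assumes "b > 0" "\<epsilon> > 0"
  shows "fourier (\<lambda>\<omega>. of_real ((1 + (norm (R *v \<omega>))\<^sup>2) powr b) *
      inverse_fourier (\<lambda>x. complex_of_real (mixture b \<epsilon> (x - a))) \<omega>) x
    = complex_of_real (heat \<epsilon> (x - a))"
proof -
  have p: "1 + (norm (R *v \<omega>))\<^sup>2 > 0" for \<omega> by (simp add: add_pos_nonneg)
  have "cis (- (x \<bullet> \<omega>)) * (of_real ((1 + (norm (R *v \<omega>))\<^sup>2) powr b) *
      inverse_fourier (\<lambda>x. complex_of_real (mixture b \<epsilon> (x - a))) \<omega>)
    = of_real (1 / (2 * pi)\<^sup>2) * (cis (- (\<omega> \<bullet> (x - a))) * of_real (exp (- \<epsilon> * (norm (R *v \<omega>))\<^sup>2)))" for \<omega>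
  proof -
    have "(1 + (norm (R *v \<omega>))\<^sup>2) powr b * (1 + (norm (R *v \<omega>))\<^sup>2) powr (- b) = 1"
      using p[of \<omega>] by (simp add: powr_add[symmetric])
    then have one: "complex_of_real ((1 + (norm (R *v \<omega>))\<^sup>2) powr b) * complex_of_real ((1 + (norm (R *v \<omega>))\<^sup>2) powr (- b)) = 1"
      by (metis of_real_1 of_real_mult)
    have c: "cis (- (\<omega> \<bullet> (x - a))) = cis (- (x \<bullet> \<omega>)) * cis (\<omega> \<bullet> a)"
      by (simp add: cis_mult inner_diff_right inner_commute)
    have *: "z * (s * (k * (u * (e * r)))) = (s * r) * (k * ((z * u) * e))" for z s k u e r :: complex
      by (simp only: mult_ac)
    show ?thesis
      unfolding inverse_fourier_mixture[OF assms(1) less_imp_le[OF assms(2)]] of_real_mult[of "exp _"] * one c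
      by simp
  qed
  then show ?thesis
    using fourier_gaussian[OF assms(2), of "x - a"]
    unfolding fourier_def by (simp add: has_bochner_integral_iff)
qed

text \<open>The equation tested against a mixture. The right-hand side does not involve g.\<close>

lemma greens_function_heat:
  assumes g: "greens_function R (2 * b) g" and b: "b > 0" and \<epsilon>: "\<epsilon> > 0"
  shows "(\<integral>v. g v * heat \<epsilon> (v - a) \<partial>lborel) = mixture b \<epsilon> (0 - a)"
proof -
  let ?f = "\<lambda>x. complex_of_real (mixture b \<epsilon> (x - a))"
  have "spde_operator R (2 * b) (distribution_of g) ?f = dirac ?f"
    using g mixture_schwartz[OF b \<epsilon>, of a] unfolding greens_function_def greens_distribution_def by blast
  moreover have "fourier (\<lambda>\<omega>. of_real ((1 + (norm (R *v \<omega>))\<^sup>2) powr b) * inverse_fourier ?f \<omega>) = (\<lambda>x. complex_of_real (heat \<epsilon> (x - a)))"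
    by (rule ext, rule fourier_multiplied_mixture[OF b \<epsilon>])
  ultimately have "distribution_of g (\<lambda>x. complex_of_real (heat \<epsilon> (x - a))) = ?f 0"
    unfolding spde_operator_def fourier_multiplier_def inverse_fourier_dist_def mult_dist_def fourier_dist_def dirac_def
    by simp
  then have "complex_of_real (\<integral>v. g v * heat \<epsilon> (v - a) \<partial>lborel) = ?f 0"
    unfolding distribution_of_def by (simp only: of_real_mult[symmetric] integral_complex_of_real)
  then show ?thesis by (simp only: of_real_eq_iff)
qed

lemma heat_le_sup: "t > 0 \<Longrightarrow> heat t x \<le> 1 / (4 * pi * t * \<bar>det R\<bar>)"
  using det_R by (simp add: heat_def divide_right_mono)

lemma L2_fun_heat:
  assumes t: "t > 0" shows "L2_fun (\<lambda>v. heat t (v - a))"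
proof -
  have "has_bochner_integral lborel (\<lambda>v. heat t (a - v) * heat t (a - v)) (heat (t + t) (a - a))"
    by (rule heat_convolution[OF t t])
  then show ?thesis
    unfolding L2_fun_def by (simp add: has_bochner_integral_iff heat_minus[of t a] power2_eq_square)
qed

text \<open>The indicator function of a box, smoothed by \<open>heat t\<close>.\<close>

definition box_smooth :: "real^2 \<Rightarrow> real^2 \<Rightarrow> real \<Rightarrow> real^2 \<Rightarrow> real" where
  "box_smooth l u t v = (\<integral>a. heat t (a - v) * indicator (box l u) a \<partial>lborel)"

lemma box_smooth_measurable [measurable]: "box_smooth l u t \<in> borel_measurable borel"
  unfolding box_smooth_def by measurable

lemma integrable_box: "integrable lborel (indicator (box l u) :: real^2 \<Rightarrow> real)"
  using emeasure_lborel_box_finite[of l u] by (simp add: integrable_real_indicator)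

lemma integrable_heat_box:
  assumes t: "t > 0" shows "integrable lborel (\<lambda>a. heat t (a - v) * indicator (box l u) a)"
  by (rule Bochner_Integration.integrable_bound[OF integrable_mult_right[OF integrable_box[of l u], of "1 / (4 * pi * t * \<bar>det R\<bar>)"]])
     (use heat_le_sup[OF t] heat_pos[OF t] t in \<open>auto simp: indicator_def less_imp_le abs_of_pos\<close>)

text \<open>A square-integrable bound that is uniform in t. For a in the box, \<open>(1 + norm v)\<^sup>2\<close> is at most
\<open>2 (1 + norm a)\<^sup>2 + 2 (norm (a - v))\<^sup>2\<close>. The first term is bounded on the box and heat kernels have mass
one; the second, multiplied by \<open>heat t (a - v)\<close>, is bounded by \<open>heat_le\<close> and the box has finite area.\<close>

lemma box_smooth_bound:
  obtains C where "\<And>t v. t > 0 \<Longrightarrow> 0 \<le> box_smooth l u t v \<and> box_smooth l u t v \<le> C / (1 + norm v)\<^sup>2"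
proof -
  let ?S = "box l u"
  obtain L where L: "L > 0" "\<And>x. norm (transpose R *v x) \<le> L * norm x"
    using matrix_norm_bound by blast
  obtain r where r: "r > 0" "\<And>a. a \<in> ?S \<Longrightarrow> norm a \<le> r"
    using bounded_box[of l u] unfolding bounded_pos by blast
  define m where "m = measure lborel ?S"
  define C where "C = 2 * (1 + r)\<^sup>2 + 2 * (L\<^sup>2 / (pi * \<bar>det R\<bar>)) * m"
  have "0 \<le> box_smooth l u t v \<and> box_smooth l u t v \<le> C / (1 + norm v)\<^sup>2" if t: "t > 0" for t v
  proof
    show "0 \<le> box_smooth l u t v"
      unfolding box_smooth_def
      by (intro integral_nonneg_AE AE_I2) (use heat_pos[OF t] in \<open>auto simp: indicator_def less_imp_le\<close>)
    show "box_smooth l u t v \<le> C / (1 + norm v)\<^sup>2"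
    proof (subst pos_le_divide_eq)
      let ?h = "\<lambda>a. heat t (a - v)"
      have point: "(1 + norm v)\<^sup>2 * (?h a * indicator ?S a) \<le> 2 * (1 + r)\<^sup>2 * ?h a + 2 * (L\<^sup>2 / (pi * \<bar>det R\<bar>)) * indicator ?S a"
        if "a \<noteq> v" for a
      proof (cases "a \<in> ?S")
        case True
        have h: "?h a > 0" using heat_pos[OF t] .
        have "norm v \<le> norm a + norm (a - v)" by (metis norm_minus_commute norm_triangle_sub)
        then have "1 + norm v \<le> (1 + r) + norm (a - v)" using r(2)[OF True] by simp
        then have "(1 + norm v)\<^sup>2 \<le> ((1 + r) + norm (a - v))\<^sup>2" by (intro power_mono) auto
        also have "\<dots> \<le> 2 * (1 + r)\<^sup>2 + 2 * (norm (a - v))\<^sup>2"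
        proof -
          have "(p + q)\<^sup>2 \<le> 2 * p\<^sup>2 + 2 * q\<^sup>2" for p q :: real
            using zero_le_power2[of "p - q"] unfolding power2_sum power2_diff by linarith
          then show ?thesis .
        qed
        finally have 1: "(1 + norm v)\<^sup>2 * ?h a \<le> (2 * (1 + r)\<^sup>2 + 2 * (norm (a - v))\<^sup>2) * ?h a"
          using h by (intro mult_right_mono) auto
        let ?A = "norm (A *v (a - v))"
        have A0: "?A > 0" using A_nonzero[of "a - v"] that by simp
        have "a - v = transpose R *v (A *v (a - v))"
          by (metis matrix_vector_mul_assoc matrix_vector_mul_lid transpose_R_A)
        then have "norm (a - v) \<le> L * ?A" using L(2)[of "A *v (a - v)"] by simp
        then have "(norm (a - v))\<^sup>2 \<le> (L * ?A)\<^sup>2" by (intro power_mono) auto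
        then have "(norm (a - v))\<^sup>2 * ?h a \<le> (L * ?A)\<^sup>2 * (1 / (pi * \<bar>det R\<bar> * ?A\<^sup>2))"
          using heat_le[of "a - v", OF _ t] that h by (intro mult_mono) auto
        also have "\<dots> = L\<^sup>2 / (pi * \<bar>det R\<bar>)" using A0 by (simp add: power_mult_distrib)
        finally show ?thesis using 1 True by (simp add: distrib_right mult.assoc)
      qed (use r heat_pos[OF t] in \<open>auto simp: less_imp_le\<close>)
      have hint: "has_bochner_integral lborel ?h 1"
      proof -
        have "integrable lborel (\<lambda>x. heat t (- v + 1 *\<^sub>R x))"
          by (rule lborel_integrable_affine) (use heat_integral[OF t] in \<open>auto simp: has_bochner_integral_iff\<close>)
        moreover have "(\<integral>x. heat t x \<partial>lborel) = 1\<^sup>2 *\<^sub>R (\<integral>x. heat t (- v + 1 *\<^sub>R x) \<partial>lborel)"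
          by (rule lborel_integral_affine) simp_all
        ultimately show ?thesis
          using heat_integral[OF t] by (simp add: has_bochner_integral_iff)
      qed
      have "box_smooth l u t v * (1 + norm v)\<^sup>2 = (\<integral>a. (1 + norm v)\<^sup>2 * (?h a * indicator ?S a) \<partial>lborel)"
        unfolding box_smooth_def by (simp add: mult.commute)
      also have "\<dots> \<le> (\<integral>a. 2 * (1 + r)\<^sup>2 * ?h a + 2 * (L\<^sup>2 / (pi * \<bar>det R\<bar>)) * indicator ?S a \<partial>lborel)"
      proof (rule integral_mono_AE)
        show "integrable lborel (\<lambda>a. (1 + norm v)\<^sup>2 * (?h a * indicator ?S a))"
          by (intro integrable_mult_right integrable_heat_box t)
        show "integrable lborel (\<lambda>a. 2 * (1 + r)\<^sup>2 * ?h a + 2 * (L\<^sup>2 / (pi * \<bar>det R\<bar>)) * indicator ?S a)"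
          using hint by (intro Bochner_Integration.integrable_add integrable_mult_right integrable_box) (simp add: has_bochner_integral_iff)
        show "AE a in lborel. (1 + norm v)\<^sup>2 * (?h a * indicator ?S a) \<le> 2 * (1 + r)\<^sup>2 * ?h a + 2 * (L\<^sup>2 / (pi * \<bar>det R\<bar>)) * indicator ?S a"
          using AE_lborel_singleton[of v] by eventually_elim (rule point)
      qed
      also have "\<dots> = C"
      proof -
        have "(\<integral>a. 2 * (1 + r)\<^sup>2 * ?h a + 2 * (L\<^sup>2 / (pi * \<bar>det R\<bar>)) * indicator ?S a \<partial>lborel)
            = (\<integral>a. 2 * (1 + r)\<^sup>2 * ?h a \<partial>lborel) + (\<integral>a. 2 * (L\<^sup>2 / (pi * \<bar>det R\<bar>)) * indicator ?S a \<partial>lborel)"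
          using hint by (intro Bochner_Integration.integral_add integrable_mult_right integrable_box) (simp add: has_bochner_integral_iff)
        also have "\<dots> = 2 * (1 + r)\<^sup>2 * 1 + 2 * (L\<^sup>2 / (pi * \<bar>det R\<bar>)) * m"
          using hint unfolding integral_mult_right_zero m_def by (simp add: has_bochner_integral_iff)
        finally show ?thesis by (simp add: C_def)
      qed
      finally show "box_smooth l u t v * (1 + norm v)\<^sup>2 \<le> C" .
      show "0 < (1 + norm v)\<^sup>2" by (intro zero_less_power add_pos_nonneg) auto
    qed
  qed
  then show ?thesis by (rule that)
qed

text \<open>Integrate the hypothesis over a in the box and exchange the integrals.\<close>

lemma box_smooth_mean_zero:
  assumes D: "L2_fun D" and t: "t > 0" and zero: "\<And>a. (\<integral>v. D v * heat t (v - a) \<partial>lborel) = 0"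
  shows "(\<integral>v. D v * box_smooth l u t v \<partial>lborel) = 0"
proof -
  have [measurable]: "D \<in> borel_measurable borel" using D by (rule L2_fun_borel)
  let ?S = "box l u"
  let ?F = "\<lambda>a v. indicator ?S a * (D v * heat t (v - a))"
  have int: "integrable (lborel \<Otimes>\<^sub>M lborel) (\<lambda>(a, v). ?F a v)"
  proof (rule lborel_pair.Fubini_integrable)
    define K where "K = (\<integral>v. (D v)\<^sup>2 \<partial>lborel) + heat (t + t) 0"
    have b: "(\<integral>v. \<bar>D v * heat t (v - a)\<bar> \<partial>lborel) \<le> K" for a
    proof -
      have i2: "integrable lborel (\<lambda>v. (heat t (v - a))\<^sup>2)" "integrable lborel (\<lambda>v. (D v)\<^sup>2)"
        using L2_fun_heat[OF t] D by (auto simp: L2_fun_def)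
      have "(\<integral>v. (heat t (v - a))\<^sup>2 \<partial>lborel) = heat (t + t) 0"
        using heat_convolution[OF t t, of a a]
        by (simp add: has_bochner_integral_iff heat_minus[of _ a] power2_eq_square)
      moreover have "(\<integral>v. \<bar>D v * heat t (v - a)\<bar> \<partial>lborel) \<le> (\<integral>v. (D v)\<^sup>2 + (heat t (v - a))\<^sup>2 \<partial>lborel)"
        by (intro integral_mono integrable_abs integrable_L2_mult D L2_fun_heat t
            Bochner_Integration.integrable_add i2 abs_mult_le_sum_squares)
      ultimately show ?thesis unfolding K_def using i2 by (simp)
    qed
    show "integrable lborel (\<lambda>a. \<integral>v. norm (case (a, v) of (a, v) \<Rightarrow> ?F a v) \<partial>lborel)"
    proof (rule Bochner_Integration.integrable_bound[OF integrable_mult_right[OF integrable_box, of K]])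
      show "AE a in lborel. norm (\<integral>v. norm (case (a, v) of (a, v) \<Rightarrow> ?F a v) \<partial>lborel) \<le> norm (K * indicator ?S a)"
      proof (rule AE_I2)
        fix a :: "real^2"
        show "norm (\<integral>v. norm (case (a, v) of (a, v) \<Rightarrow> ?F a v) \<partial>lborel) \<le> norm (K * indicator ?S a)"
          using b[of a] by (auto simp: indicator_def intro: order_trans[OF _ abs_ge_self])
      qed
    qed measurable
    show "AE a in lborel. integrable lborel (\<lambda>v. case (a, v) of (a, v) \<Rightarrow> ?F a v)"
      by (intro AE_I2) (simp add: integrable_L2_mult[OF D L2_fun_heat[OF t]])
  qed measurable
  have "(\<integral>v. D v * box_smooth l u t v \<partial>lborel) = (\<integral>v. \<integral>a. ?F a v \<partial>lborel \<partial>lborel)"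
    by (simp add: box_smooth_def heat_minus[of _ _ "_ :: real^2"] mult_ac flip: integral_mult_right_zero)
  also have "\<dots> = (\<integral>a. \<integral>v. ?F a v \<partial>lborel \<partial>lborel)"
    by (rule lborel_pair.Fubini_integral[OF int])
  also have "\<dots> = 0" using zero by simp
  finally show ?thesis .
qed

text \<open>As t tends to 0, the smoothed indicator of a box tends to the indicator off the boundary of the box,
which is a null set.\<close>

lemma L2_zero_if_heat_means_zero:
  assumes D: "L2_fun D"
    and zero: "\<And>a \<epsilon>. \<epsilon> > 0 \<Longrightarrow> (\<integral>v. D v * heat \<epsilon> (v - a) \<partial>lborel) = 0"
  shows "AE v in lborel. D v = 0"
proof (rule L2_zero_if_box_integrals_zero[OF D])
  fix l u :: "real^2"
  have [measurable]: "D \<in> borel_measurable borel" using D by (rule L2_fun_borel)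
  let ?t = "\<lambda>n. 1 / real (Suc n)" and ?S = "box l u"
  let ?k = "\<lambda>n. box_smooth l u (?t n)"
  have mean: "(\<integral>v. D v * ?k n v \<partial>lborel) = 0" for n
    by (rule box_smooth_mean_zero[OF D _ zero]) simp_all
  obtain C where "\<And>t v. t > 0 \<Longrightarrow> 0 \<le> box_smooth l u t v \<and> box_smooth l u t v \<le> C / (1 + norm v)\<^sup>2"
    using box_smooth_bound by blast
  then have k: "0 \<le> ?k n v" "?k n v \<le> C / (1 + norm v)\<^sup>2" for n v by simp_all
  have lim: "(\<lambda>n. \<integral>v. D v * ?k n v \<partial>lborel) \<longlonglongrightarrow> (\<integral>v. D v * indicator ?S v \<partial>lborel)"
  proof (rule integral_dominated_convergence[where w="\<lambda>v. (D v)\<^sup>2 + (C / (1 + norm v)\<^sup>2)\<^sup>2"])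
    have "(C / (1 + norm v)\<^sup>2)\<^sup>2 = C\<^sup>2 * (1 / (1 + norm v) ^ 4)" for v :: "real^2"
      by (simp add: power_divide power_mult[symmetric])
    then have "integrable lborel (\<lambda>v::real^2. (C / (1 + norm v)\<^sup>2)\<^sup>2)"
      using integrable_mult_right[OF integrable_decay_weight, of "C\<^sup>2"] by presburger
    then show "integrable lborel (\<lambda>v. (D v)\<^sup>2 + (C / (1 + norm v)\<^sup>2)\<^sup>2)"
      using D by (intro Bochner_Integration.integrable_add) (auto simp: L2_fun_def)
    show "AE v in lborel. norm (D v * ?k n v) \<le> (D v)\<^sup>2 + (C / (1 + norm v)\<^sup>2)\<^sup>2" for n
    proof (rule AE_I2)
      fix v :: "real^2"
      let ?e = "C / (1 + norm v)\<^sup>2"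
      have "\<bar>D v * ?k n v\<bar> \<le> \<bar>D v * ?e\<bar>"
        unfolding abs_mult using k[where n=n and v=v] by (intro mult_left_mono) linarith+
      also have "\<dots> \<le> (D v)\<^sup>2 + ?e\<^sup>2" by (rule abs_mult_le_sum_squares)
      finally show "norm (D v * ?k n v) \<le> (D v)\<^sup>2 + ?e\<^sup>2" unfolding real_norm_def .
    qed
    have "frontier ?S \<subseteq> cbox l u - box l u"
    proof -
      have "frontier ?S = closure ?S - ?S" by (simp add: frontier_def interior_open open_box)
      moreover have "closure ?S \<subseteq> cbox l u" by (intro closure_minimal box_subset_cbox closed_cbox)
      ultimately show ?thesis by blast
    qed
    moreover have "AE v in lborel. v \<notin> cbox l u - box l u"
      by (rule AE_not_in[OF null_sets_cbox_Diff_box])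
    ultimately have "AE v in lborel. v \<notin> frontier ?S"
      by (auto elim!: eventually_mono)
    then show "AE v in lborel. (\<lambda>n. D v * ?k n v) \<longlonglongrightarrow> D v * indicator ?S v"
    proof eventually_elim
      case (elim v)
      have "isCont (indicator ?S :: real^2 \<Rightarrow> real) v"
        using elim isCont_indicator[of v ?S] by blast
      moreover have "norm (indicator ?S x :: real) \<le> 1" for x by (simp add: indicator_def)
      ultimately have "(\<lambda>n. \<integral>a. heat (?t n) (a - v) *\<^sub>R (indicator ?S a :: real) \<partial>lborel) \<longlonglongrightarrow> indicator ?S v"
        by (intro heat_approximate_identity[where B=1]) measurable
      then show ?case
        by (intro tendsto_mult tendsto_const) (simp add: box_smooth_def)
    qed
  qed measurable
  show "(\<integral>v. D v * indicator ?S v \<partial>lborel) = 0"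
    by (rule LIMSEQ_unique[OF lim[unfolded mean] tendsto_const])
qed

lemma schwartz_norm_0: "schwartz_norm 0 f = (SUP x. norm (f x))"
proof -
  have "{is :: 2 list. length is \<le> 0} = {[]}" by auto
  then show ?thesis by (simp add: schwartz_norm_def)
qed

lemma norm_le_schwartz_norm:
  assumes "f \<in> schwartz_space" shows "norm (f x) \<le> schwartz_norm 0 f"
proof -
  obtain C where "\<And>x. norm (f x) \<le> C" using schwartz_decay[OF assms, of 0] by auto
  then have "bdd_above (range (\<lambda>x. norm (f x)))" by (intro bdd_aboveI[of _ C]) auto
  then show ?thesis unfolding schwartz_norm_0 by (rule cSUP_upper[OF UNIV_I])
qed

lemma integrable_kernel: "b > 0 \<Longrightarrow> integrable lborel (kernel b)"
  using fourier_kernel[of b 0] by (simp add: has_bochner_integral_iff complex_of_real_integrable_eq)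

text \<open>The kernel is integrable, so the supremum norm alone bounds its action on test functions.\<close>

lemma tempered_kernel:
  assumes b: "b > 0" shows "tempered_distribution (distribution_of (kernel b))"
  unfolding tempered_distribution_def
proof (intro conjI ballI allI)
  have int: "integrable lborel (\<lambda>v. complex_of_real (kernel b v) * f v)" if f: "f \<in> schwartz_space" for f
  proof (rule Bochner_Integration.integrable_bound)
    show "integrable lborel (\<lambda>v. kernel b v * schwartz_norm 0 f)"
      by (intro integrable_mult_left integrable_kernel b)
    have [measurable]: "f \<in> borel_measurable borel" by (rule schwartz_measurable[OF f])
    show "(\<lambda>v. complex_of_real (kernel b v) * f v) \<in> borel_measurable lborel" by measurable
    show "AE v in lborel. norm (complex_of_real (kernel b v) * f v) \<le> norm (kernel b v * schwartz_norm 0 f)"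
      using norm_le_schwartz_norm[OF f] kernel_nonneg[OF b]
      by (intro AE_I2) (auto simp: norm_mult abs_mult intro!: mult_left_mono intro: order_trans[OF _ abs_ge_self])
  qed
  show "distribution_of (kernel b) (\<lambda>x. c * f x + d * h x) = c * distribution_of (kernel b) f + d * distribution_of (kernel b) h"
    if "f \<in> schwartz_space" "h \<in> schwartz_space" for f h c d
  proof -
    have "distribution_of (kernel b) (\<lambda>x. c * f x + d * h x) =
      (\<integral>v. c * (complex_of_real (kernel b v) * f v) + d * (complex_of_real (kernel b v) * h v) \<partial>lborel)"
      unfolding distribution_of_def by (simp add: algebra_simps)
    also have "\<dots> = c * distribution_of (kernel b) f + d * distribution_of (kernel b) h"
      unfolding distribution_of_def using int that by simp
    finally show ?thesis .
  qed
  have "norm (distribution_of (kernel b) f) \<le> (\<integral>v. kernel b v \<partial>lborel) * schwartz_norm 0 f" if f: "f \<in> schwartz_space" for f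
  proof -
    have "norm (distribution_of (kernel b) f) \<le> (\<integral>v. norm (complex_of_real (kernel b v) * f v) \<partial>lborel)"
      unfolding distribution_of_def by (rule integral_norm_bound)
    also have "\<dots> \<le> (\<integral>v. kernel b v * schwartz_norm 0 f \<partial>lborel)"
      using norm_le_schwartz_norm[OF f] kernel_nonneg[OF b]
      by (intro integral_mono integrable_norm int f integrable_mult_left integrable_kernel b)
        (auto simp: norm_mult intro!: mult_left_mono)
    finally show ?thesis by simp
  qed
  then show "\<exists>N C. \<forall>f\<in>schwartz_space. norm (distribution_of (kernel b) f) \<le> C * schwartz_norm N f"
    by blast
qed

text \<open>The symbol grows at most polynomially, while inverse transforms of Schwartz functions decay faster
than any power.\<close>

lemma integrable_symbol_inverse_fourier:
  assumes f: "f \<in> schwartz_space"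
  shows "integrable lborel (\<lambda>\<omega>. of_real ((1 + (norm (R *v \<omega>))\<^sup>2) powr b) * inverse_fourier f \<omega>)"
proof -
  obtain L where L: "L > 0" "\<And>x. norm (R *v x) \<le> L * norm x" using matrix_norm_bound by blast
  obtain N :: nat where N: "b \<le> real N" using real_arch_simple by blast
  obtain C where C: "\<And>\<omega>. norm (inverse_fourier f \<omega>) \<le> C / (1 + norm \<omega>) ^ (2 * N + 4)"
    using inverse_fourier_decay[OF f] by blast
  have [measurable]: "f \<in> borel_measurable borel" by (rule schwartz_measurable[OF f])
  show ?thesis
  proof (rule integrable_of_decay)
    fix \<omega>
    let ?q = "(norm (R *v \<omega>))\<^sup>2" and ?n = "1 + norm \<omega>"
    have n: "?n > 0" by (simp add: add_pos_nonneg)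
    have "(1 + ?q) powr b \<le> (1 + ?q) powr real N" using N by (intro powr_mono) auto
    also have "\<dots> = (1 + ?q) ^ N" by (simp add: powr_realpow add_pos_nonneg)
    also have "1 + ?q \<le> ((1 + L) * ?n)\<^sup>2"
    proof -
      have "norm (R *v \<omega>) \<le> L * norm \<omega>" by (rule L)
      also have "\<dots> \<le> L * ?n" using L by simp
      finally have "1 + norm (R *v \<omega>) \<le> ?n + L * ?n" using norm_ge_zero[of \<omega>] by argo
      then have "(1 + norm (R *v \<omega>))\<^sup>2 \<le> ((1 + L) * ?n)\<^sup>2"
        by (intro power_mono) (simp_all add: algebra_simps)
      moreover have "1 + ?q \<le> (1 + norm (R *v \<omega>))\<^sup>2" by (simp add: power2_sum)
      ultimately show ?thesis by linarith
    qed
    then have "(1 + ?q) ^ N \<le> (((1 + L) * ?n)\<^sup>2) ^ N" by (intro power_mono) auto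
    also have "\<dots> = (1 + L) ^ (2 * N) * ?n ^ (2 * N)" by (simp add: power_mult[symmetric] power_mult_distrib)
    finally have s: "(1 + ?q) powr b \<le> (1 + L) ^ (2 * N) * ?n ^ (2 * N)" .
    have "norm (of_real ((1 + ?q) powr b) * inverse_fourier f \<omega>) = (1 + ?q) powr b * norm (inverse_fourier f \<omega>)"
      by (simp add: norm_mult)
    also have "\<dots> \<le> ((1 + L) ^ (2 * N) * ?n ^ (2 * N)) * (C / ?n ^ (2 * N + 4))"
      using L n by (intro mult_mono s C) auto
    also have "\<dots> = ((1 + L) ^ (2 * N) * C) / ?n ^ 4"
      using n by (simp add: power_add)
    finally show "norm (of_real ((1 + ?q) powr b) * inverse_fourier f \<omega>) \<le> ((1 + L) ^ (2 * N) * C) / ?n ^ 4" .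
  qed measurable
qed

text \<open>Moving the Fourier transform from the test function to the kernel turns the kernel into the
reciprocal of the symbol. The symbol cancels, and the integral of an inverse Fourier transform is
the value at the origin.\<close>

lemma greens_function_kernel:
  assumes b: "b > 1 / 2" shows "greens_function R (2 * b) (kernel b)"
  unfolding greens_function_def greens_distribution_def
proof (intro conjI ballI)
  have b0: "b > 0" using b by simp
  have "has_bochner_integral lborel (\<lambda>v. kernel b (0 - v) * kernel b (0 - v)) (kernel (2 * b) (0 - 0))"
    by (rule kernel_autocorrelation[OF b])
  then show "L2_fun (kernel b)"
    unfolding L2_fun_def by (subst (asm) (1 2) kernel_minus) (simp add: has_bochner_integral_iff power2_eq_square)
  show "tempered_distribution (distribution_of (kernel b))" by (rule tempered_kernel[OF b0])
  fix f :: "real^2 \<Rightarrow> complex" assume f: "f \<in> schwartz_space"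
  let ?s = "\<lambda>\<omega>. complex_of_real ((1 + (norm (R *v \<omega>))\<^sup>2) powr b)"
  let ?\<psi> = "\<lambda>\<omega>. ?s \<omega> * inverse_fourier f \<omega>"
  have "spde_operator R (2 * b) (distribution_of (kernel b)) f = (\<integral>v. complex_of_real (kernel b v) * (\<integral>\<omega>. cis (- 1 * (v \<bullet> \<omega>)) * ?\<psi> \<omega> \<partial>lborel) \<partial>lborel)"
    unfolding spde_operator_def fourier_multiplier_def inverse_fourier_dist_def mult_dist_def fourier_dist_def
      distribution_of_def fourier_def by simp
  also have "\<dots> = (\<integral>\<omega>. (\<integral>v. cis (- 1 * (v \<bullet> \<omega>)) * complex_of_real (kernel b v) \<partial>lborel) * ?\<psi> \<omega> \<partial>lborel)"
    using integrable_kernel[OF b0]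
    by (intro Fubini_multiplication_formula integrable_symbol_inverse_fourier f) (simp add: complex_of_real_integrable_eq)
  also have "\<dots> = (\<integral>\<omega>. inverse_fourier f \<omega> \<partial>lborel)"
  proof (intro Bochner_Integration.integral_cong refl)
    fix \<omega>
    let ?q = "1 + (norm (R *v \<omega>))\<^sup>2"
    have "?q > 0" by (simp add: add_pos_nonneg)
    then have "complex_of_real (?q powr (- b)) * complex_of_real (?q powr b) = 1"
      unfolding of_real_mult[symmetric] by (simp add: powr_add[symmetric])
    moreover have "(\<integral>v. cis (- 1 * (v \<bullet> \<omega>)) * complex_of_real (kernel b v) \<partial>lborel) = complex_of_real (?q powr (- b))"
      using fourier_kernel[OF b0, of \<omega>] by (simp add: has_bochner_integral_iff inner_commute)
    ultimately show "(\<integral>v. cis (- 1 * (v \<bullet> \<omega>)) * complex_of_real (kernel b v) \<partial>lborel) * ?\<psi> \<omega> = inverse_fourier f \<omega>"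
      by (simp only: mult.assoc[symmetric] mult_1)
  qed
  also have "\<dots> = f 0" by (rule integral_inverse_fourier[OF f])
  finally show "spde_operator R (2 * b) (distribution_of (kernel b)) f = dirac f"
    by (simp only: dirac_def)
qed

text \<open>By \<open>greens_function_heat\<close> the difference of two Green's functions has mean zero against all Gaussians.\<close>

theorem greens_function_unique:
  assumes b: "b > 1 / 2" and g: "greens_function R (2 * b) g"
  shows "AE v in lborel. g v = kernel b v"
proof -
  have b0: "b > 0" using b by simp
  note k = greens_function_kernel[OF b]
  have L: "L2_fun g" "L2_fun (kernel b)" using g k by (auto simp: greens_function_def)
  have "AE v in lborel. g v - kernel b v = 0"
  proof (rule L2_zero_if_heat_means_zero[OF L2_fun_diff[OF L]])
    fix a and \<epsilon> :: real assume \<epsilon>: "\<epsilon> > 0"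
    have "(\<integral>v. (g v - kernel b v) * heat \<epsilon> (v - a) \<partial>lborel) = (\<integral>v. g v * heat \<epsilon> (v - a) - kernel b v * heat \<epsilon> (v - a) \<partial>lborel)"
      by (simp add: left_diff_distrib)
    also have "\<dots> = (\<integral>v. g v * heat \<epsilon> (v - a) \<partial>lborel) - (\<integral>v. kernel b v * heat \<epsilon> (v - a) \<partial>lborel)"
      by (intro Bochner_Integration.integral_diff integrable_L2_mult L L2_fun_heat \<epsilon>)
    also have "\<dots> = 0"
      using greens_function_heat[OF g b0 \<epsilon>, of a] greens_function_heat[OF k b0 \<epsilon>, of a] by simp
    finally show "(\<integral>v. (g v - kernel b v) * heat \<epsilon> (v - a) \<partial>lborel) = 0" .
  qed
  then show ?thesis by eventually_elim simp
qed

end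

section \<open>Integrals against white noise\<close>

text \<open>Partial sums of the two expansions converge in the mean, and their inner products are the finite
sums on the left.\<close>

lemma Parseval:
  assumes \<phi>: "orthonormal_basis_L2 \<phi>" and f: "L2_fun f" and h: "L2_fun h"
  shows "(\<lambda>n. \<Sum>j<n. L2_inner f (\<phi> j) * L2_inner h (\<phi> j)) \<longlonglongrightarrow> L2_inner f h"
proof -
  have e: "orthonormal_system lborel \<phi>"
    using \<phi> unfolding orthonormal_basis_L2_def orthonormal_system_def L2_inner_def L2_fun_iff_square_integrable by blast
  have "(\<lambda>n. \<integral>v. (\<Sum>j<n. L2_inner f (\<phi> j) * \<phi> j v) * (\<Sum>j<n. L2_inner h (\<phi> j) * \<phi> j v) \<partial>lborel) \<longlonglongrightarrow> (\<integral>v. f v * h v \<partial>lborel)"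
    using \<phi> f h unfolding orthonormal_basis_L2_def
    by (intro mean_square_limit_mult square_integrable_orthonormal_sum e) (simp_all add: L2_fun_iff_square_integrable)
  then show ?thesis
    unfolding orthonormal_sum_mult[OF e finite_lessThan] L2_inner_def .
qed

locale gaussian_white_noise =
  fixes M :: "'w measure" and \<xi> \<phi>
  assumes white_noise: "white_noise M \<xi> \<phi>"
begin

sublocale prob_space M
  using white_noise by (simp add: white_noise_def)

lemma indep: "indep_vars (\<lambda>_. borel) \<xi> UNIV"
  and distributed_\<xi>: "distributed M lborel (\<xi> j) std_normal_density"
  and basis: "orthonormal_basis_L2 \<phi>"
  using white_noise by (auto simp: white_noise_def)

lemma \<xi>_measurable [measurable]: "\<xi> j \<in> borel_measurable M"
  using distributed_measurable[OF distributed_\<xi>, of j] by simp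

lemma \<xi>_moments:
  "integrable M (\<xi> j)" "expectation (\<xi> j) = 0" "integrable M (\<lambda>\<omega>. (\<xi> j \<omega>)\<^sup>2)" "expectation (\<lambda>\<omega>. (\<xi> j \<omega>)\<^sup>2) = 1"
proof -
  show "integrable M (\<xi> j)"
    using distributed_integrable[OF distributed_\<xi>, of "\<lambda>x. x"] integrable_std_normal_moment[of 1] by simp
  show mean: "expectation (\<xi> j) = 0"
    by (rule standard_normal_distributed_expectation[OF distributed_\<xi>])
  show "integrable M (\<lambda>\<omega>. (\<xi> j \<omega>)\<^sup>2)"
    using distributed_integrable[OF distributed_\<xi>, of "\<lambda>x. x\<^sup>2"] integrable_std_normal_moment[of 2] by simp
  show "expectation (\<lambda>\<omega>. (\<xi> j \<omega>)\<^sup>2) = 1"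
    using standard_normal_distributed_variance[OF distributed_\<xi>, of j] mean by simp
qed

lemma orthonormal_\<xi>: "orthonormal_system M \<xi>"
  unfolding orthonormal_system_def
proof (intro conjI allI)
  show "square_integrable M (\<xi> j)" for j
    by (simp add: square_integrable_def \<xi>_moments)
  show "expectation (\<lambda>\<omega>. \<xi> i \<omega> * \<xi> j \<omega>) = (if i = j then 1 else 0)" for i j
  proof (cases "i = j")
    case False
    have "expectation (\<lambda>\<omega>. \<Prod>k\<in>{i, j}. \<xi> k \<omega>) = (\<Prod>k\<in>{i, j}. expectation (\<xi> k))"
      by (intro indep_vars_lebesgue_integral indep_vars_subset[OF indep] \<xi>_moments) auto
    then show ?thesis using False by (simp add: \<xi>_moments)
  qed (simp add: \<xi>_moments power2_eq_square[symmetric])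
qed

abbreviation coeff_sum :: "(real^2 \<Rightarrow> real) \<Rightarrow> nat \<Rightarrow> 'w \<Rightarrow> real" where
  "coeff_sum f n \<omega> \<equiv> (\<Sum>j<n. L2_inner f (\<phi> j) * \<xi> j \<omega>)"

lemma white_noise_integral_iff:
  "white_noise_integral M \<xi> \<phi> f Y \<longleftrightarrow> L2_fun f \<and> square_integrable M Y \<and>
     (\<lambda>n. expectation (\<lambda>\<omega>. (Y \<omega> - coeff_sum f n \<omega>)\<^sup>2)) \<longlonglongrightarrow> 0"
  unfolding white_noise_integral_def square_integrable_def by (simp add: mult.commute)

lemma square_integrable_coeff_sum: "square_integrable M (coeff_sum f n)"
  by (rule square_integrable_orthonormal_sum[OF orthonormal_\<xi>])

lemma white_noise_integral_mean_zero:
  assumes "white_noise_integral M \<xi> \<phi> f Y"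
  shows "expectation Y = 0"
proof -
  have one: "square_integrable M (\<lambda>_. 1)" by (simp add: square_integrable_def)
  have "(\<lambda>n. expectation (\<lambda>\<omega>. coeff_sum f n \<omega> * 1)) \<longlonglongrightarrow> expectation (\<lambda>\<omega>. Y \<omega> * 1)"
    using assms unfolding white_noise_integral_iff
    by (intro mean_square_limit_mult square_integrable_coeff_sum one) auto
  moreover have "expectation (\<lambda>\<omega>. coeff_sum f n \<omega> * 1) = 0" for n
    using \<xi>_moments by simp
  ultimately show ?thesis by (simp add: LIMSEQ_const_iff)
qed

lemma white_noise_integral_covariance:
  assumes Y: "white_noise_integral M \<xi> \<phi> f Y" and Z: "white_noise_integral M \<xi> \<phi> h Z"
  shows "expectation (\<lambda>\<omega>. Y \<omega> * Z \<omega>) = L2_inner f h"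
proof -
  have "(\<lambda>n. expectation (\<lambda>\<omega>. coeff_sum f n \<omega> * coeff_sum h n \<omega>)) \<longlonglongrightarrow> expectation (\<lambda>\<omega>. Y \<omega> * Z \<omega>)"
    using Y Z unfolding white_noise_integral_iff
    by (intro mean_square_limit_mult square_integrable_coeff_sum) auto
  then have "(\<lambda>n. \<Sum>j<n. L2_inner f (\<phi> j) * L2_inner h (\<phi> j)) \<longlonglongrightarrow> expectation (\<lambda>\<omega>. Y \<omega> * Z \<omega>)"
    unfolding orthonormal_sum_mult[OF orthonormal_\<xi> finite_lessThan] .
  moreover have "(\<lambda>n. \<Sum>j<n. L2_inner f (\<phi> j) * L2_inner h (\<phi> j)) \<longlonglongrightarrow> L2_inner f h"
    using Y Z by (intro Parseval basis) (auto simp: white_noise_integral_iff)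
  ultimately show ?thesis by (rule LIMSEQ_unique)
qed

lemma L2_inner_add_cmult:
  assumes "L2_fun f" "L2_fun h" "L2_fun k"
  shows "L2_inner (\<lambda>v. c * f v + h v) k = c * L2_inner f k + L2_inner h k"
proof -
  have "L2_inner (\<lambda>v. c * f v + h v) k = (\<integral>v. c * (f v * k v) + h v * k v \<partial>lborel)"
    unfolding L2_inner_def by (simp add: algebra_simps)
  also have "\<dots> = c * L2_inner f k + L2_inner h k"
    unfolding L2_inner_def using assms integrable_mult_square_integrable[of lborel f k]
      integrable_mult_square_integrable[of lborel h k] by (simp add: L2_fun_iff_square_integrable)
  finally show ?thesis .
qed

lemma white_noise_integral_add_cmult:
  assumes Y: "white_noise_integral M \<xi> \<phi> f Y" and Z: "white_noise_integral M \<xi> \<phi> h Z"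
  shows "white_noise_integral M \<xi> \<phi> (\<lambda>v. c * f v + h v) (\<lambda>\<omega>. c * Y \<omega> + Z \<omega>)"
  unfolding white_noise_integral_iff
proof (intro conjI)
  have fh: "L2_fun f" "L2_fun h" and YZ: "square_integrable M Y" "square_integrable M Z"
    and lim: "(\<lambda>n. expectation (\<lambda>\<omega>. (Y \<omega> - coeff_sum f n \<omega>)\<^sup>2)) \<longlonglongrightarrow> 0"
      "(\<lambda>n. expectation (\<lambda>\<omega>. (Z \<omega> - coeff_sum h n \<omega>)\<^sup>2)) \<longlonglongrightarrow> 0"
    using Y Z by (auto simp: white_noise_integral_iff)
  show "L2_fun (\<lambda>v. c * f v + h v)"
    using fh by (simp add: L2_fun_iff_square_integrable square_integrable_add square_integrable_cmult)
  show "square_integrable M (\<lambda>\<omega>. c * Y \<omega> + Z \<omega>)"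
    by (intro square_integrable_add square_integrable_cmult YZ)
  let ?u = "\<lambda>n \<omega>. Y \<omega> - coeff_sum f n \<omega>" and ?v = "\<lambda>n \<omega>. Z \<omega> - coeff_sum h n \<omega>"
  have uv: "square_integrable M (?u n)" "square_integrable M (?v n)" for n
    by (intro square_integrable_diff YZ square_integrable_coeff_sum)+
  have "(\<lambda>\<omega>. (c * Y \<omega> + Z \<omega> - coeff_sum (\<lambda>v. c * f v + h v) n \<omega>)\<^sup>2) =
      (\<lambda>\<omega>. c\<^sup>2 * (?u n \<omega>)\<^sup>2 + 2 * c * (?u n \<omega> * ?v n \<omega>) + (?v n \<omega>)\<^sup>2)" for n
  proof
    fix \<omega>
    have "L2_fun (\<phi> j)" for j using basis by (simp add: orthonormal_basis_L2_def)
    then have "coeff_sum (\<lambda>v. c * f v + h v) n \<omega> = c * coeff_sum f n \<omega> + coeff_sum h n \<omega>"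
      using fh by (simp add: L2_inner_add_cmult distrib_right sum.distrib sum_distrib_left mult.assoc)
    moreover have "(c * y + z - (c * s + t))\<^sup>2 = c\<^sup>2 * (y - s)\<^sup>2 + 2 * c * ((y - s) * (z - t)) + (z - t)\<^sup>2" for y z s t :: real
      by algebra
    ultimately show "(c * Y \<omega> + Z \<omega> - coeff_sum (\<lambda>v. c * f v + h v) n \<omega>)\<^sup>2 = c\<^sup>2 * (?u n \<omega>)\<^sup>2 + 2 * c * (?u n \<omega> * ?v n \<omega>) + (?v n \<omega>)\<^sup>2"
      by simp
  qed
  then have eq: "expectation (\<lambda>\<omega>. (c * Y \<omega> + Z \<omega> - coeff_sum (\<lambda>v. c * f v + h v) n \<omega>)\<^sup>2) =
      c\<^sup>2 * expectation (\<lambda>\<omega>. (?u n \<omega>)\<^sup>2) + 2 * c * expectation (\<lambda>\<omega>. ?u n \<omega> * ?v n \<omega>) + expectation (\<lambda>\<omega>. (?v n \<omega>)\<^sup>2)" for n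
    using uv[of n] integrable_mult_square_integrable[OF uv[of n]] by (simp add: square_integrable_def)
  have "(\<lambda>n. expectation (\<lambda>\<omega>. ?u n \<omega> * ?v n \<omega>)) \<longlonglongrightarrow> 0"
    by (rule integral_mult_tendsto_zero[OF uv]) (use tendsto_mult[OF lim] in simp)
  then have "(\<lambda>n. c\<^sup>2 * expectation (\<lambda>\<omega>. (?u n \<omega>)\<^sup>2) + 2 * c * expectation (\<lambda>\<omega>. ?u n \<omega> * ?v n \<omega>) + expectation (\<lambda>\<omega>. (?v n \<omega>)\<^sup>2)) \<longlonglongrightarrow> c\<^sup>2 * 0 + 2 * c * 0 + 0"
    by (intro tendsto_add tendsto_mult tendsto_const lim)
  then show "(\<lambda>n. expectation (\<lambda>\<omega>. (c * Y \<omega> + Z \<omega> - coeff_sum (\<lambda>v. c * f v + h v) n \<omega>)\<^sup>2)) \<longlonglongrightarrow> 0"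
    unfolding eq by simp
qed

lemma white_noise_integral_zero: "white_noise_integral M \<xi> \<phi> (\<lambda>_. 0) (\<lambda>_. 0)"
  by (simp add: white_noise_integral_def L2_fun_def L2_inner_def)

lemma white_noise_integral_sum:
  assumes "\<And>i. i < k \<Longrightarrow> white_noise_integral M \<xi> \<phi> (f i) (Y i)"
  shows "white_noise_integral M \<xi> \<phi> (\<lambda>v. \<Sum>i<k. a i * f i v) (\<lambda>\<omega>. \<Sum>i<(k::nat). a i * Y i \<omega>)"
  using assms
proof (induction k)
  case (Suc k)
  then have "white_noise_integral M \<xi> \<phi> (f k) (Y k)"
    "white_noise_integral M \<xi> \<phi> (\<lambda>v. \<Sum>i<k. a i * f i v) (\<lambda>\<omega>. \<Sum>i<k. a i * Y i \<omega>)" by auto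
  from white_noise_integral_add_cmult[OF this, of "a k"] show ?case by (simp add: add.commute)
qed (simp add: white_noise_integral_zero)

lemma char_coeff_sum:
  "char (distr M borel (coeff_sum f n)) t = complex_of_real (exp (- (t\<^sup>2 * (\<Sum>j<n. (L2_inner f (\<phi> j))\<^sup>2)) / 2))"
proof -
  let ?c = "\<lambda>j. L2_inner f (\<phi> j)"
  have single: "char (distr M borel (\<lambda>\<omega>. ?c j * \<xi> j \<omega>)) t = complex_of_real (exp (- (t\<^sup>2 * (?c j)\<^sup>2) / 2))" for j
  proof -
    have "std_normal_distribution = distr M lborel (\<xi> j)"
      using distributed_distr_eq_density[OF distributed_\<xi>, of j] by simp
    then have "char std_normal_distribution (t * ?c j) = (\<integral>\<omega>. iexp (t * ?c j * \<xi> j \<omega>) \<partial>M)"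
      unfolding char_def by (simp add: integral_distr)
    moreover have "char (distr M borel (\<lambda>\<omega>. ?c j * \<xi> j \<omega>)) t = (\<integral>\<omega>. iexp (t * ?c j * \<xi> j \<omega>) \<partial>M)"
      unfolding char_def by (simp add: integral_distr mult.assoc)
    ultimately show ?thesis
      by (simp add: char_std_normal_distribution power_mult_distrib)
  qed
  have "indep_vars (\<lambda>_. borel) (\<lambda>j \<omega>. ?c j * \<xi> j \<omega>) {..<n}"
    by (rule indep_vars_compose2[OF indep_vars_subset[OF indep]]) auto
  then have "char (distr M borel (coeff_sum f n)) t = (\<Prod>j<n. char (distr M borel (\<lambda>\<omega>. ?c j * \<xi> j \<omega>)) t)"
    by (rule char_distr_sum)
  also have "\<dots> = (\<Prod>j<n. complex_of_real (exp (- (t\<^sup>2 * (?c j)\<^sup>2) / 2)))"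
    unfolding single ..
  also have "\<dots> = complex_of_real (exp (\<Sum>j<n. - (t\<^sup>2 * (?c j)\<^sup>2) / 2))"
    by (simp add: exp_sum)
  also have "(\<Sum>j<n. - (t\<^sup>2 * (?c j)\<^sup>2) / 2) = - (t\<^sup>2 * (\<Sum>j<n. (?c j)\<^sup>2)) / 2"
    by (simp add: sum_distrib_left sum_divide_distrib sum_negf)
  finally show ?thesis .
qed

text \<open>Since \<open>|iexp x - iexp y| \<le> |x - y|\<close>, the characteristic functions differ by at most \<open>|t|\<close> times the mean
distance, which is bounded by the root mean square distance.\<close>

lemma char_mean_square_limit:
  assumes Y: "square_integrable M Y" and X: "\<And>n. square_integrable M (X n)"
    and lim: "(\<lambda>n. expectation (\<lambda>\<omega>. (Y \<omega> - X n \<omega>)\<^sup>2)) \<longlonglongrightarrow> 0"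
  shows "(\<lambda>n. char (distr M borel (X n)) t) \<longlonglongrightarrow> char (distr M borel Y) t"
proof -
  have [measurable]: "Y \<in> borel_measurable M" "\<And>n. X n \<in> borel_measurable M"
    using Y X by (auto dest: square_integrable_measurable)
  have one: "square_integrable M (\<lambda>_. 1)" by (simp add: square_integrable_def)
  let ?d = "\<lambda>n \<omega>. \<bar>Y \<omega> - X n \<omega>\<bar>"
  have d: "square_integrable M (?d n)" for n
    using square_integrable_diff[OF Y X, of n] by (simp add: square_integrable_def)
  have int: "integrable M (?d n)" for n
    using integrable_mult_square_integrable[OF d one] by simp
  have "(\<lambda>n. expectation (\<lambda>\<omega>. ?d n \<omega> * 1)) \<longlonglongrightarrow> 0"
    by (rule integral_mult_tendsto_zero[OF d one]) (use lim in \<open>simp add: prob_space\<close>)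
  then have l: "(\<lambda>n. \<bar>t\<bar> * expectation (?d n)) \<longlonglongrightarrow> 0"
    using tendsto_mult[OF tendsto_const, of _ 0] by force
  have iexp_int: "integrable M (\<lambda>\<omega>. iexp (t * Z \<omega>))" if "Z \<in> borel_measurable M" for Z
    by (rule integrable_const_bound[where B=1]) (use that in auto)
  have "norm (char (distr M borel (X n)) t - char (distr M borel Y) t) \<le> \<bar>t\<bar> * expectation (?d n)" for n
  proof -
    have "norm (char (distr M borel (X n)) t - char (distr M borel Y) t) = norm (\<integral>\<omega>. iexp (t * X n \<omega>) - iexp (t * Y \<omega>) \<partial>M)"
      unfolding char_def using iexp_int by (simp add: integral_distr)
    also have "\<dots> \<le> (\<integral>\<omega>. norm (iexp (t * X n \<omega>) - iexp (t * Y \<omega>)) \<partial>M)"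
      by (rule integral_norm_bound)
    also have "\<dots> \<le> (\<integral>\<omega>. \<bar>t\<bar> * ?d n \<omega> \<partial>M)"
    proof (rule integral_mono)
      show "integrable M (\<lambda>\<omega>. norm (iexp (t * X n \<omega>) - iexp (t * Y \<omega>)))"
        using iexp_int by simp
      show "integrable M (\<lambda>\<omega>. \<bar>t\<bar> * ?d n \<omega>)" using int by simp
      fix \<omega>
      have "iexp (t * X n \<omega>) - iexp (t * Y \<omega>) = iexp (t * X n \<omega>) * (1 - iexp (t * (Y \<omega> - X n \<omega>)))"
        by (simp add: algebra_simps exp_add[symmetric])
      then have "norm (iexp (t * X n \<omega>) - iexp (t * Y \<omega>)) = norm (iexp (t * (Y \<omega> - X n \<omega>)) - 1)"
        by (simp add: norm_mult norm_minus_commute)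
      also have "\<dots> \<le> \<bar>t * (Y \<omega> - X n \<omega>)\<bar>"
        using iexp_approx1[of "t * (Y \<omega> - X n \<omega>)" 0] by simp
      finally show "norm (iexp (t * X n \<omega>) - iexp (t * Y \<omega>)) \<le> \<bar>t\<bar> * ?d n \<omega>" by (simp add: abs_mult)
    qed
    finally show ?thesis by simp
  qed
  then have "(\<lambda>n. char (distr M borel (X n)) t - char (distr M borel Y) t) \<longlonglongrightarrow> 0"
    by (intro Lim_null_comparison[OF _ l]) (simp add: always_eventually)
  then show ?thesis by (rule LIM_zero_cancel)
qed

end

lemma char_normal_density:
  assumes "\<sigma> > 0"
  shows "char (density lborel (normal_density 0 \<sigma>)) t = complex_of_real (exp (- (t\<^sup>2 * \<sigma>\<^sup>2) / 2))"
proof -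
  have "has_bochner_integral lborel (\<lambda>u. cis (- (- t * u)) * complex_of_real (normal_density 0 (sqrt (2 * (\<sigma>\<^sup>2 / 2))) u))
      (complex_of_real (exp (- (\<sigma>\<^sup>2 / 2) * (- t)\<^sup>2)))"
    using assms by (intro fourier_normal_density) simp
  moreover have "sqrt (2 * (\<sigma>\<^sup>2 / 2)) = \<sigma>" using assms by simp
  ultimately have "(\<integral>u. cis (t * u) * complex_of_real (normal_density 0 \<sigma> u) \<partial>lborel) = complex_of_real (exp (- (t\<^sup>2 * \<sigma>\<^sup>2) / 2))"
    by (simp add: has_bochner_integral_iff mult.commute)
  then show ?thesis
    unfolding char_def by (subst integral_density) (simp_all add: cis_conv_exp scaleR_conv_of_real mult.commute)
qed

context gaussian_white_noise
begin

text \<open>The partial sums are normal, and the limit of their characteristic functions is that of a normal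
distribution whose variance is the squared norm of f. A vanishing norm is the degenerate case.\<close>

lemma white_noise_integral_normal:
  assumes Y: "white_noise_integral M \<xi> \<phi> f Y"
  shows "normal_variable M Y"
proof -
  have f: "L2_fun f" and sq: "square_integrable M Y"
    and lim: "(\<lambda>n. expectation (\<lambda>\<omega>. (Y \<omega> - coeff_sum f n \<omega>)\<^sup>2)) \<longlonglongrightarrow> 0"
    using Y by (auto simp: white_noise_integral_iff)
  have [measurable]: "Y \<in> borel_measurable M" using sq by (rule square_integrable_measurable)
  define \<sigma> where "\<sigma> = sqrt (L2_inner f f)"
  have ff: "L2_inner f f \<ge> 0" unfolding L2_inner_def by simp
  then have \<sigma>0: "\<sigma> \<ge> 0" and \<sigma>2: "\<sigma>\<^sup>2 = L2_inner f f" by (simp_all add: \<sigma>_def)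
  have "if \<sigma> = 0 then AE \<omega> in M. Y \<omega> = 0 else distributed M lborel Y (normal_density 0 \<sigma>)"
  proof (cases "\<sigma> = 0")
    case True
    then have "expectation (\<lambda>\<omega>. (Y \<omega>)\<^sup>2) = 0"
      using white_noise_integral_covariance[OF Y Y] \<sigma>2 by (simp add: power2_eq_square)
    then have "AE \<omega> in M. (Y \<omega>)\<^sup>2 = 0"
      using sq by (subst (asm) integral_nonneg_eq_0_iff_AE) (auto simp: square_integrable_def)
    then show ?thesis using True by simp
  next
    case False
    then have \<sigma>: "\<sigma> > 0" using \<sigma>0 by simp
    have "distr M borel Y = density lborel (normal_density 0 \<sigma>)"
    proof (rule Levy_uniqueness)
      show "real_distribution (distr M borel Y)" by simp
      show "real_distribution (density lborel (normal_density 0 \<sigma>))"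
        unfolding real_distribution_def real_distribution_axioms_def
        using prob_space_normal_density[OF \<sigma>, of 0] by simp
      show "char (distr M borel Y) = char (density lborel (normal_density 0 \<sigma>))"
      proof
        fix t
        have "(\<lambda>n. \<Sum>j<n. (L2_inner f (\<phi> j))\<^sup>2) \<longlonglongrightarrow> \<sigma>\<^sup>2"
          using Parseval[OF basis f f] unfolding \<sigma>2 by (simp add: power2_eq_square)
        then have "(\<lambda>n. complex_of_real (exp (- (t\<^sup>2 * (\<Sum>j<n. (L2_inner f (\<phi> j))\<^sup>2)) / 2))) \<longlonglongrightarrow> complex_of_real (exp (- (t\<^sup>2 * \<sigma>\<^sup>2) / 2))"
          by (intro tendsto_of_real tendsto_exp tendsto_divide tendsto_minus tendsto_mult tendsto_const) simp_all
        moreover have "(\<lambda>n. char (distr M borel (coeff_sum f n)) t) \<longlonglongrightarrow> char (distr M borel Y) t"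
          by (rule char_mean_square_limit[OF sq square_integrable_coeff_sum lim])
        ultimately show "char (distr M borel Y) t = char (density lborel (normal_density 0 \<sigma>)) t"
          unfolding char_coeff_sum char_normal_density[OF \<sigma>] by (rule LIMSEQ_unique[rotated])
      qed
    qed
    moreover have "distr M lborel Y = distr M borel Y" by (rule distr_cong) auto
    ultimately show ?thesis using False by (simp add: distributed_def)
  qed
  from conjI[OF \<sigma>0 this]
  have "\<exists>\<mu> \<sigma>. \<sigma> \<ge> 0 \<and> (if \<sigma> = 0 then AE \<omega> in M. Y \<omega> = \<mu> else distributed M lborel Y (normal_density \<mu> \<sigma>))"
    by (rule exI[THEN exI[of _ 0]])
  then show ?thesis by (simp only: normal_variable_def) simp
qed

text \<open>Completeness in the mean, as in the Riesz-Fischer theorem: a subsequence of the partial sums with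
summable mean increments converges almost surely, and Fatou's lemma bounds the mean-square distance
from the limit to the n-th partial sum by the tail of the series of squared coefficients.\<close>

lemma white_noise_integral_exists:
  assumes f: "L2_fun f"
  shows "\<exists>Y. white_noise_integral M \<xi> \<phi> f Y"
proof -
  let ?c = "\<lambda>j. L2_inner f (\<phi> j)" and ?S = "coeff_sum f" and ?L = "L2_inner f f"
  let ?q = "\<lambda>n. \<Sum>j<n. (?c j)\<^sup>2"
  have q: "?q \<longlonglongrightarrow> ?L"
    using Parseval[OF basis f f] by (simp add: power2_eq_square)
  have q_mono: "?q m \<le> ?q n" if "m \<le> n" for m n using that by (intro sum_mono2) auto
  have q_le: "?q n \<le> ?L" for n
    by (rule incseq_le[OF _ q]) (unfold incseq_def, intro allI impI q_mono)
  have dist: "expectation (\<lambda>\<omega>. (?S m \<omega> - ?S n \<omega>)\<^sup>2) = ?q m - ?q n" if "n \<le> m" for m n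
  proof -
    have split: "(\<Sum>j<m. h j) - (\<Sum>j<n. h j) = (\<Sum>j\<in>{n..<m}. h j)" for h :: "nat \<Rightarrow> real"
      using sum_diff_nat_ivl[OF le0 that, of h] by (simp add: atLeast0LessThan)
    have 1: "?S m \<omega> - ?S n \<omega> = (\<Sum>j\<in>{n..<m}. ?c j * \<xi> j \<omega>)" for \<omega>
      by (rule split)
    have 2: "?q m - ?q n = (\<Sum>j\<in>{n..<m}. (?c j)\<^sup>2)"
      by (rule split)
    show ?thesis
      unfolding 1 2 by (rule orthonormal_sum_square[OF orthonormal_\<xi> finite_atLeastLessThan])
  qed
  have "\<forall>k::nat. \<exists>N. ?L - ?q N \<le> (1 / 4) ^ k"
  proof
    fix k :: nat
    have "(\<lambda>n. ?L - ?q n) \<longlonglongrightarrow> 0" using tendsto_diff[OF tendsto_const q, of ?L] by simp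
    from order_tendstoD(2)[OF this, of "(1 / 4) ^ k"]
    have "eventually (\<lambda>n. ?L - ?q n < (1 / 4) ^ k) sequentially" by simp
    from eventually_happens'[OF sequentially_bot this] obtain N where "?L - ?q N < (1 / 4) ^ k" ..
    then show "\<exists>N. ?L - ?q N \<le> (1 / 4) ^ k" by (intro exI[of _ N]) simp
  qed
  from choice[OF this] obtain N where N: "\<And>k. ?L - ?q (N k) \<le> (1 / 4) ^ k" by blast
  \<comment> \<open>A monotone index sequence above N, so that successive partial sums are within \<open>(1 / 2) ^ k\<close>.\<close>
  define r where "r k = k + (\<Sum>i\<le>k. N i)" for k
  have r_mono: "r k \<le> r (Suc k)" for k by (simp add: r_def)
  have r_ge: "k \<le> r k" "N k \<le> r k" for k
  proof -
    have "N k \<le> (\<Sum>i\<le>k. N i)" by (rule member_le_sum) auto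
    then show "k \<le> r k" "N k \<le> r k" by (simp_all add: r_def)
  qed
  have r_small: "?L - ?q (r k) \<le> (1 / 4) ^ k" for k
    using N[of k] q_mono[OF r_ge(2)[of k]] by linarith
  let ?d = "\<lambda>k \<omega>. ?S (r (Suc k)) \<omega> - ?S (r k) \<omega>"
  have sqd: "square_integrable M (?d k)" for k
    by (intro square_integrable_diff square_integrable_coeff_sum)
  have one: "square_integrable M (\<lambda>_. 1)" by (simp add: square_integrable_def)
  have d_small: "expectation (\<lambda>\<omega>. \<bar>?d k \<omega>\<bar>) \<le> (1 / 2) ^ k" and d_int: "integrable M (\<lambda>\<omega>. \<bar>?d k \<omega>\<bar>)" for k
  proof -
    have abs: "square_integrable M (\<lambda>\<omega>. \<bar>?d k \<omega>\<bar>)" using sqd[of k] by (simp add: square_integrable_def)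
    show "integrable M (\<lambda>\<omega>. \<bar>?d k \<omega>\<bar>)" using integrable_mult_square_integrable[OF abs one] by simp
    have "(expectation (\<lambda>\<omega>. \<bar>?d k \<omega>\<bar>))\<^sup>2 \<le> expectation (\<lambda>\<omega>. (?d k \<omega>)\<^sup>2)"
      using Cauchy_Schwarz_integral[OF abs one] by (simp add: prob_space)
    also have "\<dots> = ?q (r (Suc k)) - ?q (r k)" by (rule dist[OF r_mono])
    also have "\<dots> \<le> (1 / 4) ^ k" using r_small[of k] q_le[of "r (Suc k)"] by linarith
    also have "(1 / 4 :: real) ^ k = ((1 / 2) ^ k)\<^sup>2"
    proof -
      have "((1 / 2 :: real) ^ k)\<^sup>2 = ((1 / 2)\<^sup>2) ^ k"
        by (simp only: power_mult[symmetric] mult.commute[of k])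
      also have "(1 / 2 :: real)\<^sup>2 = 1 / 4" by (simp add: power2_eq_square)
      finally show ?thesis by (rule sym)
    qed
    finally show "expectation (\<lambda>\<omega>. \<bar>?d k \<omega>\<bar>) \<le> (1 / 2) ^ k" by (rule power2_le_imp_le) simp
  qed
  have AE_conv: "AE \<omega> in M. convergent (\<lambda>k. ?S (r k) \<omega>)"
  proof -
    have "(\<integral>\<^sup>+\<omega>. (\<Sum>k. ennreal \<bar>?d k \<omega>\<bar>) \<partial>M) = (\<Sum>k. \<integral>\<^sup>+\<omega>. ennreal \<bar>?d k \<omega>\<bar> \<partial>M)"
      by (rule nn_integral_suminf) measurable
    also have "\<dots> \<le> (\<Sum>k. ennreal ((1 / 2) ^ k))"
      using d_small d_int by (intro suminf_le) (auto simp: nn_integral_eq_integral intro!: ennreal_leI)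
    also have "\<dots> = ennreal (\<Sum>k. (1 / 2) ^ k)"
      by (intro suminf_ennreal2) (auto intro: summable_geometric)
    also have "\<dots> < \<infinity>" by simp
    finally have "AE \<omega> in M. (\<Sum>k. ennreal \<bar>?d k \<omega>\<bar>) \<noteq> \<infinity>"
      by (intro nn_integral_PInf_AE) auto
    then show ?thesis
    proof eventually_elim
      case (elim \<omega>)
      then have "summable (\<lambda>k. \<bar>?d k \<omega>\<bar>)" by (intro summable_suminf_not_top) auto
      then have "summable (\<lambda>k. ?d k \<omega>)" by (rule summable_rabs_cancel)
      then have "(\<lambda>n. \<Sum>k<n. ?d k \<omega>) \<longlonglongrightarrow> (\<Sum>k. ?d k \<omega>)" by (rule summable_LIMSEQ)
      then have "(\<lambda>n. ?S (r n) \<omega> - ?S (r 0) \<omega>) \<longlonglongrightarrow> (\<Sum>k. ?d k \<omega>)"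
        by (simp add: sum_lessThan_telescope[of "\<lambda>k. ?S (r k) \<omega>"])
      from tendsto_add[OF this tendsto_const[of "?S (r 0) \<omega>"]]
      show ?case by (auto simp: convergent_def)
    qed
  qed
  define Y where "Y \<omega> = lim (\<lambda>k. ?S (r k) \<omega>)" for \<omega>
  have [measurable]: "Y \<in> borel_measurable M" unfolding Y_def by measurable
  have bound: "(\<integral>\<^sup>+\<omega>. ennreal ((Y \<omega> - ?S n \<omega>)\<^sup>2) \<partial>M) \<le> ennreal (?L - ?q n)" for n
  proof -
    have "(\<integral>\<^sup>+\<omega>. ennreal ((Y \<omega> - ?S n \<omega>)\<^sup>2) \<partial>M) = (\<integral>\<^sup>+\<omega>. liminf (\<lambda>k. ennreal ((?S (r k) \<omega> - ?S n \<omega>)\<^sup>2)) \<partial>M)"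
    proof (rule nn_integral_cong_AE, use AE_conv in eventually_elim)
      case (elim \<omega>)
      then have "(\<lambda>k. ?S (r k) \<omega>) \<longlonglongrightarrow> Y \<omega>" by (simp add: convergent_LIMSEQ_iff Y_def)
      then have "(\<lambda>k. ennreal ((?S (r k) \<omega> - ?S n \<omega>)\<^sup>2)) \<longlonglongrightarrow> ennreal ((Y \<omega> - ?S n \<omega>)\<^sup>2)"
        by (intro tendsto_ennrealI tendsto_power tendsto_diff tendsto_const)
      then show ?case by (rule lim_imp_Liminf[symmetric, OF trivial_limit_sequentially])
    qed
    also have "\<dots> \<le> liminf (\<lambda>k. \<integral>\<^sup>+\<omega>. ennreal ((?S (r k) \<omega> - ?S n \<omega>)\<^sup>2) \<partial>M)"
      by (rule nn_integral_liminf) measurable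
    also have "\<dots> \<le> ennreal (?L - ?q n)"
    proof (rule Liminf_le)
      show "\<forall>\<^sub>F k in sequentially. (\<integral>\<^sup>+\<omega>. ennreal ((?S (r k) \<omega> - ?S n \<omega>)\<^sup>2) \<partial>M) \<le> ennreal (?L - ?q n)"
        using eventually_ge_at_top[of n]
      proof eventually_elim
        case (elim k)
        then have n: "n \<le> r k" using r_ge(1)[of k] by linarith
        have "integrable M (\<lambda>\<omega>. (?S (r k) \<omega> - ?S n \<omega>)\<^sup>2)"
          using square_integrable_diff[OF square_integrable_coeff_sum square_integrable_coeff_sum, of f "r k" f n]
          by (simp add: square_integrable_def)
        then have "(\<integral>\<^sup>+\<omega>. ennreal ((?S (r k) \<omega> - ?S n \<omega>)\<^sup>2) \<partial>M) = ennreal (?q (r k) - ?q n)"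
          by (subst nn_integral_eq_integral) (auto simp: dist[OF n])
        also have "\<dots> \<le> ennreal (?L - ?q n)" using q_le[of "r k"] by (intro ennreal_leI) linarith
        finally show ?case .
      qed
    qed simp
    finally show ?thesis .
  qed
  have int: "integrable M (\<lambda>\<omega>. (Y \<omega> - ?S n \<omega>)\<^sup>2)" for n
  proof (rule integrableI_bounded)
    have "norm ((Y \<omega> - ?S n \<omega>)\<^sup>2) = (Y \<omega> - ?S n \<omega>)\<^sup>2" for \<omega> by simp
    then show "(\<integral>\<^sup>+\<omega>. ennreal (norm ((Y \<omega> - ?S n \<omega>)\<^sup>2)) \<partial>M) < \<infinity>"
      using le_less_trans[OF bound[of n] ennreal_less_top] by simp
  qed measurable
  have le: "expectation (\<lambda>\<omega>. (Y \<omega> - ?S n \<omega>)\<^sup>2) \<le> ?L - ?q n" for n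
  proof -
    have "ennreal (expectation (\<lambda>\<omega>. (Y \<omega> - ?S n \<omega>)\<^sup>2)) \<le> ennreal (?L - ?q n)"
      using bound[of n] by (subst nn_integral_eq_integral[OF int, symmetric]) auto
    then show ?thesis using q_le[of n] by (simp add: ennreal_le_iff)
  qed
  have tail: "(\<lambda>n. ?L - ?q n) \<longlonglongrightarrow> 0" using tendsto_diff[OF tendsto_const q, of ?L] by simp
  have "(\<lambda>n. expectation (\<lambda>\<omega>. (Y \<omega> - ?S n \<omega>)\<^sup>2)) \<longlonglongrightarrow> 0"
    by (rule tendsto_sandwich[OF _ _ tendsto_const tail]) (simp_all add: le)
  moreover have "square_integrable M Y"
    using int[of 0] by (simp add: square_integrable_def)
  ultimately have "white_noise_integral M \<xi> \<phi> f Y"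
    using f unfolding white_noise_integral_iff by blast
  then show ?thesis by (rule exI[of _ Y])
qed

end

section \<open>The Bessel function and the covariance\<close>

lemma exponential_substitution:
  fixes h :: "real \<Rightarrow> real"
  assumes [measurable]: "h \<in> borel_measurable borel"
    and h: "integrable lborel (\<lambda>t. indicator {0<..} t * h t)" and c: "c > 0"
  shows "has_bochner_integral lborel (\<lambda>s. c * exp s * h (c * exp s)) (\<integral>t. indicator {0<..} t * h t \<partial>lborel)"
proof -
  let ?g = "\<lambda>s. c * exp s" and ?I = "\<integral>t. indicator {0<..} t * h t \<partial>lborel"
  have range: "?g ` UNIV = {0::real<..}"
  proof (intro set_eqI iffI)
    fix t :: real assume "t \<in> {0<..}"
    then have "t = ?g (ln (t / c))" using c by simp
    then show "t \<in> ?g ` UNIV" by blast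
  qed (use c in auto)
  have abs: "h absolutely_integrable_on {0<..}"
    using h by (simp add: set_integrable_def integrable_completion)
  have "integral {0<..} h = (LINT t:{0<..}|lebesgue. h t)"
    using set_lebesgue_integral_eq_integral(2)[OF abs] by simp
  also have "\<dots> = ?I"
    by (simp add: set_lebesgue_integral_def integral_completion)
  finally have "h absolutely_integrable_on (?g ` UNIV) \<and> integral (?g ` UNIV) h = ?I"
    using abs range by simp
  then have "(\<lambda>s. \<bar>?g s\<bar> * h (?g s)) absolutely_integrable_on UNIV \<and> integral UNIV (\<lambda>s. \<bar>?g s\<bar> * h (?g s)) = ?I"
    by (subst has_absolute_integral_change_of_variables_1'[where g="?g" and g'="?g"])
       (use c in \<open>auto intro!: derivative_eq_intros inj_onI\<close>)
  moreover have "(\<lambda>s. \<bar>?g s\<bar> * h (?g s)) = (\<lambda>s. ?g s * h (?g s))" using c by (simp add: abs_of_pos)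
  ultimately have 1: "(\<lambda>s. ?g s * h (?g s)) absolutely_integrable_on UNIV" "integral UNIV (\<lambda>s. ?g s * h (?g s)) = ?I"
    by simp_all
  have "integrable lborel (\<lambda>s. ?g s * h (?g s))"
    using 1(1) by (simp add: set_integrable_def integrable_completion)
  then show ?thesis
    using 1(2) integral_lborel[of "\<lambda>s. ?g s * h (?g s)"] by (simp add: has_bochner_integral_iff)
qed

text \<open>Folding the integral at the origin replaces \<open>exp (\<nu> s)\<close> by \<open>2 cosh (\<nu> s)\<close>.\<close>

lemma bessel_K_bilateral:
  assumes "has_bochner_integral lborel (\<lambda>s. exp (\<nu> * s) * exp (- z * cosh s)) I"
  shows "I = 2 * bessel_K \<nu> z"
proof -
  let ?F = "\<lambda>s. exp (\<nu> * s) * exp (- z * cosh s)"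
  have [measurable]: "(cosh :: real \<Rightarrow> real) \<in> borel_measurable borel"
    by (intro borel_measurable_continuous_onI continuous_intros)
  have F: "integrable lborel ?F" "integral\<^sup>L lborel ?F = I"
    using assms by (auto simp: has_bochner_integral_iff)
  have Fm: "integrable lborel (\<lambda>s. ?F (- s))"
    using lborel_integrable_real_affine[OF F(1), of "-1" 0] by simp
  have i: "integrable lborel (\<lambda>s. indicator {0..} s * ?F s)" "integrable lborel (\<lambda>s. indicator {..<0} s * ?F s)"
    "integrable lborel (\<lambda>s. indicator {0..} s * ?F (- s))"
    using integrable_mult_indicator[OF _ F(1), of "{0..}"] integrable_mult_indicator[OF _ F(1), of "{..<0}"]
      integrable_mult_indicator[OF _ Fm, of "{0..}"] by simp_all
  have "I = (\<integral>s. indicator {0..} s * ?F s + indicator {..<0} s * ?F s \<partial>lborel)"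
    unfolding F(2)[symmetric] by (intro Bochner_Integration.integral_cong) (auto simp: indicator_def)
  also have "\<dots> = (\<integral>s. indicator {0..} s * ?F s \<partial>lborel) + (\<integral>s. indicator {..<0} s * ?F s \<partial>lborel)"
    using i by simp
  also have "(\<integral>s. indicator {..<0} s * ?F s \<partial>lborel) = (\<integral>s. indicator {..<0} (0 + - 1 * s) * ?F (0 + - 1 * s) \<partial>lborel)"
    by (subst lborel_integral_real_affine[of "-1" _ 0]) simp_all
  also have "\<dots> = (\<integral>s. indicator {0..} s * ?F (- s) \<partial>lborel)"
    by (rule integral_cong_AE) (use AE_lborel_singleton[of "0::real"] in \<open>auto simp: indicator_def elim!: eventually_mono\<close>)
  also have "(\<integral>s. indicator {0..} s * ?F s \<partial>lborel) + (\<integral>s. indicator {0..} s * ?F (- s) \<partial>lborel)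
      = (\<integral>s. indicator {0..} s * ?F s + indicator {0..} s * ?F (- s) \<partial>lborel)"
    using i by simp
  also have "\<dots> = (\<integral>s. 2 * (indicator {0..} s *\<^sub>R (exp (- z * cosh s) * cosh (\<nu> * s))) \<partial>lborel)"
  proof (intro Bochner_Integration.integral_cong refl)
    fix s
    have "cosh (\<nu> * s) = (exp (\<nu> * s) + exp (\<nu> * - s)) / 2" by (simp add: cosh_field_def)
    then show "indicator {0..} s * ?F s + indicator {0..} s * ?F (- s) = 2 * (indicator {0..} s *\<^sub>R (exp (- z * cosh s) * cosh (\<nu> * s)))"
      by (simp only: cosh_minus real_scaleR_def) (simp add: algebra_simps)
  qed
  also have "\<dots> = 2 * bessel_K \<nu> z"
    unfolding bessel_K_def set_lebesgue_integral_def by (rule integral_mult_right_zero)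
  finally show ?thesis .
qed

context anisotropy
begin

text \<open>The substitution \<open>t = (z / 2) exp s\<close> makes the exponent symmetric: \<open>t + z\<^sup>2 / (4 t)\<close> becomes \<open>z cosh s\<close>.\<close>

lemma kernel_eq_bessel_K:
  assumes \<nu>: "\<nu> > 0" and w: "w \<noteq> 0"
  defines "z \<equiv> norm (A *v w)"
  shows "kernel (\<nu> + 1) w = 2 * (z / 2) powr \<nu> * bessel_K \<nu> z / (Gamma (\<nu> + 1) * (4 * pi * \<bar>det R\<bar>))"
proof -
  have z: "z > 0" unfolding z_def using A_nonzero[OF w] by simp
  let ?G = "Gamma (\<nu> + 1) * (4 * pi * \<bar>det R\<bar>)"
  have G: "?G > 0" using \<nu> det_R by simp
  let ?h = "\<lambda>t. t powr \<nu> * exp (- t) * exp (- z\<^sup>2 / (4 * t)) / (t * ?G)"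
  have eq: "gamma_density (\<nu> + 1) t * heat t w = indicator {0<..} t * ?h t" for t
    by (simp add: gamma_density_def heat_def z_def indicator_def)
  have "integrable lborel (\<lambda>t. indicator {0<..} t * ?h t)"
    unfolding eq[symmetric] using \<nu> w by (intro integrable_gamma_heat) auto
  then have "has_bochner_integral lborel (\<lambda>s. (z / 2) * exp s * ?h ((z / 2) * exp s)) (\<integral>t. indicator {0<..} t * ?h t \<partial>lborel)"
    using z by (intro exponential_substitution) simp_all
  moreover have "(z / 2) * exp s * ?h ((z / 2) * exp s) = (z / 2) powr \<nu> / ?G * (exp (\<nu> * s) * exp (- z * cosh s))" for s
  proof -
    let ?t = "(z / 2) * exp s"
    have t: "?t > 0" using z by simp
    have "?t powr \<nu> = (z / 2) powr \<nu> * exp (\<nu> * s)"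
      using powr_mult[of "z / 2" "exp s" \<nu>] z by (simp only: powr_def[of "exp s"]) simp
    moreover have "exp (- ?t) * exp (- z\<^sup>2 / (4 * ?t)) = exp (- z * cosh s)"
    proof -
      have "z\<^sup>2 / (4 * ?t) = (z / 2) * exp (- s)"
        using z by (simp add: exp_minus power2_eq_square field_simps)
      then have "- ?t + - z\<^sup>2 / (4 * ?t) = - z * cosh s"
        by (simp add: cosh_def algebra_simps)
      then show ?thesis by (simp only: mult_exp_exp)
    qed
    ultimately show ?thesis
      using t G by (simp add: mult.assoc)
  qed
  ultimately have "has_bochner_integral lborel (\<lambda>s. (z / 2) powr \<nu> / ?G * (exp (\<nu> * s) * exp (- z * cosh s))) (kernel (\<nu> + 1) w)"
    by (simp add: kernel_def eq)
  then have "has_bochner_integral lborel (\<lambda>s. ?G / (z / 2) powr \<nu> * ((z / 2) powr \<nu> / ?G * (exp (\<nu> * s) * exp (- z * cosh s)))) (?G / (z / 2) powr \<nu> * kernel (\<nu> + 1) w)"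
    by (rule has_bochner_integral_mult_right)
  moreover have "?G / (z / 2) powr \<nu> * ((z / 2) powr \<nu> / ?G * y) = y" for y
  proof -
    have cancel: "k / p * (p / k * y) = y" if "k > 0" "p > 0" for k p :: real using that by simp
    have "(z / 2) powr \<nu> > 0" using z by simp
    then show ?thesis by (rule cancel[OF G])
  qed
  ultimately have "has_bochner_integral lborel (\<lambda>s. exp (\<nu> * s) * exp (- z * cosh s)) (?G / (z / 2) powr \<nu> * kernel (\<nu> + 1) w)"
    by simp
  note bessel_K_bilateral[OF this]
  moreover have "k = 2 * p * B / g" if "g / p * k = 2 * B" "g > 0" "p > 0" for g p k B :: real
    using that by (simp add: field_simps)
  moreover have "(z / 2) powr \<nu> > 0" using z by simp
  ultimately show ?thesis using G by blast
qed

lemma kernel_0: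
  assumes \<nu>: "\<nu> > 0"
  shows "kernel (\<nu> + 1) 0 = 1 / (4 * pi * \<nu> * \<bar>det R\<bar>)"
proof -
  have "gamma_density (\<nu> + 1) t * heat t 0 = gamma_density (\<nu> + 1) t * t powr (- 1) * (1 / (4 * pi * \<bar>det R\<bar>))" for t
    by (auto simp: gamma_density_def heat_def powr_minus divide_simps)
  then have "kernel (\<nu> + 1) 0 = (\<integral>t. gamma_density (\<nu> + 1) t * t powr (- 1) \<partial>lborel) * (1 / (4 * pi * \<bar>det R\<bar>))"
    unfolding kernel_def by (simp only: integral_mult_left_zero)
  also have "(\<integral>t. gamma_density (\<nu> + 1) t * t powr (- 1) \<partial>lborel) = Gamma (\<nu> + 1 + - 1) / Gamma (\<nu> + 1)"
    using \<nu> by (intro has_bochner_integral_integral_eq gamma_density_moment) auto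
  finally have "kernel (\<nu> + 1) 0 = Gamma \<nu> / Gamma (\<nu> + 1) * (1 / (4 * pi * \<bar>det R\<bar>))" by simp
  moreover have "Gamma (\<nu> + 1) = \<nu> * Gamma \<nu>" using \<nu> Gamma_plus1[of \<nu>] by force
  moreover have "g / (\<nu> * g) * (1 / (4 * pi * \<bar>det R\<bar>)) = 1 / (4 * pi * \<nu> * \<bar>det R\<bar>)" if "g > 0" for g
    using that by (simp add: mult_ac)
  ultimately show ?thesis using Gamma_real_pos[OF \<nu>] by presburger
qed

text \<open>The variance is the value of the kernel at the origin; the powers of 2 and the gamma factors agree by
\<open>Gamma (\<nu> + 1) = \<nu> Gamma \<nu>\<close>.\<close>

lemma matern_kernel:
  assumes \<nu>: "\<nu> > 0" and z: "norm (A *v w) = norm w / \<zeta>"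
  shows "kernel (\<nu> + 1) w = matern (1 / (4 * pi * \<nu> * \<bar>det R\<bar>)) \<nu> \<zeta> (norm w)"
proof (cases "w = 0")
  case False
  have pos: "norm w / \<zeta> > 0" using z A_nonzero[OF False] by (metis zero_less_norm_iff)
  have G: "Gamma (\<nu> + 1) = \<nu> * Gamma \<nu>" using \<nu> Gamma_plus1[of \<nu>] by force
  have G0: "Gamma \<nu> > 0" using \<nu> by simp
  have p: "2 * (norm w / \<zeta> / 2) powr \<nu> = (norm w / \<zeta>) powr \<nu> / 2 powr (\<nu> - 1)"
  proof -
    have "2 * (u / 2) powr \<nu> = u powr \<nu> / 2 powr (\<nu> - 1)" if "u > 0" for u
      using that by (simp add: powr_divide powr_diff)
    then show ?thesis using pos by blast
  qed
  show ?thesis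
    using False \<nu> G0 det_R unfolding kernel_eq_bessel_K[OF \<nu> False] z p G matern_def
    by (simp add: field_simps)
next
  case True
  then show ?thesis by (simp add: kernel_0[OF \<nu>] matern_def)
qed

end

lemma AE_lborel_reflect:
  fixes P :: "real^2 \<Rightarrow> bool"
  assumes P: "AE x in lborel. P x" and [measurable]: "Measurable.pred borel P"
  shows "AE v in lborel. P (w - v)"
proof -
  have "(lborel :: (real^2) measure) = density (distr lborel borel ((-) w)) (\<lambda>_. 1)"
    using lborel_affine[of "- 1" w] by simp
  then have "AE x in density (distr lborel borel ((-) w)) (\<lambda>_. 1). P x"
    using P by (simp only:)
  then show ?thesis by (simp add: AE_density AE_distr_iff)
qed

context gaussian_white_noise
begin

lemma gaussian_field_white_noise_integral:
  assumes x: "\<And>w. \<exists>Y. white_noise_integral M \<xi> \<phi> (f w) Y \<and> x w = (\<lambda>\<omega>. c * Y \<omega>)"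
  shows "gaussian_field M x" and "expectation (x w) = 0"
    and "covariance M (x w) (x w') = c\<^sup>2 * L2_inner (f w) (f w')"
proof -
  have "\<forall>w. \<exists>Y. white_noise_integral M \<xi> \<phi> (f w) Y \<and> x w = (\<lambda>\<omega>. c * Y \<omega>)"
    using x by blast
  from choice[OF this] obtain Y where Y: "\<And>w. white_noise_integral M \<xi> \<phi> (f w) (Y w)"
    and xY: "\<And>w. x w = (\<lambda>\<omega>. c * Y w \<omega>)" by blast
  show mean: "expectation (x w) = 0" for w
    using white_noise_integral_mean_zero[OF Y, of w] by (simp add: xY)
  show "covariance M (x w) (x w') = c\<^sup>2 * L2_inner (f w) (f w')"
  proof -
    have "covariance M (x w) (x w') = expectation (\<lambda>\<omega>. c\<^sup>2 * (Y w \<omega> * Y w' \<omega>))"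
      by (simp add: covariance_def mean) (simp add: xY power2_eq_square mult_ac)
    then show ?thesis
      using white_noise_integral_covariance[OF Y Y, of w w'] by simp
  qed
  show "gaussian_field M x"
    unfolding gaussian_field_def normal_vector_def
  proof (intro allI impI conjI)
    fix k :: nat and p :: "nat \<Rightarrow> real^2"
    have [measurable]: "Y w \<in> borel_measurable M" for w
      using Y[of w] by (simp add: white_noise_integral_def)
    show "x (p i) \<in> borel_measurable M" for i
      unfolding xY by measurable
    fix a :: "nat \<Rightarrow> real"
    have "normal_variable M (\<lambda>\<omega>. \<Sum>i<k. (a i * c) * Y (p i) \<omega>)"
      by (rule white_noise_integral_normal[OF white_noise_integral_sum[OF Y]])
    then show "normal_variable M (\<lambda>\<omega>. \<Sum>i<k. a i * x (p i) \<omega>)"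
      by (simp add: xY mult.assoc)
  qed
qed

end

lemma (in anisotropy) kernel_translate_L2:
  assumes b: "b > 1 / 2"
  shows "L2_fun (\<lambda>v. kernel b (w - v))"
  using kernel_autocorrelation[OF b, of w w]
  by (simp add: L2_fun_def has_bochner_integral_iff power2_eq_square)

text \<open>Inner products do not see the null set on which g may differ from the kernel.\<close>

lemma (in anisotropy) greens_function_autocorrelation:
  assumes b: "b > 1 / 2" and g: "greens_function R (2 * b) g"
  shows "L2_inner (\<lambda>v. g (w - v)) (\<lambda>v. g (w' - v)) = kernel (2 * b) (w - w')"
proof -
  have [measurable]: "g \<in> borel_measurable borel"
    using g L2_fun_borel unfolding greens_function_def by blast
  have ae: "AE v in lborel. g (u - v) = kernel b (u - v)" for u
    by (rule AE_lborel_reflect[OF greens_function_unique[OF b g]]) measurable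
  have "L2_inner (\<lambda>v. g (w - v)) (\<lambda>v. g (w' - v)) = (\<integral>v. kernel b (w - v) * kernel b (w' - v) \<partial>lborel)"
    unfolding L2_inner_def
    by (rule integral_cong_AE) (measurable, use ae[of w] ae[of w'] in \<open>eventually_elim, simp\<close>)
  then show ?thesis
    using kernel_autocorrelation[OF b, of w w'] by (simp add: has_bochner_integral_iff)
qed

text \<open>R is a rotation by \<open>- \<theta>\<close> followed by scaling the axes by l1 and l2, so A is the same rotation
followed by scaling with the reciprocals.\<close>

theorem theorem2:
  fixes M :: "'w measure"
    and \<xi> :: "nat \<Rightarrow> 'w \<Rightarrow> real"
    and \<phi> :: "nat \<Rightarrow> real^2 \<Rightarrow> real"
    and l1 l2 \<theta> \<nu> \<beta> :: real
    and R :: "real^2^2"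
  assumes "l1 > 0" and "l2 > 0"
    and "- pi / 2 < \<theta>" and "\<theta> \<le> pi / 2"
    and "\<nu> > 0" and "\<beta> = \<nu> + 1"
    and "R = vector [vector [l1 * cos \<theta>, l1 * sin \<theta>], vector [- l2 * sin \<theta>, l2 * cos \<theta>]]"
    and "white_noise M \<xi> \<phi>"
  shows "(\<exists>x. spde_solution M \<xi> \<phi> R \<beta> (sqrt (l2 / l1)) x) \<and>
    (\<forall>x. spde_solution M \<xi> \<phi> R \<beta> (sqrt (l2 / l1)) x \<longrightarrow>
       gaussian_field M x \<and>
       (\<forall>w. (\<integral>\<omega>. x w \<omega> \<partial>M) = 0) \<and>
       (\<exists>\<sigma>2>0. \<forall>wi wj \<psi>.
          wi - wj = vector [norm (wi - wj) * cos \<psi>, norm (wi - wj) * sin \<psi>] \<longrightarrow>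
          covariance M (x wi) (x wj) =
            matern \<sigma>2 \<nu>
              (l1 / sqrt ((cos (\<psi> - \<theta>))\<^sup>2 + (l1 / l2)\<^sup>2 * (sin (\<psi> - \<theta>))\<^sup>2))
              (norm (wi - wj))))"
proof -
  note l = \<open>l1 > 0\<close> \<open>l2 > 0\<close> and \<nu> = \<open>\<nu> > 0\<close>
  define A :: "real^2^2" where
    "A = vector [vector [cos \<theta> / l1, sin \<theta> / l1], vector [- sin \<theta> / l2, cos \<theta> / l2]]"
  have pyth: "cos \<theta> * cos \<theta> + sin \<theta> * sin \<theta> = 1"
    using sin_cos_squared_add[of \<theta>] by (simp add: power2_eq_square)
  then have "transpose R ** A = mat 1"
    using l by (simp add: assms(7) A_def vec_eq_iff forall_2 matrix_matrix_mult_def transpose_def mat_def sum_2 mult.commute add.commute)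
  then interpret anisotropy R A by unfold_locales
  interpret gaussian_white_noise M \<xi> \<phi> by unfold_locales (rule assms(8))
  define b where "b = (\<nu> + 1) / 2"
  have b: "b > 1 / 2" and \<beta>: "\<beta> = 2 * b" using \<nu> assms(6) by (simp_all add: b_def)
  have two_b: "2 * b = \<nu> + 1" by (simp add: b_def)
  let ?c = "sqrt (l2 / l1)"
  have detR: "det R = l1 * l2"
  proof -
    have "det R = l1 * cos \<theta> * (l2 * cos \<theta>) - l1 * sin \<theta> * (- l2 * sin \<theta>)"
      by (simp only: assms(7) det_2 vector_2)
    also have "\<dots> = l1 * l2 * (cos \<theta> * cos \<theta> + sin \<theta> * sin \<theta>)" by algebra
    finally show ?thesis by (simp only: pyth mult_1_right)
  qed
  have exists: "\<exists>x. spde_solution M \<xi> \<phi> R \<beta> ?c x"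
  proof -
    have "\<forall>w. \<exists>Y. white_noise_integral M \<xi> \<phi> (\<lambda>v. kernel b (w - v)) Y"
      by (intro allI white_noise_integral_exists kernel_translate_L2 b)
    from choice[OF this] obtain Y where "\<And>w. white_noise_integral M \<xi> \<phi> (\<lambda>v. kernel b (w - v)) (Y w)" by blast
    then have "spde_solution M \<xi> \<phi> R \<beta> ?c (\<lambda>w \<omega>. ?c * Y w \<omega>)"
      unfolding spde_solution_def \<beta> using greens_function_kernel[OF b] by blast
    then show ?thesis by (rule exI[of _ "\<lambda>w \<omega>. ?c * Y w \<omega>"])
  qed
  have scale: "norm (A *v w) = norm w / (l1 / sqrt ((cos (\<psi> - \<theta>))\<^sup>2 + (l1 / l2)\<^sup>2 * (sin (\<psi> - \<theta>))\<^sup>2))"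
    if w: "w = vector [norm w * cos \<psi>, norm w * sin \<psi>]" for w \<psi>
  proof (rule power2_eq_imp_eq)
    let ?q = "(cos (\<psi> - \<theta>))\<^sup>2 + (l1 / l2)\<^sup>2 * (sin (\<psi> - \<theta>))\<^sup>2"
    have w12: "w $ 1 = norm w * cos \<psi>" "w $ 2 = norm w * sin \<psi>"
      using arg_cong[OF w, of "\<lambda>v. v $ 1"] arg_cong[OF w, of "\<lambda>v. v $ 2"] by simp_all
    \<comment> \<open>In polar coordinates the rotation subtracts \<open>\<theta>\<close> from the angle.\<close>
    have 1: "(A *v w) $ 1 = norm w * cos (\<psi> - \<theta>) / l1"
      using l by (simp add: A_def matrix_vector_mult_def sum_2 w12 cos_diff field_simps)
    have 2: "(A *v w) $ 2 = norm w * sin (\<psi> - \<theta>) / l2"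
      using l by (simp add: A_def matrix_vector_mult_def sum_2 w12 sin_diff field_simps)
    have "(norm (A *v w))\<^sup>2 = (norm w)\<^sup>2 * ?q / l1\<^sup>2"
      unfolding norm_2_power2[of "A *v w"] 1 2 using l by (simp add: power_divide power_mult_distrib field_simps)
    also have "\<dots> = (norm w / (l1 / sqrt ?q))\<^sup>2"
      by (simp add: power_divide power_mult_distrib)
    finally show "(norm (A *v w))\<^sup>2 = (norm w / (l1 / sqrt ?q))\<^sup>2" .
  qed (use l in auto)
  show ?thesis
  proof (rule conjI[OF exists], rule allI, rule impI)
    fix x assume sol: "spde_solution M \<xi> \<phi> R \<beta> ?c x"
    from sol obtain g where g: "greens_function R (2 * b) g"
      and x: "\<And>w. \<exists>Y. white_noise_integral M \<xi> \<phi> (\<lambda>v. g (w - v)) Y \<and> x w = (\<lambda>\<omega>. ?c * Y \<omega>)"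
      unfolding spde_solution_def \<beta> by blast
    note field = gaussian_field_white_noise_integral[where f="\<lambda>w v. g (w - v)", OF x]
    \<comment> \<open>The variance of the kernel times \<open>l2 / l1\<close>, where \<open>det R = l1 * l2\<close>.\<close>
    let ?s = "1 / (4 * pi * \<nu> * l1\<^sup>2)"
    have cov: "covariance M (x wi) (x wj) = matern ?s \<nu> (l1 / sqrt ((cos (\<psi> - \<theta>))\<^sup>2 + (l1 / l2)\<^sup>2 * (sin (\<psi> - \<theta>))\<^sup>2)) (norm (wi - wj))"
      if w: "wi - wj = vector [norm (wi - wj) * cos \<psi>, norm (wi - wj) * sin \<psi>]" for wi wj \<psi>
    proof -
      have rescale: "l2 / l1 * matern (1 / (4 * pi * \<nu> * \<bar>det R\<bar>)) \<nu> \<zeta> r = matern ?s \<nu> \<zeta> r" for \<zeta> r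
        using l \<nu> unfolding matern_def detR by (simp add: abs_mult power2_eq_square)
      have "covariance M (x wi) (x wj) = l2 / l1 * kernel (\<nu> + 1) (wi - wj)"
        using field(3)[of wi wj] greens_function_autocorrelation[OF b g, of wi wj] l two_b by simp
      also have "kernel (\<nu> + 1) (wi - wj) = matern (1 / (4 * pi * \<nu> * \<bar>det R\<bar>)) \<nu> (l1 / sqrt ((cos (\<psi> - \<theta>))\<^sup>2 + (l1 / l2)\<^sup>2 * (sin (\<psi> - \<theta>))\<^sup>2)) (norm (wi - wj))"
        by (rule matern_kernel[OF \<nu> scale[OF w]])
      finally show ?thesis by (simp only: rescale)
    qed
    have "?s > 0" using l \<nu> by simp
    then show "gaussian_field M x \<and> (\<forall>w. (\<integral>\<omega>. x w \<omega> \<partial>M) = 0) \<and>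
       (\<exists>\<sigma>2>0. \<forall>wi wj \<psi>.
          wi - wj = vector [norm (wi - wj) * cos \<psi>, norm (wi - wj) * sin \<psi>] \<longrightarrow>
          covariance M (x wi) (x wj) =
            matern \<sigma>2 \<nu>
              (l1 / sqrt ((cos (\<psi> - \<theta>))\<^sup>2 + (l1 / l2)\<^sup>2 * (sin (\<psi> - \<theta>))\<^sup>2))
              (norm (wi - wj)))"
      by (intro conjI allI field(1) field(2) exI[of _ ?s] impI cov)
  qed
qed

end
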